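(* Let $N\ge2$, $v\in\mathbb{R}^N$ with $|v|<1$, $p=2+\frac2N$ and $m>0$. Let $u_a\in\mathcal{S}_a$ be a minimizer for $d_p(a)$, for values $a\in(0,a_v^* )$ accumulating at $a_v^*$. Then, as $a\nearrow a_v^*$ (along these values), $$d_p(a)\to-\infty,\qquad \epsilon_a d_p(a)\to0,\qquad \epsilon_a\int_{\mathbb{R}^N}|u_a|^2\log|u_a|^2\,dx\to0,\qquad \epsilon_a\|u_a\|_{2+\frac2N}^{2+\frac2N}\to\frac{N+1}{N},$$ where $\epsilon_a:=\left(T_v(u_a)\right)^{-1}\to0^+$.
   Context: Functions are complex-valued on $\mathbb{R}^N$; $\|\cdot\|_q$ is the $L^q(\mathbb{R}^N)$ norm; $\hat u$ is the (unitary) Fourier transform. $H^{1/2}(\mathbb{R}^N)$ is the usual fractional Sobolev space and $W^{1/2}(\mathbb{R}^N):=\{\varphi\in H^{1/2}(\mathbb{R}^N): |\varphi|^2\log|\varphi|^2\in L^1(\mathbb{R}^N)\}$ (with $0\log 0=0$). For $m>0$ the operator $\sqrt{-\Delta+m^2}-m$ is the Fourier multiplier with symbol $\sqrt{|k|^2+m^2}-m$, and $\int\bar\varphi(\sqrt{-\Delta+m^2}-m+iv\cdot\nabla)\varphi\,dx$ is understood as the quadratic form $\int_{\mathbb{R}^N}(\sqrt{|k|^2+m^2}-m-v\cdot k)|\hat\varphi(k)|^2\,dk$ on $H^{1/2}(\mathbb{R}^N)$. For $a>0$: $\mathcal{S}_a:=\{\varphi\in W^{1/2}(\mathbb{R}^N):\|\varphi\|_2^2=a\}$,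 and $$E_p(\varphi):=\frac12\int_{\mathbb{R}^N}\bar\varphi(\sqrt{-\Delta+m^2}-m+iv\cdot\nabla)\varphi\,dx-\frac1p\|\varphi\|_p^p-\frac12\int_{\mathbb{R}^N}|\varphi|^2(\log|\varphi|^2-1)\,dx,\qquad d_p(a):=\inf_{\varphi\in\mathcal{S}_a}E_p(\varphi).$$ A minimizer for $d_p(a)$ is a $\varphi\in\mathcal{S}_a$ with $E_p(\varphi)=d_p(a)$. Let $T_v(u):=\int_{\mathbb{R}^N}\bar u(\sqrt{-\Delta}+iv\cdot\nabla)u\,dx=\int_{\mathbb{R}^N}(|k|-v\cdot k)|\hat u|^2\,dk$. Set $a_v^*:=\|Q_v\|_2^2$, where $Q_v\in H^{1/2}(\mathbb{R}^N)\setminus\{0\}$ solves $(\sqrt{-\Delta}+iv\cdot\nabla)u+u=|u|^{2/N}u$ and attains equality in the sharp Gagliardo–Nirenberg type inequality, valid for all $u\in H^{1/2}(\mathbb{R}^N)$, $$\|u\|_{2+\frac2N}^{2+\frac2N}\le\frac{N+1}{N\|Q_v\|_2^{2/N}}\,T_v(u)\,\|u\|_2^{2/N}.$$ Such $Q_v$ is known to exist, and the number $a_v^*$ is well defined (independent of the choice of $Q_v$). *)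

theory Defs
  imports "HOL-Analysis.Analysis"
begin

text \<open>
  Functions on \<open>\<real>\<^sup>N\<close> are Borel representatives \<open>'a \<Rightarrow> complex\<close> of their almost-everywhere classes;
  every notion below is invariant under changes on null sets.
\<close>

definition square_integrable :: "('a::euclidean_space \<Rightarrow> complex) \<Rightarrow> bool" where
  "square_integrable u \<longleftrightarrow>
     u \<in> borel_measurable lborel \<and> integrable lborel (\<lambda>x. (norm (u x))\<^sup>2)"

definition Lp_norm :: "real \<Rightarrow> ('a::euclidean_space \<Rightarrow> complex) \<Rightarrow> real" where
  "Lp_norm q u = (LINT x|lborel. norm (u x) powr q) powr (1 / q)"

definition fourier_integral :: "('a::euclidean_space \<Rightarrow> complex) \<Rightarrow> 'a \<Rightarrow> complex" where
  "fourier_integral u k =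
     complex_of_real ((2 * pi) powr (- real DIM('a) / 2)) *
     (LINT x|lborel. cis (- (k \<bullet> x)) * u x)"

text \<open>
  The unitary Fourier transform on \<open>L\<^sup>2\<close> is the \<open>L\<^sup>2\<close> limit of the Fourier integrals of the
  truncations of \<open>u\<close> to balls, which lie in \<open>L\<^sup>1 \<inter> L\<^sup>2\<close>. The limit is unique up to null sets, so
  the choice in \<open>fourier\<close> affects none of the integrals in which it is used.
\<close>

definition is_fourier_transform ::
    "('a::euclidean_space \<Rightarrow> complex) \<Rightarrow> ('a \<Rightarrow> complex) \<Rightarrow> bool" where
  "is_fourier_transform u g \<longleftrightarrow>
     square_integrable g \<and>
     ((\<lambda>R. \<integral>\<^sup>+ k. ennreal ((norm (g k -
          fourier_integral (\<lambda>x. indicator (cball 0 R) x *\<^sub>R u x) k))\<^sup>2) \<partial>lborel) \<longlongrightarrow> 0) at_top"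

definition fourier :: "('a::euclidean_space \<Rightarrow> complex) \<Rightarrow> 'a \<Rightarrow> complex" where
  "fourier u = (SOME g. is_fourier_transform u g)"

definition sobolev_H :: "real \<Rightarrow> ('a::euclidean_space \<Rightarrow> complex) set" where
  "sobolev_H s =
     {u. square_integrable u \<and>
         integrable lborel (\<lambda>k. (1 + (norm k)\<^sup>2) powr s * (norm (fourier u k))\<^sup>2)}"

text \<open>The convention \<open>0 log 0 = 0\<close> holds automatically, by the factor \<open>0\<close>.\<close>

definition W_half :: "('a::euclidean_space \<Rightarrow> complex) set" where
  "W_half = {u \<in> sobolev_H (1/2).
     integrable lborel (\<lambda>x. (norm (u x))\<^sup>2 * ln ((norm (u x))\<^sup>2))}"

definition mass_sphere :: "real \<Rightarrow> ('a::euclidean_space \<Rightarrow> complex) set" where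
  "mass_sphere a = {u \<in> W_half. (Lp_norm 2 u)\<^sup>2 = a}"

text \<open>With \<open>\<nabla>\<close> acting as \<open>\<i>k\<close> on the Fourier side, \<open>\<i>v\<cdot>\<nabla>\<close> has symbol \<open>-v\<cdot>k\<close>.\<close>

definition kinetic :: "real \<Rightarrow> 'a \<Rightarrow> ('a::euclidean_space \<Rightarrow> complex) \<Rightarrow> real" where
  "kinetic m v u =
     (LINT k|lborel. (sqrt ((norm k)\<^sup>2 + m\<^sup>2) - m - v \<bullet> k) * (norm (fourier u k))\<^sup>2)"

definition T :: "'a \<Rightarrow> ('a::euclidean_space \<Rightarrow> complex) \<Rightarrow> real" where
  "T v u = (LINT k|lborel. (norm k - v \<bullet> k) * (norm (fourier u k))\<^sup>2)"

definition energy :: "real \<Rightarrow> 'a \<Rightarrow> real \<Rightarrow> ('a::euclidean_space \<Rightarrow> complex) \<Rightarrow> real" where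
  "energy m v p u =
     1/2 * kinetic m v u - 1/p * Lp_norm p u powr p
     - 1/2 * (LINT x|lborel. (norm (u x))\<^sup>2 * (ln ((norm (u x))\<^sup>2) - 1))"

text \<open>The infimum is taken in the extended reals, so it is \<open>-\<infinity>\<close> if the energy is unbounded below.\<close>

definition min_energy :: "real \<Rightarrow> 'a::euclidean_space \<Rightarrow> real \<Rightarrow> real \<Rightarrow> ereal" where
  "min_energy m v p a = (INF u\<in>mass_sphere a. ereal (energy m v p u))"

definition is_minimizer ::
    "real \<Rightarrow> 'a \<Rightarrow> real \<Rightarrow> real \<Rightarrow> ('a::euclidean_space \<Rightarrow> complex) \<Rightarrow> bool" where
  "is_minimizer m v p a u \<longleftrightarrow>
     u \<in> mass_sphere a \<and> ereal (energy m v p u) = min_energy m v p a"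

text \<open>
  Weak form, tested against \<open>H\<^bsup>1/2\<^esup>\<close>, of
  \<open>(\<surd>(-\<Delta>) + \<i>v\<cdot>\<nabla>)u + u = |u|\<^bsup>2/N\<^esup>u\<close>.
\<close>

definition solves_Q_equation :: "'a \<Rightarrow> ('a::euclidean_space \<Rightarrow> complex) \<Rightarrow> bool" where
  "solves_Q_equation v u \<longleftrightarrow>
     (\<forall>\<phi>\<in>sobolev_H (1/2).
        (LINT k|lborel. complex_of_real (norm k - v \<bullet> k) * fourier u k * cnj (fourier \<phi> k))
        + (LINT x|lborel. u x * cnj (\<phi> x))
        = (LINT x|lborel. complex_of_real (norm (u x) powr (2 / real DIM('a))) * u x * cnj (\<phi> x)))"

text \<open>
  \<open>is_Q v Q\<close> says that \<open>Q\<close> is an admissible choice of \<open>Q\<^sub>v\<close>: a nonzero solution that attains equality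
  in the Gagliardo-Nirenberg type inequality, whose constant is expressed through \<open>Q\<close> itself.
\<close>

definition is_Q :: "'a \<Rightarrow> ('a::euclidean_space \<Rightarrow> complex) \<Rightarrow> bool" where
  "is_Q v Q \<longleftrightarrow>
     (let N = real DIM('a); p = 2 + 2 / N;
          C = (N + 1) / (N * Lp_norm 2 Q powr (2 / N))
      in Q \<in> sobolev_H (1/2) \<and> \<not> (AE x in lborel. Q x = 0) \<and> solves_Q_equation v Q \<and>
         (\<forall>u\<in>sobolev_H (1/2). Lp_norm p u powr p \<le> C * T v u * Lp_norm 2 u powr (2 / N)) \<and>
         Lp_norm p Q powr p = C * T v Q * Lp_norm 2 Q powr (2 / N))"

end

theory Submission
  imports Defs "HOL-Probability.Probability"
begin

text \<open>
  Write \<open>t\<close> for \<open>T\<^sub>v(u)\<close>, \<open>k\<close> for the kinetic term with mass \<open>m\<close>, \<open>P\<close> for \<open>\<integral>|u|\<^sup>p\<close> and \<open>S\<close> for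
  \<open>\<integral>|u|\<^sup>2 ln |u|\<^sup>2\<close>, so that a function of mass \<open>a\<close> has energy \<open>k/2 - P/p - S/2 + a/2\<close>. The symbols of
  \<open>k\<close> and \<open>t\<close> differ by at most \<open>m\<close>, so \<open>k = t + O(1)\<close>. Below the critical mass the sharp
  Gagliardo-Nirenberg inequality gives \<open>P/p \<le> t/2\<close>, hence energy \<open>\<ge> -S/2 - O(1)\<close>. A logarithm grows
  slower than a power, hence also \<open>S \<le> \<delta>t + c(\<delta>)\<close> for every \<open>\<delta> > 0\<close>. Thus everything follows once the
  minimal energy is known to tend to \<open>-\<infinity>\<close>: this forces \<open>S \<rightarrow> \<infinity>\<close>, then \<open>t \<rightarrow> \<infinity>\<close> and \<open>S = o(t)\<close>; the energy
  lies between \<open>-S/2 - O(1)\<close> and \<open>0\<close> and is therefore \<open>o(t)\<close>; and the formula for the energy leaves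
  \<open>P/t \<rightarrow> p/2 = (N+1)/N\<close>.

  That the minimal energy tends to \<open>-\<infinity>\<close> is seen on the ground state \<open>Q\<close>, multiplied by a constant to get
  mass \<open>a\<close> and concentrated at length \<open>1/\<tau>\<close> (\<open>min_energy_le_trial\<close>). The first two terms of the energy are
  then at most \<open>\<tau>(1 - \<sigma>\<^bsup>1/N\<^esup>) T\<^sub>v(Q)/2\<close> with \<open>\<sigma> = a/a\<^sup>*\<close>, which stays bounded for
  \<open>\<tau> = 1/(1 - \<sigma>\<^bsup>1/N\<^esup>) \<rightarrow> \<infinity>\<close>, while concentration adds \<open>-(aN/2) ln \<tau>\<close> through the entropy.

  This argument rests on two analytic facts. The first is that \<open>Q\<close> has finite entropy, that is, belongs to
  \<open>W\<^bsup>1/2\<^esup>\<close> (\<open>ground_state_in_W_half\<close>). Multiplication by \<open>sin (h\<cdot>x)\<close> turns into a difference of two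
  translations under the Fourier transform, and the symbol \<open>|k| - v\<cdot>k\<close> is Lipschitz; so the equation for
  \<open>Q\<close>, tested against \<open>sin\<^sup>2(h\<cdot>x) Q\<close>, controls the localised energy up to \<open>O(|h|)\<close>, and the inequality itself
  absorbs the nonlinear term. The outcome \<open>\<integral>sin\<^sup>2(h\<cdot>x)|Q|\<^sup>2 \<le> K|h|\<close> (\<open>ground_state_decay\<close>), summed over dyadic
  \<open>h\<close>, bounds a logarithmic moment of \<open>|Q|\<^sup>2\<close>, which in turn bounds the entropy.

  The second is that \<open>|u|\<^sup>p\<close> is integrable for every \<open>u\<close> in \<open>H\<^bsup>1/2\<^esup>\<close> (\<open>sobolev_integrable_power\<close>). A Bochner
  integral is \<open>0\<close> when the integrand is not integrable, so the assumed inequality alone does not say this.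
  It does so for averages of \<open>u\<close> over small balls, which are bounded and have no larger kinetic form, and
  Fatou's lemma passes to \<open>u\<close>.

  Both need the Fourier transform on \<open>L\<^sup>2\<close> to exist and to obey the rules for dilations, modulations and
  convolutions. This is derived from the contraction property \<open>l2sq_fourier_integral_le\<close> of Fourier
  integrals, proved with a Gaussian cutoff, and from completeness of \<open>L\<^sup>2\<close>.
\<close>

section \<open>Square-integrable functions\<close>

abbreviation Borel :: "('a::topological_space \<Rightarrow> 'b::topological_space) set" where
  "Borel \<equiv> borel_measurable borel"

abbreviation norm2 :: "'a::real_normed_vector \<Rightarrow> real" where
  "norm2 z \<equiv> (norm z)^2"

text \<open>The nonnegative counterpart of \<open>LBINT\<close>.\<close>

abbreviation nn_lborel :: "('a::euclidean_space \<Rightarrow> ennreal) \<Rightarrow> ennreal" (binder "NNI " 10) where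
  "nn_lborel f \<equiv> integral\<^sup>N lborel f"

text \<open>Qualified because the Henstock-Kurzweil integral has facts with the same base names.\<close>

lemmas LB_cong = Bochner_Integration.integral_cong
lemmas LB_nonneg = Bochner_Integration.integral_nonneg
lemmas LB_add = Bochner_Integration.integral_add
lemmas LB_diff = Bochner_Integration.integral_diff
lemmas int_add = Bochner_Integration.integrable_add
lemmas int_diff = Bochner_Integration.integrable_diff
lemmas int_sum = Bochner_Integration.integrable_sum
lemmas int_bound = Bochner_Integration.integrable_bound

lemma integrable_dominated:
  fixes f :: "'a::euclidean_space \<Rightarrow> 'b::{banach, second_countable_topology}"
  assumes "integrable lborel g" "f \<in> Borel" "\<And>x. norm (f x) \<le> g x"
  shows "integrable lborel f"
proof (rule int_bound[OF assms(1)])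
  have "g x \<ge> 0" for x using assms(3)[of x] norm_ge_zero[of "f x"] by linarith
  thus "AE x in lborel. norm (f x) \<le> norm (g x)" using assms(3) by simp
qed (use assms(2) in simp)

lemma norm2_add_le: "norm2 (a + b :: 'a::real_normed_vector) \<le> 2 * norm2 a + 2 * norm2 b"
proof -
  have "norm2 (a + b) \<le> (norm a + norm b)^2"
    by (intro power_mono norm_triangle_ineq) auto
  also have "\<dots> \<le> 2 * norm2 a + 2 * norm2 b"
    using zero_le_power2[of "norm a - norm b"] by (simp add: power2_eq_square algebra_simps)
  finally show ?thesis .
qed

text \<open>
  The squared \<open>L\<^sup>2\<close> norm with values in the extended reals: no integrability has to be known
  before it is estimated.
\<close>

definition l2sq :: "('a::euclidean_space \<Rightarrow> complex) \<Rightarrow> ennreal" where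
  "l2sq f = (NNI x. ennreal (norm2 (f x)))"

abbreviation l2dist :: "('a::euclidean_space \<Rightarrow> complex) \<Rightarrow> ('a \<Rightarrow> complex) \<Rightarrow> ennreal" where
  "l2dist f g \<equiv> l2sq (\<lambda>x. f x - g x)"

lemma L2_iff:
  "square_integrable f \<longleftrightarrow> f \<in> Borel \<and> l2sq f < \<infinity>"
  unfolding square_integrable_def l2sq_def integrable_iff_bounded by auto

lemma square_integrable_measurable [measurable_dest]:
  "square_integrable f \<Longrightarrow> f \<in> Borel"
  by (simp add: square_integrable_def)

lemma l2sq_eq_integral:
  assumes "square_integrable f"
  shows "l2sq f = ennreal (LBINT x. norm2 (f x))"
  using assms unfolding l2sq_def square_integrable_def
  by (subst nn_integral_eq_integral) auto

text \<open>
  The constant \<open>2\<close> stands in for Minkowski's inequality; it suffices for all convergence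
  statements below.
\<close>

lemma l2sq_add_le:
  assumes [measurable]: "f \<in> Borel" "g \<in> Borel"
  shows "l2sq (\<lambda>x. f x + g x) \<le> 2 * l2sq f + 2 * l2sq g"
proof -
  have "ennreal (norm2 (f x + g x)) \<le> 2 * ennreal (norm2 (f x)) + 2 * ennreal (norm2 (g x))" for x
    using norm2_add_le[of "f x" "g x"]
    by (simp add: ennreal_leI flip: ennreal_plus ennreal_mult' ennreal_numeral)
  hence "l2sq (\<lambda>x. f x + g x)
      \<le> (NNI x. (2 * ennreal (norm2 (f x)) + 2 * ennreal (norm2 (g x))))"
    unfolding l2sq_def by (intro nn_integral_mono)
  also have "\<dots> = 2 * l2sq f + 2 * l2sq g"
    unfolding l2sq_def by (subst nn_integral_add) (auto simp: nn_integral_cmult)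
  finally show ?thesis .
qed

lemma l2sq_cmult:
  assumes [measurable]: "f \<in> Borel"
  shows "l2sq (\<lambda>x. c * f x) = ennreal (norm2 c) * l2sq f"
  unfolding l2sq_def by (simp add: norm_mult power_mult_distrib ennreal_mult nn_integral_cmult)

lemma l2sq_diff_swap: "l2dist f g = l2dist g f"
  unfolding l2sq_def by (simp add: norm_minus_commute)

lemma l2sq_diff_le:
  assumes [measurable]: "f \<in> Borel" "g \<in> Borel" "h \<in> Borel"
  shows "l2dist f h \<le> 2 * l2dist f g + 2 * l2dist g h"
  using l2sq_add_le[of "\<lambda>x. f x - g x" "\<lambda>x. g x - h x"] by simp

lemma l2sq_mono:
  assumes "\<And>x. norm (f x) \<le> norm (g x)" shows "l2sq f \<le> l2sq g"
  unfolding l2sq_def using assms by (intro nn_integral_mono ennreal_leI power_mono) auto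

lemma L2_add:
  assumes "square_integrable f" "square_integrable g"
  shows "square_integrable (\<lambda>x. f x + g x)"
  using assms l2sq_add_le[of f g] unfolding L2_iff
  by (auto simp: ennreal_mult_less_top ennreal_add_less_top intro: le_less_trans)

lemma L2_bounded_mult:
  assumes "square_integrable f" and [measurable]: "b \<in> Borel"
    and "\<And>x. norm (b x) \<le> 1"
  shows "square_integrable (\<lambda>x. b x * f x)"
proof -
  have "l2sq (\<lambda>x. b x * f x) \<le> l2sq f"
    using assms(3) by (intro l2sq_mono) (simp add: norm_mult mult_left_le_one_le)
  thus ?thesis using assms unfolding L2_iff by auto
qed

lemma L2_cmult:
  assumes "square_integrable f" shows "square_integrable (\<lambda>x. c * f x)"
  using assms unfolding L2_iff
  by (auto simp: l2sq_cmult ennreal_mult_less_top)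

lemma L2_diff:
  assumes "square_integrable f" "square_integrable g"
  shows "square_integrable (\<lambda>x. f x - g x)"
  using L2_add[OF assms(1) L2_cmult[OF assms(2), of "-1"]] by simp

lemma l2sq_eq_0_AE:
  assumes [measurable]: "f \<in> Borel" and "l2sq f = 0"
  shows "AE x in lborel. f x = 0"
  using assms(2) unfolding l2sq_def by (subst (asm) nn_integral_0_iff_AE) (auto simp: ennreal_eq_0_iff)

lemma l2sq_limit_unique:
  assumes [measurable]: "f \<in> Borel" "g \<in> Borel"
    "\<And>i. h i \<in> Borel" and "F \<noteq> bot"
    and "((\<lambda>i. l2dist f (h i)) \<longlongrightarrow> 0) F" "((\<lambda>i. l2dist g (h i)) \<longlongrightarrow> 0) F"
  shows "AE x in lborel. f x = g x"
proof -
  have "l2dist f g \<le> 2 * l2dist f (h i) + 2 * l2dist g (h i)" for i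
    using l2sq_diff_le[of f "h i" g] by (simp add: l2sq_diff_swap[of g])
  moreover have "((\<lambda>i. 2 * l2dist f (h i) + 2 * l2dist g (h i)) \<longlongrightarrow> 2 * 0 + 2 * 0) F"
    using assms(5,6) by (intro tendsto_add ennreal_tendsto_cmult) auto
  ultimately have "l2dist f g \<le> 2 * 0 + 2 * 0"
    using assms(4) by (intro tendsto_lowerbound[of _ "2*0+2*0" F]) auto
  hence "AE x in lborel. f x - g x = 0"
    by (intro l2sq_eq_0_AE) auto
  thus ?thesis by simp
qed

lemma tendsto_ennreal_0I:
  assumes "\<And>e. e > 0 \<Longrightarrow> \<forall>\<^sub>F i in F. f i \<le> ennreal e"
  shows "(f \<longlongrightarrow> (0::ennreal)) F"
proof (rule order_tendstoI)
  fix a :: ennreal assume "0 < a"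
  then obtain b where b: "0 < b" "b < a" using dense by blast
  then obtain e where e: "0 < ennreal e" "ennreal e < a" by (cases b) auto
  show "\<forall>\<^sub>F i in F. f i < a"
  proof -
    have "\<forall>\<^sub>F i in F. f i \<le> ennreal e" using e(1) by (intro assms) (simp add: ennreal_less_zero_iff)
    thus ?thesis by eventually_elim (rule le_less_trans[OF _ e(2)])
  qed
qed auto

lemma l2sq_Fatou:
  assumes [measurable]: "\<And>i. f i \<in> Borel"
    and "AE x in lborel. (\<lambda>i. f i x) \<longlonglongrightarrow> g x" and "\<And>i::nat. l2sq (f i) \<le> C"
  shows "l2sq g \<le> C"
proof -
  have "l2sq g \<le> (NNI x. liminf (\<lambda>i. ennreal (norm2 (f i x))))"
    unfolding l2sq_def
  proof (intro nn_integral_mono_AE, use assms(2) in eventually_elim)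
    case (elim x)
    have "(\<lambda>i. ennreal (norm2 (f i x))) \<longlonglongrightarrow> ennreal (norm2 (g x))"
      using elim by (intro tendsto_intros tendsto_ennrealI)
    thus ?case by (subst lim_imp_Liminf) auto
  qed
  also have "\<dots> \<le> liminf (\<lambda>i. l2sq (f i))"
    unfolding l2sq_def by (intro nn_integral_liminf) auto
  also have "\<dots> \<le> C"
    by (rule Liminf_le) (use assms(3) in auto)
  finally show ?thesis .
qed

text \<open>
  Riesz-Fischer. Along a subsequence whose increments have squared norm at most \<open>8\<^bsup>-j\<^esup>\<close> the series
  \<open>\<Sum>4\<^sup>j|f\<^bsub>r(j+1)\<^esub> - f\<^bsub>r(j)\<^esub>|\<^sup>2\<close> is finite almost everywhere, so the increments are \<open>O(2\<^bsup>-j\<^esup>)\<close> at almost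
  every point and the subsequence converges there; Fatou's lemma turns this into convergence
  of the whole sequence in \<open>L\<^sup>2\<close>.
\<close>

lemma l2sq_complete:
  fixes f :: "nat \<Rightarrow> 'a::euclidean_space \<Rightarrow> complex"
  assumes [measurable]: "\<And>i. f i \<in> Borel"
    and Cauchy: "\<And>e. e > 0 \<Longrightarrow> \<exists>n0. \<forall>i\<ge>n0. \<forall>j\<ge>n0. l2dist (f i) (f j) \<le> ennreal e"
  obtains g where "g \<in> Borel" "(\<lambda>i. l2dist g (f i)) \<longlonglongrightarrow> 0"
proof -
  let ?e = "\<lambda>i j. l2dist (f i) (f j)"
  define N where "N e = (SOME n0. \<forall>i\<ge>n0. \<forall>j\<ge>n0. ?e i j \<le> ennreal e)" for e
  have N: "?e i j \<le> ennreal e" if "e > 0" "i \<ge> N e" "j \<ge> N e" for e i j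
    using someI_ex[OF Cauchy[OF that(1)]] that(2,3) unfolding N_def by blast
  \<comment> \<open>Indices beyond the Cauchy threshold for \<open>8\<^bsup>-j\<^esup>\<close>, kept strictly increasing.\<close>
  define r where "r = rec_nat (N 1) (\<lambda>j k. max (Suc k) (N ((1/8) ^ Suc j)))"
  have r_Suc: "r (Suc j) = max (Suc (r j)) (N ((1/8) ^ Suc j))" for j by (simp add: r_def)
  have r_ge: "r j \<ge> N ((1/8) ^ j)" for j by (cases j) (simp_all add: r_Suc, simp add: r_def)
  have "strict_mono r" by (rule strict_monoI_Suc) (simp add: r_Suc less_max_iff_disj)
  have d_le: "?e (r (Suc j)) (r j) \<le> ennreal ((1/8)^j)" for j
    using r_ge[of j] \<open>strict_mono r\<close> by (intro N) (auto simp: r_Suc)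
  define d where "d j x = ennreal (4^j * norm2 (f (r (Suc j)) x - f (r j) x))" for j x
  have [measurable]: "d j \<in> Borel" for j unfolding d_def by measurable
  have "(NNI x. (\<Sum>j. d j x)) = (\<Sum>j. NNI x. d j x)"
    by (intro nn_integral_suminf) auto
  also have "\<dots> \<le> (\<Sum>j. ennreal ((1/2)^j))"
  proof (intro suminf_le summableI)
    fix j
    have "(NNI x. d j x) = ennreal (4^j) * ?e (r (Suc j)) (r j)"
      unfolding d_def l2sq_def by (simp add: ennreal_mult nn_integral_cmult)
    also have "\<dots> \<le> ennreal (4^j) * ennreal ((1/8)^j)"
      by (intro mult_left_mono d_le) auto
    also have "\<dots> = ennreal ((1/2)^j)"
      by (simp flip: ennreal_mult power_mult_distrib)
    finally show "(NNI x. d j x) \<le> ennreal ((1/2)^j)" .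
  qed
  also have "\<dots> = ennreal (\<Sum>j. (1/2)^j)"
    by (intro suminf_ennreal_eq) (auto intro!: summable_sums)
  finally have "(NNI x. (\<Sum>j. d j x)) < \<infinity>" by (auto simp: less_top[symmetric] top_unique)
  hence "AE x in lborel. (\<Sum>j. d j x) \<noteq> \<infinity>"
    by (intro nn_integral_noteq_infinite) auto
  hence conv: "AE x in lborel. convergent (\<lambda>j. f (r j) x)"
  proof eventually_elim
    case (elim x)
    then obtain M where M: "M \<ge> 0" "(\<Sum>j. d j x) = ennreal M"
      by (cases "\<Sum>j. d j x") auto
    have bound: "norm (f (r (Suc j)) x - f (r j) x) \<le> sqrt M * (1/2)^j" for j
    proof -
      have "d j x \<le> (\<Sum>j. d j x)"
        using sum_le_suminf[of "\<lambda>j. d j x" "{j}"] by simp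
      hence "4^j * norm2 (f (r (Suc j)) x - f (r j) x) \<le> M"
        using M by (simp add: d_def)
      hence "(2^j * norm (f (r (Suc j)) x - f (r j) x))^2 \<le> M"
        by (simp only: power_mult_distrib power_even_eq[symmetric] power_mult[symmetric] mult.commute[of j]) (simp add: power_mult)
      hence "2^j * norm (f (r (Suc j)) x - f (r j) x) \<le> sqrt M"
        by (rule real_le_rsqrt)
      thus ?thesis by (simp add: field_simps)
    qed
    have "summable (\<lambda>j. f (r (Suc j)) x - f (r j) x)"
      by (rule summable_comparison_test'[of "\<lambda>j. sqrt M * (1/2)^j" 0]) (auto intro: bound summable_mult summable_geometric)
    hence "convergent (\<lambda>j. f (r (0+j)) x)"
      unfolding summable_iff_convergent
      by (subst (asm) sum_lessThan_telescope) (auto dest: convergent_add_const_iff[THEN iffD1] simp: convergent_diff_const_right_iff)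
    thus ?case by simp
  qed
  define g where "g x = lim (\<lambda>j. f (r j) x)" for x
  have [measurable]: "g \<in> Borel"
    unfolding g_def by (intro borel_measurable_lim_metric) auto
  have lim: "AE x in lborel. (\<lambda>j. f (r j) x) \<longlonglongrightarrow> g x"
    using conv by eventually_elim (simp add: g_def convergent_LIMSEQ_iff)
  have "(\<lambda>i. l2dist g (f i)) \<longlonglongrightarrow> 0"
  proof (rule tendsto_ennreal_0I)
    fix e :: real assume "e > 0"
    show "\<forall>\<^sub>F i in sequentially. l2dist g (f i) \<le> ennreal e"
      using eventually_ge_at_top[of "N e"]
    proof eventually_elim
      case (elim i)
      have AEl: "AE x in lborel. (\<lambda>j. f (r (j + N e)) x - f i x) \<longlonglongrightarrow> g x - f i x"
        using lim by eventually_elim (intro tendsto_intros LIMSEQ_ignore_initial_segment)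
      have b: "l2sq (\<lambda>x. f (r (j + N e)) x - f i x) \<le> ennreal e" for j
        using \<open>e > 0\<close> elim seq_suble[OF \<open>strict_mono r\<close>, of "j + N e"] by (intro N) auto
      show ?case by (rule l2sq_Fatou[OF _ AEl b]) measurable
    qed
  qed
  thus thesis by (intro that[of g]) auto
qed

section \<open>Change of variables and Gaussian integrals\<close>

lemma borel_measurable_cis [measurable]: "cis \<in> Borel"
  by (intro borel_measurable_continuous_onI continuous_intros)

lemma nn_integral_lborel_affine:
  fixes f :: "'a::euclidean_space \<Rightarrow> ennreal"
  assumes [measurable]: "f \<in> Borel" and "c \<noteq> 0"
  shows "(NNI x. f x) = ennreal (\<bar>c\<bar> ^ DIM('a)) * (NNI x. f (t + c *\<^sub>R x))"
  by (subst lborel_affine[OF \<open>c \<noteq> 0\<close>, of t])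
     (simp add: nn_integral_density nn_integral_distr nn_integral_cmult)

lemma int_affine:
  fixes f :: "'a::euclidean_space \<Rightarrow> 'b::{banach, second_countable_topology}"
  assumes "integrable lborel f" and "c \<noteq> 0"
  shows "integrable lborel (\<lambda>x. f (t + c *\<^sub>R x))"
proof -
  have [measurable]: "f \<in> Borel" using assms(1) by auto
  have "(NNI x. ennreal (norm (f x))) < \<infinity>"
    using assms(1) by (simp add: integrable_iff_bounded)
  hence "ennreal (\<bar>c\<bar> ^ DIM('a)) * (NNI x. ennreal (norm (f (t + c *\<^sub>R x)))) < \<infinity>"
    by (subst nn_integral_lborel_affine[symmetric]) (use assms(2) in auto)
  thus ?thesis using assms(2) by (auto simp: integrable_iff_bounded ennreal_mult_less_top)
qed

lemma integral_lborel_affine: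
  fixes f :: "'a::euclidean_space \<Rightarrow> 'b::{banach, second_countable_topology}"
  assumes "f \<in> Borel" and "c \<noteq> 0"
  shows "(LBINT x. f x) = \<bar>c\<bar> ^ DIM('a) *\<^sub>R (LBINT x. f (t + c *\<^sub>R x))"
  by (subst lborel_affine[OF \<open>c \<noteq> 0\<close>, of t])
     (use assms in \<open>simp add: integral_density integral_distr\<close>)

lemma integral_lborel_prod:
  fixes f :: "'a::euclidean_space \<Rightarrow> real \<Rightarrow> complex"
  assumes "\<And>b. b \<in> Basis \<Longrightarrow> integrable lborel (f b)"
  shows "(LBINT x. (\<Prod>b\<in>Basis. f b (x \<bullet> b))) = (\<Prod>b\<in>Basis. LBINT x. f b x)"
proof -
  interpret product_sigma_finite "\<lambda>b::'a. lborel :: real measure" ..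
  have [measurable]: "b \<in> Basis \<Longrightarrow> f b \<in> Borel" for b
    using assms[of b] by auto
  have "(LBINT x. (\<Prod>b\<in>Basis. f b (x \<bullet> b)))
      = (LINT x|(\<Pi>\<^sub>M b\<in>Basis. lborel). (\<Prod>b\<in>Basis. f b ((\<Sum>i\<in>Basis. x i *\<^sub>R i) \<bullet> b)))"
    by (subst lborel_eq) (simp add: integral_distr)
  also have "\<dots> = (LINT x|(\<Pi>\<^sub>M b\<in>(Basis :: 'a set). lborel). (\<Prod>b\<in>Basis. f b (x b)))"
    by (intro LB_cong refl prod.cong) simp
  also have "\<dots> = (\<Prod>b\<in>Basis. LBINT x. f b x)"
    using assms by (intro product_integral_prod) auto
  finally show ?thesis .
qed

text \<open>
  Fubini for a bounded kernel. It serves to move a Gaussian integral in \<open>k\<close> inside a Fourier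
  integral.
\<close>

lemma integral_lborel_Fubini_kernel:
  fixes f g :: "'a::euclidean_space \<Rightarrow> complex" and K :: "'a \<Rightarrow> 'a \<Rightarrow> complex"
  assumes f: "integrable lborel f" and g: "integrable lborel g"
    and K [measurable]: "(\<lambda>(k, x). K k x) \<in> borel_measurable (borel \<Otimes>\<^sub>M borel)"
    and K1: "\<And>k x. norm (K k x) \<le> 1"
  shows "(LBINT k. g k * (LBINT x. K k x * f x))
       = (LBINT x. f x * (LBINT k. K k x * g k))"
proof -
  have [measurable]: "f \<in> Borel" "g \<in> Borel"
    using f g by auto
  have "integrable (lborel \<Otimes>\<^sub>M lborel) (\<lambda>(x, k). f x * g k)"
    by (rule lborel_pair.Fubini_integrable) (use f g in \<open>auto simp: norm_mult\<close>)
  hence int: "integrable (lborel \<Otimes>\<^sub>M lborel) (\<lambda>(x, k). f x * (K k x * g k))"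
    by (rule int_bound)
       (use K1 in \<open>auto simp: norm_mult mult_left_le_one_le intro!: mult_left_mono AE_I2\<close>)
  have "(LBINT k. g k * (LBINT x. K k x * f x))
      = (LBINT k. (LBINT x. f x * (K k x * g k)))"
  proof (intro LB_cong refl)
    fix k
    have "g k * (LBINT x. K k x * f x) = (LBINT x. g k * (K k x * f x))" by simp
    also have "\<dots> = (LBINT x. f x * (K k x * g k))"
      by (intro LB_cong refl) (simp add: algebra_simps)
    finally show "g k * (LBINT x. K k x * f x) = (LBINT x. f x * (K k x * g k))" .
  qed
  also have "\<dots> = (LBINT x. (LBINT k. f x * (K k x * g k)))"
    using lborel_pair.Fubini_integral[OF int] by simp
  finally show ?thesis by simp
qed

lemma integral_cis_gaussian_real:
  "(LBINT x. cis (- (x * z)) * of_real (exp (- (x^2 / 2)))) = of_real (sqrt (2 * pi) * exp (- (z^2 / 2)))"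
proof -
  have "of_real (exp (- (z^2 / 2))) = char std_normal_distribution (- z)"
    by (simp add: char_std_normal_distribution)
  also have "\<dots> = (LBINT x. std_normal_density x *\<^sub>R iexp (- z * x))"
    unfolding char_def by (subst integral_density) (auto simp: normal_density_nonneg)
  also have "\<dots> = (LBINT x. of_real (1 / sqrt (2 * pi)) * (cis (- (x * z)) * of_real (exp (- (x^2 / 2)))))"
    by (intro LB_cong refl)
       (simp add: std_normal_density_def cis_conv_exp scaleR_conv_of_real algebra_simps)
  also have "\<dots> = of_real (1 / sqrt (2 * pi)) * (LBINT x. cis (- (x * z)) * of_real (exp (- (x^2 / 2))))"
    by simp
  finally show ?thesis by (simp add: field_simps)
qed

lemma integrable_gaussian_real: "integrable lborel (\<lambda>x::real. exp (- (x^2 / 2)))"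
proof -
  have "integrable lborel (\<lambda>x::real. sqrt (2 * pi) * std_normal_density x)"
    using std_normal_moment_even[of 0] by (simp add: has_bochner_integral_iff)
  thus ?thesis by (simp add: std_normal_density_def)
qed

lemma integral_gaussian_real: "(LBINT x. exp (- (x^2 / 2))) = sqrt (2 * pi)"
proof -
  have "complex_of_real (LBINT x. exp (- (x^2 / 2))) = of_real (sqrt (2 * pi))"
    using integral_cis_gaussian_real[of 0] by (simp flip: integral_complex_of_real)
  thus ?thesis by (simp only: of_real_eq_iff)
qed

lemma exp_norm_prod: "exp (- (norm2 (x::'a::euclidean_space) / 2)) = (\<Prod>b\<in>Basis. exp (- ((x \<bullet> b)^2 / 2)))"
proof -
  have "- (norm2 x / 2) = (\<Sum>b\<in>Basis. - ((x \<bullet> b)^2 / 2))"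
    unfolding power2_norm_eq_inner by (subst euclidean_inner) (simp add: power2_eq_square sum_negf sum_divide_distrib)
  thus ?thesis by (simp add: exp_sum)
qed

lemma cis_sum: "finite A \<Longrightarrow> cis (\<Sum>b\<in>A. f b) = (\<Prod>b\<in>A. cis (f b))"
  by (induction A rule: finite_induct) (auto simp: cis_mult[symmetric])

lemma nn_integral_gaussian:
  "(NNI x. ennreal (exp (- (norm2 (x::'a::euclidean_space) / 2)))) = ennreal (sqrt (2 * pi) ^ DIM('a))"
proof -
  have 1: "(NNI x. ennreal (exp (- (x^2 / 2)))) = ennreal (sqrt (2 * pi))"
    by (subst nn_integral_eq_integral) (auto simp: integral_gaussian_real integrable_gaussian_real)
  have "(NNI x. ennreal (exp (- (norm2 (x::'a) / 2))))
      = (NNI x. (\<Prod>b\<in>(Basis::'a set). ennreal (exp (- ((x \<bullet> b)^2 / 2)))))"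
    unfolding exp_norm_prod by (simp add: prod_ennreal)
  also have "\<dots> = (\<Prod>b\<in>(Basis::'a set). NNI x. ennreal (exp (- (x^2 / 2))))"
    by (intro nn_integral_lborel_prod) auto
  finally show ?thesis by (simp add: 1 prod_ennreal ennreal_power)
qed

lemma integral_cis_gaussian:
  "(LBINT x. cis (- (x \<bullet> z)) * of_real (exp (- (norm2 (x::'a::euclidean_space) / 2))))
    = of_real (sqrt (2 * pi) ^ DIM('a) * exp (- (norm2 z / 2)))"
proof -
  have "cis (- (x \<bullet> z)) * of_real (exp (- (norm2 x / 2)))
      = (\<Prod>b\<in>Basis. cis (- ((x \<bullet> b) * (z \<bullet> b))) * of_real (exp (- ((x \<bullet> b)^2 / 2))))" for x :: 'a
    unfolding exp_norm_prod prod.distrib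
    by (subst euclidean_inner) (simp add: cis_sum[symmetric] sum_negf)
  hence "(LBINT x. cis (- (x \<bullet> z)) * of_real (exp (- (norm2 (x::'a) / 2))))
      = (LBINT x. (\<Prod>b\<in>(Basis::'a set). cis (- ((x \<bullet> b) * (z \<bullet> b))) * of_real (exp (- ((x \<bullet> b)^2 / 2)))))"
    by simp
  also have "\<dots> = (\<Prod>b\<in>(Basis::'a set). LBINT x. cis (- (x * (z \<bullet> b))) * of_real (exp (- (x^2 / 2))))"
  proof (intro integral_lborel_prod)
    fix b :: 'a
    show "integrable lborel (\<lambda>x. cis (- (x * (z \<bullet> b))) * of_real (exp (- (x^2 / 2))))"
      by (rule int_bound[OF integrable_gaussian_real]) (auto simp: norm_mult)
  qed
  also have "\<dots> = of_real (sqrt (2 * pi) ^ DIM('a) * exp (- (norm2 z / 2)))"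
    unfolding integral_cis_gaussian_real exp_norm_prod by (simp add: prod.distrib)
  finally show ?thesis .
qed

lemma integral_cis_gaussian_scaled:
  assumes "s > 0"
  shows "(LBINT x. cis (- (x \<bullet> z)) * of_real (exp (- (norm2 (s *\<^sub>R (x::'a::euclidean_space)) / 2))))
    = of_real (sqrt (2 * pi) ^ DIM('a) / s ^ DIM('a) * exp (- (norm2 ((1/s) *\<^sub>R z) / 2)))"
proof -
  have "(LBINT x. cis (- (x \<bullet> ((1/s) *\<^sub>R z))) * of_real (exp (- (norm2 (x::'a) / 2))))
     = s ^ DIM('a) *\<^sub>R (LBINT x. cis (- ((0 + s *\<^sub>R x) \<bullet> ((1/s) *\<^sub>R z))) * of_real (exp (- (norm2 (0 + s *\<^sub>R (x::'a)) / 2))))"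
    using assms by (subst integral_lborel_affine[of _ s 0]) auto
  also have "\<dots> = s ^ DIM('a) *\<^sub>R (LBINT x. cis (- (x \<bullet> z)) * of_real (exp (- (norm2 (s *\<^sub>R (x::'a)) / 2))))"
    using assms by simp
  finally show ?thesis
    using assms unfolding integral_cis_gaussian by (simp add: field_simps scaleR_conv_of_real)
qed

lemma integrable_gaussian_scaled:
  assumes "s > 0"
  shows "integrable lborel (\<lambda>x::'a::euclidean_space. complex_of_real (exp (- (norm2 (s *\<^sub>R x) / 2))))"
proof -
  have "integrable lborel (\<lambda>x::'a. complex_of_real (exp (- (norm2 x / 2))))"
    unfolding integrable_iff_bounded using nn_integral_gaussian[where 'a='a] by simp
  from int_affine[OF this, of s 0] show ?thesis using assms by simp
qed

lemma nn_integral_gaussian_shifted: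
  assumes "s > 0"
  shows "(NNI x. ennreal (exp (- (norm2 ((1/s) *\<^sub>R (x - y::'a::euclidean_space)) / 2))))
     = ennreal (s ^ DIM('a) * sqrt (2 * pi) ^ DIM('a))"
proof -
  have "(NNI x. ennreal (exp (- (norm2 ((1/s) *\<^sub>R (x - y::'a)) / 2))))
      = ennreal (\<bar>s\<bar> ^ DIM('a)) * (NNI x. ennreal (exp (- (norm2 ((1/s) *\<^sub>R (y + s *\<^sub>R x - y::'a)) / 2))))"
    using assms by (intro nn_integral_lborel_affine) auto
  also have "\<dots> = ennreal (s ^ DIM('a)) * (NNI x. ennreal (exp (- (norm2 (x::'a) / 2))))"
    using assms by simp
  finally show ?thesis using assms unfolding nn_integral_gaussian by (simp add: ennreal_mult)
qed

section \<open>The Fourier integral contracts the square norm\<close>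

lemma borel_measurable_cnj [measurable]: "cnj \<in> Borel"
  by (intro borel_measurable_continuous_onI continuous_intros)

lemma norm_integral_le_nn:
  fixes f :: "'a \<Rightarrow> 'b::{banach, second_countable_topology}"
  shows "ennreal (norm (LINT x|M. f x)) \<le> (\<integral>\<^sup>+x. ennreal (norm (f x)) \<partial>M)"
  by (cases "integrable M f") (auto intro: integral_norm_bound_ennreal simp: not_integrable_integral_eq)

lemma fourier_integral_measurable [measurable]:
  assumes [measurable]: "u \<in> Borel"
  shows "fourier_integral u \<in> Borel"
  unfolding fourier_integral_def by measurable

text \<open>
  Young's inequality for a symmetric convolution kernel, from
  \<open>2|u(x)||u(y)| \<le> |u(x)|\<^sup>2 + |u(y)|\<^sup>2\<close>.
\<close>

lemma schur_bound:
  fixes u :: "'a::euclidean_space \<Rightarrow> complex" and \<gamma> :: "'a \<Rightarrow> real"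
  assumes [measurable]: "u \<in> Borel" "\<gamma> \<in> Borel"
    and nonneg: "\<And>z. \<gamma> z \<ge> 0" and sym: "\<And>z. \<gamma> (- z) = \<gamma> z"
    and mass: "\<And>y. (NNI x. ennreal (\<gamma> (x - y))) = G"
  shows "(NNI x. NNI y. ennreal (norm (u x) * (norm (u y) * \<gamma> (x - y)))) \<le> G * l2sq u"
proof -
  have sym': "\<gamma> (x - y) = \<gamma> (y - x)" for x y using sym[of "x - y"] by simp
  let ?w = "\<lambda>x. ennreal (norm2 (u x) / 2)"
  let ?g = "\<lambda>z. ennreal (\<gamma> z)"
  have "ennreal (norm (u x) * (norm (u y) * \<gamma> (x - y)))
     \<le> ?w x * ?g (y - x) + ?w y * ?g (x - y)" for x y
  proof -
    have "norm (u x) * norm (u y) \<le> norm2 (u x) / 2 + norm2 (u y) / 2"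
      using zero_le_power2[of "norm (u x) - norm (u y)"] by (simp add: power2_eq_square algebra_simps)
    hence "norm (u x) * norm (u y) * \<gamma> (x - y) \<le> (norm2 (u x) / 2 + norm2 (u y) / 2) * \<gamma> (x - y)"
      by (intro mult_right_mono nonneg)
    thus ?thesis using nonneg
      by (subst sym') (simp add: algebra_simps sym'[of x y] ennreal_leI flip: ennreal_plus ennreal_mult)
  qed
  hence "(NNI x. NNI y. ennreal (norm (u x) * (norm (u y) * \<gamma> (x - y))))
      \<le> (NNI x. NNI y. (?w x * ?g (y - x) + ?w y * ?g (x - y)))"
    by (intro nn_integral_mono)
  also have "\<dots> = (NNI x. NNI y. ?w x * ?g (y - x))
      + (NNI x. NNI y. ?w y * ?g (x - y))"
    by (simp add: nn_integral_add)
  also have "(NNI x. NNI y. ?w y * ?g (x - y))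
      = (NNI y. NNI x. ?w y * ?g (x - y))"
    by (rule lborel_pair.Fubini') measurable
  also have "(NNI x. NNI y. ?w x * ?g (y - x)) + \<dots>
      = G * (NNI x. ?w x) + G * (NNI x. ?w x)"
    by (simp add: nn_integral_cmult mass nn_integral_multc mult.commute)
  also have "\<dots> = G * (NNI x. (?w x + ?w x))"
    by (subst nn_integral_add) (auto simp: distrib_left)
  also have "\<dots> = G * l2sq u"
    unfolding l2sq_def by (simp flip: ennreal_plus)
  finally show ?thesis .
qed

text \<open>
  Writing \<open>|F|\<^sup>2 = F cnj F\<close> and integrating the Gaussian in \<open>k\<close> first turns the left side into a
  double integral of \<open>u(x) cnj u(y)\<close> against a Gaussian in \<open>x - y\<close> of total mass \<open>(2\<pi>)\<^sup>N\<close>, to which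
  the bound above applies.
\<close>

lemma l2sq_gaussian_fourier_le:
  fixes u :: "'a::euclidean_space \<Rightarrow> complex"
  assumes u: "integrable lborel u" and s: "s > 0"
  defines "F \<equiv> \<lambda>k. LBINT x. cis (- (k \<bullet> x)) * u x"
  shows "l2sq (\<lambda>k. of_real (exp (- (norm2 (s *\<^sub>R k) / 4))) * F k)
     \<le> ennreal ((2 * pi) ^ DIM('a)) * l2sq u"
proof -
  have [measurable]: "u \<in> Borel" using u by auto
  have [measurable]: "F \<in> Borel" unfolding F_def by measurable
  have F_eq: "(LBINT x. cis (- (k \<bullet> x)) * u x) = F k" for k by (simp add: F_def)
  define g where "g k = exp (- (norm2 (s *\<^sub>R k) / 2))" for k :: 'a
  have [measurable]: "g \<in> Borel" unfolding g_def by measurable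
  have g: "integrable lborel (\<lambda>k. complex_of_real (g k))"
    unfolding g_def by (rule integrable_gaussian_scaled[OF s])
  define \<gamma> where "\<gamma> z = sqrt (2 * pi) ^ DIM('a) / s ^ DIM('a) * exp (- (norm2 ((1/s) *\<^sub>R z) / 2))" for z :: 'a
  have [measurable]: "\<gamma> \<in> Borel" unfolding \<gamma>_def by measurable
  have \<gamma>_nonneg: "\<gamma> z \<ge> 0" for z using s by (simp add: \<gamma>_def)
  let ?g = "\<lambda>x k. cis (- (k \<bullet> x)) * of_real (g k)"
  let ?c = "\<lambda>x. LBINT y. cnj (u y) * of_real (\<gamma> (x - y))"
  let ?d = "\<lambda>x. LBINT k. cis (- (k \<bullet> x)) * (of_real (g k) * cnj (F k))"
  have F_bound: "norm (F k) \<le> (LBINT x. norm (u x))" for k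
    unfolding F_def by (rule order.trans[OF integral_norm_bound]) (simp add: norm_mult)
  have gF: "integrable lborel (\<lambda>k. complex_of_real (g k) * cnj (F k))"
  proof (rule integrable_dominated)
    show "integrable lborel (\<lambda>k. (LBINT x. norm (u x)) * norm (complex_of_real (g k)))"
      using g by (intro integrable_mult_right integrable_norm)
    show "norm (of_real (g k) * cnj (F k)) \<le> (LBINT x. norm (u x)) * norm (complex_of_real (g k))" for k
      using F_bound[of k] by (simp add: norm_mult mult_left_mono mult.commute)
  qed measurable
  have eq: "complex_of_real (LBINT k. g k * norm2 (F k))
      = (LBINT x. u x * ?c x)"
  proof -
    have "complex_of_real (LBINT k. g k * norm2 (F k))
        = (LBINT k. of_real (g k) * cnj (F k) * (LBINT x. cis (- (k \<bullet> x)) * u x))"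
      unfolding F_eq integral_complex_of_real[symmetric]
      by (intro LB_cong refl) (simp only: of_real_mult complex_norm_square mult_ac)
    also have "\<dots> = (LBINT x. u x * ?d x)"
      by (rule integral_lborel_Fubini_kernel[OF u gF]) (auto simp: case_prod_beta)
    also have "\<dots> = (LBINT x. u x * ?c x)"
    proof (rule LB_cong[OF refl], rule arg_cong[where f = "(*) _"])
      fix x :: 'a
      have F_cnj: "cnj (F k) = (LBINT y. cis (k \<bullet> y) * cnj (u y))" for k
      proof -
        have "cnj (F k) = (LBINT y. cnj (cis (- (k \<bullet> y)) * u y))"
          unfolding F_def by (rule Bochner_Integration.integral_cnj[symmetric])
        thus ?thesis by (simp add: cis_cnj)
      qed
      have "?d x
          = (LBINT k. (?g x k) * (LBINT y. cis (k \<bullet> y) * cnj (u y)))"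
        unfolding F_cnj by (simp add: mult.assoc)
      also have "\<dots> = (LBINT y. cnj (u y) * (LBINT k. cis (k \<bullet> y) * (?g x k)))"
      proof (rule integral_lborel_Fubini_kernel)
        show "integrable lborel (\<lambda>y. cnj (u y))" using u by simp
        show "integrable lborel (\<lambda>k. ?g x k)"
          by (rule int_bound[OF g]) (auto simp: norm_mult)
      qed (auto simp: case_prod_beta)
      also have "\<dots> = ?c x"
      proof (rule LB_cong[OF refl], rule arg_cong[where f = "(*) _"])
        fix y :: 'a
        have "(LBINT k. cis (k \<bullet> y) * (?g x k))
            = (LBINT k. cis (- (k \<bullet> (x - y))) * of_real (g k))"
          by (simp add: mult.assoc[symmetric] cis_mult inner_diff_right)
        also have "\<dots> = of_real (\<gamma> (x - y))"
          unfolding g_def \<gamma>_def by (rule integral_cis_gaussian_scaled[OF s])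
        finally show "(LBINT k. cis (k \<bullet> y) * (?g x k))
            = of_real (\<gamma> (x - y))" .
      qed
      finally show "?d x
          = ?c x" .
    qed
    finally show ?thesis .
  qed
  have gFF: "integrable lborel (\<lambda>k. g k * norm2 (F k))"
  proof (rule integrable_dominated)
    show "integrable lborel (\<lambda>k. (LBINT x. norm (u x))^2 * norm (complex_of_real (g k)))"
      using g by (intro integrable_mult_right integrable_norm)
    show "norm (g k * norm2 (F k)) \<le> (LBINT x. norm (u x))^2 * norm (complex_of_real (g k))" for k
      using power_mono[OF F_bound[of k], of 2] by (simp add: mult_left_mono mult.commute abs_mult)
  qed measurable
  have "l2sq (\<lambda>k. of_real (exp (- (norm2 (s *\<^sub>R k) / 4))) * F k)
      = (NNI k. ennreal (g k * norm2 (F k)))"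
    unfolding l2sq_def g_def
    by (intro nn_integral_cong) (simp add: norm_mult power_mult_distrib flip: exp_of_nat_mult)
  also have "\<dots> = ennreal (LBINT k. g k * norm2 (F k))"
    by (intro nn_integral_eq_integral gFF) (auto simp: g_def)
  also have "\<dots> \<le> ennreal (norm (complex_of_real (LBINT k. g k * norm2 (F k))))"
    by (intro ennreal_leI) auto
  also have "\<dots> \<le> (NNI x. ennreal (norm (u x * ?c x)))"
    unfolding eq by (rule norm_integral_le_nn)
  also have "\<dots> \<le> (NNI x. NNI y. ennreal (norm (u x) * (norm (u y) * \<gamma> (x - y))))"
  proof (intro nn_integral_mono)
    fix x
    have "ennreal (norm (u x * ?c x))
       \<le> ennreal (norm (u x)) * (NNI y. ennreal (norm (cnj (u y) * of_real (\<gamma> (x - y)))))"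
      by (simp only: norm_mult[of "u x"] ennreal_mult norm_ge_zero) (intro mult_left_mono norm_integral_le_nn, auto)
    also have "\<dots> = (NNI y. ennreal (norm (u x) * (norm (u y) * \<gamma> (x - y))))"
      using \<gamma>_nonneg by (subst nn_integral_cmult[symmetric]) (auto simp: norm_mult ennreal_mult abs_of_nonneg)
    finally show "ennreal (norm (u x * ?c x))
       \<le> (NNI y. ennreal (norm (u x) * (norm (u y) * \<gamma> (x - y))))" .
  qed
  also have "\<dots> \<le> ennreal ((2 * pi) ^ DIM('a)) * l2sq u"
  proof (rule schur_bound)
    fix y :: 'a
    have "(NNI x. ennreal (\<gamma> (x - y)))
        = ennreal (sqrt (2 * pi) ^ DIM('a) / s ^ DIM('a)) * (NNI x. ennreal (exp (- (norm2 ((1/s) *\<^sub>R (x - y)) / 2))))"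
    proof -
      have "ennreal (\<gamma> (x - y)) = ennreal (sqrt (2 * pi) ^ DIM('a) / s ^ DIM('a)) * ennreal (exp (- (norm2 ((1/s) *\<^sub>R (x - y)) / 2)))" for x
        unfolding \<gamma>_def using s by (intro ennreal_mult) auto
      thus ?thesis by (simp only:) (intro nn_integral_cmult, measurable)
    qed
    also have "\<dots> = ennreal ((2 * pi) ^ DIM('a))"
    proof -
      have "sqrt (2 * pi) ^ DIM('a) / s ^ DIM('a) * (s ^ DIM('a) * sqrt (2 * pi) ^ DIM('a)) = (sqrt (2 * pi) * sqrt (2 * pi)) ^ DIM('a)"
        using s unfolding power_mult_distrib by simp
      also have "sqrt (2 * pi) * sqrt (2 * pi) = 2 * pi" by simp
      finally show ?thesis
        unfolding nn_integral_gaussian_shifted[OF s] using s by (subst ennreal_mult[symmetric]) auto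
    qed
    finally show "(NNI x. ennreal (\<gamma> (x - y))) = ennreal ((2 * pi) ^ DIM('a))" .
  next
    show "\<gamma> (- z) = \<gamma> z" for z by (simp add: \<gamma>_def)
  qed (auto simp: \<gamma>_nonneg)
  finally show ?thesis .
qed

text \<open>
  The half of Plancherel's theorem that is used: remove the Gaussian cutoff with Fatou's
  lemma.
\<close>

lemma l2sq_fourier_integral_le:
  fixes u :: "'a::euclidean_space \<Rightarrow> complex"
  assumes u: "integrable lborel u"
  shows "l2sq (fourier_integral u) \<le> l2sq u"
proof -
  have [measurable]: "u \<in> Borel" using u by auto
  define F where "F = (\<lambda>k. LBINT x. cis (- (k \<bullet> x)) * u x)"
  have [measurable]: "F \<in> Borel" unfolding F_def by measurable
  let ?e = "\<lambda>i k. of_real (exp (- (norm2 (inverse (real (Suc i)) *\<^sub>R k) / 4))) * F k"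
  have "l2sq F \<le> ennreal ((2 * pi) ^ DIM('a)) * l2sq u"
  proof (rule l2sq_Fatou)
    show "l2sq (\<lambda>k. ?e i k)
      \<le> ennreal ((2 * pi) ^ DIM('a)) * l2sq u" for i
      unfolding F_def by (rule l2sq_gaussian_fourier_le[OF u]) auto
    show "AE k in lborel. (\<lambda>i. ?e i k) \<longlonglongrightarrow> F k"
    proof (intro AE_I2)
      fix k
      have "(\<lambda>i. ?e i k) \<longlonglongrightarrow>
        of_real (exp (- (norm2 (0 *\<^sub>R k) / 4))) * F k"
        by (intro tendsto_intros LIMSEQ_inverse_real_of_nat) auto
      thus "(\<lambda>i. ?e i k) \<longlonglongrightarrow> F k"
        by simp
    qed
  qed measurable
  hence "l2sq (fourier_integral u) \<le> ennreal (((2 * pi) powr (- real DIM('a) / 2))^2) * (ennreal ((2 * pi) ^ DIM('a)) * l2sq u)"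
    unfolding fourier_integral_def F_def[symmetric] 
    by (subst l2sq_cmult) (auto simp: F_def[symmetric] intro!: mult_left_mono)
  also have "\<dots> = l2sq u"
  proof -
    have "((2 * pi) powr (- real DIM('a) / 2))^2 * (2 * pi) ^ DIM('a) = 1"
    proof -
      have "((2 * pi) powr (- real DIM('a) / 2))^2 * (2 * pi) ^ DIM('a)
          = (2 * pi) powr (2 * (- real DIM('a) / 2)) * (2 * pi) powr (real DIM('a))"
        by (simp add: powr_powr[symmetric] powr_realpow powr_power)
      also have "\<dots> = 1" by (simp flip: powr_add)
      finally show ?thesis .
    qed
    thus ?thesis by (simp add: mult.assoc[symmetric] ennreal_mult[symmetric] del: ennreal_mult'')
  qed
  finally show ?thesis .
qed

section \<open>Calculus of the Fourier transform\<close>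

definition trunc :: "real \<Rightarrow> ('a::euclidean_space \<Rightarrow> complex) \<Rightarrow> 'a \<Rightarrow> complex" where
  "trunc R u x = indicator (cball 0 R) x *\<^sub>R u x"

lemma trunc_measurable [measurable]:
  fixes u :: "'a::euclidean_space \<Rightarrow> complex"
  assumes [measurable]: "u \<in> Borel" shows "trunc R u \<in> Borel"
proof -
  have [measurable]: "cball (0::'a) R \<in> sets borel" by auto
  show ?thesis unfolding trunc_def[abs_def] by measurable
qed

lemma is_ft_iff:
  "is_fourier_transform u g \<longleftrightarrow> square_integrable g \<and>
     ((\<lambda>R. l2dist g (fourier_integral (trunc R u))) \<longlongrightarrow> 0) at_top"
  unfolding is_fourier_transform_def l2sq_def trunc_def by simp

lemma L2_trunc:
  assumes "square_integrable u" shows "square_integrable (trunc R u)"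
proof -
  have "trunc R u = (\<lambda>x. complex_of_real (indicator (cball 0 R) x) * u x)"
    by (auto simp: trunc_def scaleR_conv_of_real)
  thus ?thesis
    by (simp only:) (rule L2_bounded_mult[OF assms], auto simp: indicator_def)
qed

lemma integrable_trunc:
  assumes "square_integrable u" shows "integrable lborel (trunc R u)"
proof (rule integrable_dominated)
  have "integrable lborel (\<lambda>x. indicator (cball 0 R) x :: real)"
    by (rule integrable_real_indicator) (use emeasure_bounded_finite[OF bounded_cball, of 0 R] in auto)
  thus "integrable lborel (\<lambda>x. indicator (cball 0 R) x + norm2 (u x))"
    using assms by (intro int_add) (simp_all add: square_integrable_def)
  have "t \<le> 1 + t^2" for t :: real
    using zero_le_power2[of "t - 1/2"] by (simp add: power2_eq_square algebra_simps)
  thus "norm (trunc R u x) \<le> indicator (cball 0 R) x + norm2 (u x)" for x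
    by (auto simp: trunc_def indicator_def)
  show "trunc R u \<in> Borel" using assms by auto
qed

lemma l2sq_trunc_tendsto:
  assumes u: "square_integrable u"
  shows "((\<lambda>R. l2dist u (trunc R u)) \<longlongrightarrow> 0) at_top"
proof -
  have [measurable]: "u \<in> Borel" using u by auto
  have "((\<lambda>R. LBINT x. norm2 (u x - trunc R u x)) \<longlongrightarrow> (LINT x|(lborel::'a measure). 0)) at_top"
  proof (rule integral_dominated_convergence_at_top)
    show "integrable lborel (\<lambda>x. norm2 (u x))" using u by (simp add: square_integrable_def)
    show "\<forall>\<^sub>F R in at_top. AE x in lborel. norm (norm2 (u x - trunc R u x)) \<le> norm2 (u x)"
      by (intro always_eventually allI AE_I2) (auto simp: trunc_def indicator_def)
    show "AE x in lborel. ((\<lambda>R. norm2 (u x - trunc R u x)) \<longlongrightarrow> 0) at_top"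
    proof (intro AE_I2 tendsto_eventually)
      fix x show "\<forall>\<^sub>F R in at_top. norm2 (u x - trunc R u x) = 0"
        using eventually_ge_at_top[of "norm x"] by eventually_elim (auto simp: trunc_def)
    qed
  qed auto
  hence "((\<lambda>R. ennreal (LBINT x. norm2 (u x - trunc R u x))) \<longlongrightarrow> ennreal 0) at_top"
    by (intro tendsto_ennrealI) simp
  moreover have "l2dist u (trunc R u) = ennreal (LBINT x. norm2 (u x - trunc R u x))" for R
    by (intro l2sq_eq_integral L2_diff u L2_trunc)
  ultimately show ?thesis by simp
qed

lemma integrable_cis_mult:
  assumes "integrable lborel (u :: 'a::euclidean_space \<Rightarrow> complex)"
  shows "integrable lborel (\<lambda>x. cis (- (k \<bullet> x)) * u x)"
  by (rule int_bound[OF assms]) (use assms in \<open>auto simp: norm_mult\<close>)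

lemma fourier_integral_diff:
  assumes "integrable lborel f" "integrable lborel g"
  shows "fourier_integral (\<lambda>x. f x - g x) k = fourier_integral f k - fourier_integral g k"
  unfolding fourier_integral_def
  by (simp add: right_diff_distrib integrable_cis_mult assms)

lemma fourier_integral_add:
  assumes "integrable lborel f" "integrable lborel g"
  shows "fourier_integral (\<lambda>x. f x + g x) k = fourier_integral f k + fourier_integral g k"
  unfolding fourier_integral_def
  by (simp add: distrib_left integrable_cis_mult assms)

lemma l2sq_fourier_integral_diff_le:
  assumes "integrable lborel f" "integrable lborel g"
  shows "l2dist (fourier_integral f) (fourier_integral g) \<le> l2dist f g"
  using l2sq_fourier_integral_le[of "\<lambda>x. f x - g x"] assms
  by (simp add: fourier_integral_diff cong: l2sq_def)

lemma fourier_limit_diff_le: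
  assumes [measurable]: "u \<in> Borel" "g \<in> Borel" and f: "\<And>i. integrable lborel (f i)" and e: "integrable lborel e"
    and "F \<noteq> bot" and u: "((\<lambda>i. l2dist u (f i)) \<longlongrightarrow> 0) F"
    and g: "((\<lambda>i. l2dist g (fourier_integral (f i))) \<longlongrightarrow> 0) F"
  shows "l2dist g (fourier_integral e) \<le> 4 * l2dist u e"
proof -
  have [measurable]: "e \<in> Borel" "\<And>i. f i \<in> Borel" using e f by auto
  let ?b = "\<lambda>i. 2 * l2dist g (fourier_integral (f i)) + 2 * (2 * l2dist u (f i) + 2 * l2dist u e)"
  have "(?b \<longlongrightarrow> 2 * 0 + 2 * (2 * 0 + 2 * l2dist u e)) F"
    by (intro tendsto_add ennreal_tendsto_cmult u g tendsto_const) auto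
  moreover have "l2dist g (fourier_integral e) \<le> ?b i" for i
  proof -
    have "l2dist g (fourier_integral e)
       \<le> 2 * l2dist g (fourier_integral (f i)) + 2 * l2dist (fourier_integral (f i)) (fourier_integral e)"
      by (intro l2sq_diff_le) auto
    also have "l2dist (fourier_integral (f i)) (fourier_integral e) \<le> l2dist (f i) e"
      by (intro l2sq_fourier_integral_diff_le f e)
    also have "\<dots> \<le> 2 * l2dist u (f i) + 2 * l2dist u e"
      using l2sq_diff_le[of "f i" u e] by (simp add: l2sq_diff_swap[of "f i" u])
    finally show ?thesis by (simp add: add_left_mono mult_left_mono)
  qed
  ultimately have "l2dist g (fourier_integral e) \<le> 2 * 0 + 2 * (2 * 0 + 2 * l2dist u e)"
    using \<open>F \<noteq> bot\<close> by (intro tendsto_lowerbound[of ?b _ F]) auto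
  thus ?thesis by (simp add: mult.assoc[symmetric])
qed

text \<open>
  By contraction, the Fourier integrals of the truncations inherit the Cauchy property of the
  truncations.
\<close>

lemma ex_fourier_transform:
  assumes u: "square_integrable u"
  shows "\<exists>g. is_fourier_transform u g"
proof -
  have [measurable]: "u \<in> Borel" using u by auto
  let ?d = "\<lambda>R. l2dist u (trunc R u)"
  let ?F = "\<lambda>R. fourier_integral (trunc R u)"
  have diff: "l2dist (?F R) (?F S) \<le> 2 * ?d R + 2 * ?d S" for R S
  proof -
    have "l2dist (?F R) (?F S)
        \<le> l2dist (trunc R u) (trunc S u)"
      by (intro l2sq_fourier_integral_diff_le integrable_trunc u)
    also have "\<dots> \<le> 2 * ?d R + 2 * ?d S"
      using l2sq_diff_le[of "trunc R u" u "trunc S u"] by (simp add: l2sq_diff_swap[of "trunc R u" u])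
    finally show ?thesis .
  qed
  have small: "\<forall>\<^sub>F R in at_top. 2 * ?d R \<le> ennreal e" if "e > 0" for e
  proof -
    have "((\<lambda>R. 2 * ?d R) \<longlongrightarrow> 2 * 0) at_top"
      by (intro ennreal_tendsto_cmult l2sq_trunc_tendsto u) auto
    hence "\<forall>\<^sub>F R in at_top. 2 * ?d R < ennreal e"
      using that by (intro order_tendstoD(2)[of _ 0]) auto
    thus ?thesis by eventually_elim auto
  qed
  have Cau: "\<exists>n0. \<forall>i\<ge>n0. \<forall>j\<ge>n0. l2dist (?F (real i)) (?F (real j)) \<le> ennreal e"
    if "e > 0" for e
  proof -
    have "\<forall>\<^sub>F i in sequentially. 2 * ?d (real i) \<le> ennreal (e/2)"
      using filterlim_real_sequentially small[of "e/2"] that by (auto simp: filterlim_iff)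
    then obtain n0 where n0: "2 * ?d (real i) \<le> ennreal (e/2)" if "i \<ge> n0" for i
      by (auto simp: eventually_sequentially)
    have "l2dist (?F (real i)) (?F (real j)) \<le> ennreal e"
      if "i \<ge> n0" "j \<ge> n0" for i j
    proof -
      have "2 * ?d (real i) + 2 * ?d (real j) \<le> ennreal (e/2) + ennreal (e/2)"
        by (intro add_mono n0 that)
      also have "\<dots> = ennreal e" using \<open>e > 0\<close> by (simp flip: ennreal_plus)
      finally show ?thesis using diff[of "real i" "real j"] by (rule order.trans[rotated])
    qed
    thus ?thesis by blast
  qed
  obtain g where [measurable]: "g \<in> Borel"
    and g: "(\<lambda>i. l2dist g (?F (real i))) \<longlonglongrightarrow> 0"
    by (rule l2sq_complete[of "\<lambda>i. ?F (real i)", OF _ Cau]) auto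
  have le: "l2dist g (?F R) \<le> 4 * ?d R" for R
    by (rule fourier_limit_diff_le[OF _ _ _ _ _ _ g])
       (auto intro: integrable_trunc u filterlim_compose[OF l2sq_trunc_tendsto[OF u] filterlim_real_sequentially])
  have "((\<lambda>R. l2dist g (?F R)) \<longlongrightarrow> 0) at_top"
  proof (rule tendsto_sandwich[OF _ _ tendsto_const])
    show "((\<lambda>R. 4 * ?d R) \<longlongrightarrow> 0) at_top"
      using ennreal_tendsto_cmult[OF _ l2sq_trunc_tendsto[OF u], of 4] by simp
  qed (use le in auto)
  moreover have "square_integrable g"
  proof -
    obtain R where "2 * ?d R \<le> ennreal 1"
      using small[of 1] by (auto dest: eventually_happens)
    hence "2 * (2 * ?d R) \<le> 2 * ennreal 1" by (intro mult_left_mono) auto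
    hence "4 * ?d R \<le> ennreal 2" by (simp add: mult.assoc[symmetric])
    hence d: "4 * ?d R < \<infinity>" by (rule le_less_trans) simp
    have "square_integrable (\<lambda>k. g k - ?F R k)"
      using le_less_trans[OF le d] by (auto simp: L2_iff)
    moreover have "square_integrable (?F R)"
      using le_less_trans[OF l2sq_fourier_integral_le[OF integrable_trunc[OF u]]] L2_trunc[OF u, of R]
      by (auto simp: L2_iff)
    ultimately show ?thesis
      using L2_add[of "\<lambda>k. g k - ?F R k" "?F R"] by simp
  qed
  ultimately show ?thesis by (auto simp: is_ft_iff)
qed

lemma is_ft_fourier:
  assumes "square_integrable u" shows "is_fourier_transform u (fourier u)"
  using ex_fourier_transform[OF assms] unfolding fourier_def by (rule someI_ex)

lemma fourier_L2:
  assumes "square_integrable u" shows "square_integrable (fourier u)"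
  using is_ft_fourier[OF assms] by (simp add: is_ft_iff)

text \<open>
  Any integrable approximation of \<open>u\<close>, not only a truncation, may be used to compute the
  transform. The constant \<open>4\<close> results from two uses of \<open>(a + b)\<^sup>2 \<le> 2a\<^sup>2 + 2b\<^sup>2\<close>.
\<close>

lemma l2sq_fourier_diff_le:
  assumes u: "square_integrable u" and f: "integrable lborel f"
  shows "l2dist (fourier u) (fourier_integral f) \<le> 4 * l2dist u f"
proof (rule fourier_limit_diff_le[where F = at_top and f = "\<lambda>R. trunc R u"])
  show "u \<in> Borel" "fourier u \<in> Borel" using u fourier_L2[OF u] by auto
  show "((\<lambda>R. l2dist (fourier u) (fourier_integral (trunc R u))) \<longlongrightarrow> 0) at_top"
    using is_ft_fourier[OF u] by (simp add: is_ft_iff)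
qed (auto intro: integrable_trunc u f l2sq_trunc_tendsto)

lemma l2sq_fourier_le: 
  assumes "square_integrable u" shows "l2sq (fourier u) \<le> 4 * l2sq u"
  using l2sq_fourier_diff_le[OF assms, of "\<lambda>_. 0"] by (simp add: fourier_integral_def)

lemma fourier_AE_eqI:
  assumes w: "square_integrable w" and [measurable]: "g \<in> Borel"
    and f: "\<And>i. integrable lborel (f i)" and "F \<noteq> bot"
    and lim: "((\<lambda>i. l2dist w (f i)) \<longlongrightarrow> 0) F"
    and limg: "((\<lambda>i. l2dist g (fourier_integral (f i))) \<longlongrightarrow> 0) F"
  shows "AE k in lborel. fourier w k = g k"
proof (rule l2sq_limit_unique[OF _ _ _ \<open>F \<noteq> bot\<close> _ limg])
  have [measurable]: "\<And>i. f i \<in> Borel" using f by auto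
  show "fourier_integral (f i) \<in> Borel" for i by measurable
  show "fourier w \<in> Borel" using fourier_L2[OF w] by auto
  show "((\<lambda>i. l2dist (fourier w) (fourier_integral (f i))) \<longlongrightarrow> 0) F"
  proof (rule tendsto_sandwich[OF _ _ tendsto_const])
    show "((\<lambda>i. 4 * l2dist w (f i)) \<longlongrightarrow> 0) F"
      using ennreal_tendsto_cmult[OF _ lim, of 4] by simp
  qed (use l2sq_fourier_diff_le[OF w f] in auto)
qed measurable

text \<open>
  How rules are carried from Fourier integrals to the transform: an operation that is
  \<open>L\<^sup>2\<close>-bounded on both sides need only be followed on truncations.
\<close>

lemma fourier_transfer:
  fixes u w :: "'a::euclidean_space \<Rightarrow> complex" and c d :: ennreal
  assumes u: "square_integrable u" and w: "square_integrable w" and [measurable]: "g \<in> Borel"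
    and f: "\<And>R. integrable lborel (f R)"
    and 1: "\<And>R. l2dist w (f R) \<le> c * l2dist u (trunc R u)"
    and 2: "\<And>R. l2dist g (fourier_integral (f R)) \<le> d * l2dist (fourier u) (fourier_integral (trunc R u))"
    and "c < \<infinity>" "d < \<infinity>"
  shows "AE k in lborel. fourier w k = g k"
proof (rule fourier_AE_eqI[of _ _ f at_top])
  show "((\<lambda>R. l2dist w (f R)) \<longlongrightarrow> 0) at_top"
  proof (rule tendsto_sandwich[OF _ _ tendsto_const])
    show "((\<lambda>R. c * l2dist u (trunc R u)) \<longlongrightarrow> 0) at_top"
      using ennreal_tendsto_cmult[OF _ l2sq_trunc_tendsto[OF u], of c] \<open>c < \<infinity>\<close> by simp
  qed (use 1 in auto)
  show "((\<lambda>R. l2dist g (fourier_integral (f R))) \<longlongrightarrow> 0) at_top"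
  proof (rule tendsto_sandwich[OF _ _ tendsto_const])
    show "((\<lambda>R. d * l2dist (fourier u) (fourier_integral (trunc R u))) \<longlongrightarrow> 0) at_top"
      using is_ft_fourier[OF u] \<open>d < \<infinity>\<close> ennreal_tendsto_cmult[of d _ 0] by (auto simp: is_ft_iff)
  qed (use 2 in auto)
qed (use assms in auto)

lemma l2sq_scale:
  fixes f :: "'a::euclidean_space \<Rightarrow> complex"
  assumes [measurable]: "f \<in> Borel" and "\<tau> > 0"
  shows "l2sq (\<lambda>x. c * f (\<tau> *\<^sub>R x)) = ennreal (norm2 c / \<tau> ^ DIM('a)) * l2sq f"
proof -
  have "l2sq f = ennreal (\<tau> ^ DIM('a)) * l2sq (\<lambda>x. f (\<tau> *\<^sub>R x))"
    unfolding l2sq_def using \<open>\<tau> > 0\<close> by (subst nn_integral_lborel_affine[of _ \<tau> 0]) auto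
  hence "ennreal (norm2 c / \<tau> ^ DIM('a)) * l2sq f
      = (ennreal (norm2 c / \<tau> ^ DIM('a)) * ennreal (\<tau> ^ DIM('a))) * l2sq (\<lambda>x. f (\<tau> *\<^sub>R x))"
    by (simp only: mult.assoc)
  also have "ennreal (norm2 c / \<tau> ^ DIM('a)) * ennreal (\<tau> ^ DIM('a)) = ennreal (norm2 c)"
    using \<open>\<tau> > 0\<close> by (subst ennreal_mult[symmetric]) auto
  finally show ?thesis by (simp add: l2sq_cmult)
qed

lemma L2_scale:
  assumes "square_integrable f" "\<tau> > 0"
  shows "square_integrable (\<lambda>x. c * f (\<tau> *\<^sub>R x))"
proof -
  have [measurable]: "f \<in> Borel" using assms by auto
  show ?thesis using assms l2sq_scale[of f \<tau> c] unfolding L2_iff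
    by (auto simp: ennreal_mult_less_top)
qed

lemma fourier_scale:
  fixes u :: "'a::euclidean_space \<Rightarrow> complex"
  assumes u: "square_integrable u" and \<tau>: "\<tau> > 0"
  shows "AE k in lborel. fourier (\<lambda>x. c * u (\<tau> *\<^sub>R x)) k = c / of_real (\<tau> ^ DIM('a)) * fourier u ((1/\<tau>) *\<^sub>R k)"
proof -
  have [measurable]: "u \<in> Borel" "fourier u \<in> Borel"
    using u fourier_L2[OF u] by auto
  let ?t = "\<lambda>R x. trunc R u (\<tau> *\<^sub>R x)"
  have FT: "fourier_integral (\<lambda>x. c * ?t R x) k = c / of_real (\<tau> ^ DIM('a)) * fourier_integral (trunc R u) ((1/\<tau>) *\<^sub>R k)" for R k
  proof -
    have "(LBINT x. cis (- (((1/\<tau>) *\<^sub>R k) \<bullet> x)) * trunc R u x)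
        = \<tau> ^ DIM('a) *\<^sub>R (LBINT x. cis (- (((1/\<tau>) *\<^sub>R k) \<bullet> (0 + \<tau> *\<^sub>R x))) * trunc R u (0 + \<tau> *\<^sub>R x))"
      using \<tau> by (subst integral_lborel_affine[of _ \<tau> 0]) auto
    also have "(LBINT x. cis (- (((1/\<tau>) *\<^sub>R k) \<bullet> (0 + \<tau> *\<^sub>R x))) * trunc R u (0 + \<tau> *\<^sub>R x))
       = (LBINT x. cis (- (k \<bullet> x)) * ?t R x)"
      using \<tau> by simp
    finally have "(LBINT x. cis (- (((1/\<tau>) *\<^sub>R k) \<bullet> x)) * trunc R u x)
       = of_real (\<tau> ^ DIM('a)) * (LBINT x. cis (- (k \<bullet> x)) * ?t R x)"
      by (simp only: scaleR_conv_of_real)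
    moreover have "(LBINT x. cis (- (k \<bullet> x)) * (c * ?t R x))
        = c * (LBINT x. cis (- (k \<bullet> x)) * ?t R x)"
      by (subst integral_mult_right_zero[symmetric]) (simp only: mult_ac)
    ultimately show ?thesis using \<tau> unfolding fourier_integral_def by simp
  qed
  show ?thesis
  proof (rule fourier_transfer[OF u, where f = "\<lambda>R x. c * ?t R x"])
    show "square_integrable (\<lambda>x. c * u (\<tau> *\<^sub>R x))" by (rule L2_scale[OF u \<tau>])
    show "integrable lborel (\<lambda>x. c * ?t R x)" for R
      using int_affine[OF integrable_trunc[OF u, of R], of \<tau> 0] \<tau> by simp
    show "l2sq (\<lambda>x. c * u (\<tau> *\<^sub>R x) - c * ?t R x)
        \<le> ennreal (norm2 c / \<tau> ^ DIM('a)) * l2dist u (trunc R u)" for R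
      using l2sq_scale[of "\<lambda>x. u x - trunc R u x" \<tau> c] \<tau> by (simp add: right_diff_distrib)
    show "l2sq (\<lambda>k. c / of_real (\<tau> ^ DIM('a)) * fourier u ((1/\<tau>) *\<^sub>R k) - fourier_integral (\<lambda>x. c * ?t R x) k)
      \<le> ennreal (norm2 (c / of_real (\<tau> ^ DIM('a))) / (1/\<tau>) ^ DIM('a)) * l2dist (fourier u) (fourier_integral (trunc R u))" for R
      using l2sq_scale[of "\<lambda>k. fourier u k - fourier_integral (trunc R u) k" "1/\<tau>" "c / of_real (\<tau> ^ DIM('a))"] \<tau>
      unfolding FT by (simp only: right_diff_distrib) simp
  qed auto
qed

lemma fourier_cmult:
  assumes "square_integrable u"
  shows "AE k in lborel. fourier (\<lambda>x. c * u x) k = c * fourier u k"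
  using fourier_scale[OF assms, of 1 c] by simp

lemma l2sq_shift:
  fixes f :: "'a::euclidean_space \<Rightarrow> complex"
  assumes [measurable]: "f \<in> Borel"
  shows "l2sq (\<lambda>x. f (x - t)) = l2sq f"
  unfolding l2sq_def using nn_integral_lborel_affine[of "\<lambda>x. ennreal (norm2 (f x))" 1 "- t"] by (simp add: add.commute)

lemma fourier_modulate:
  assumes u: "square_integrable u"
  shows "AE k in lborel. fourier (\<lambda>x. cis (\<theta> \<bullet> x) * u x) k = fourier u (k - \<theta>)"
proof -
  let ?t = "\<lambda>R x. cis (\<theta> \<bullet> x) * trunc R u x"
  have [measurable]: "u \<in> Borel" "fourier u \<in> Borel"
    using u fourier_L2[OF u] by auto
  have FT: "fourier_integral (\<lambda>x. ?t R x) k = fourier_integral (trunc R u) (k - \<theta>)" for R k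
    unfolding fourier_integral_def by (simp add: mult.assoc[symmetric] cis_mult inner_diff_left)
  show ?thesis
  proof (rule fourier_transfer[OF u, where f = "\<lambda>R x. ?t R x" and c = 1 and d = 1])
    show "square_integrable (\<lambda>x. cis (\<theta> \<bullet> x) * u x)" by (rule L2_bounded_mult[OF u]) auto
    show "integrable lborel (\<lambda>x. ?t R x)" for R
      by (rule int_bound[OF integrable_trunc[OF u, of R]]) (auto simp: norm_mult)
    show "l2sq (\<lambda>x. cis (\<theta> \<bullet> x) * u x - ?t R x) \<le> 1 * l2dist u (trunc R u)" for R
      unfolding right_diff_distrib[symmetric] by (simp add: l2sq_def norm_mult)
    show "l2sq (\<lambda>k. fourier u (k - \<theta>) - fourier_integral (\<lambda>x. ?t R x) k)
      \<le> 1 * l2dist (fourier u) (fourier_integral (trunc R u))" for R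
      using l2sq_shift[of "\<lambda>k. fourier u k - fourier_integral (trunc R u) k" \<theta>] unfolding FT by simp
  qed auto
qed

lemma fourier_add:
  assumes u: "square_integrable u" and w: "square_integrable w"
  shows "AE k in lborel. fourier (\<lambda>x. u x + w x) k = fourier u k + fourier w k"
proof (rule fourier_AE_eqI[where F = at_top and f = "\<lambda>R x. trunc R u x + trunc R w x"])
  have [measurable]: "u \<in> Borel" "fourier u \<in> Borel"
     "w \<in> Borel" "fourier w \<in> Borel"
    using u w fourier_L2[OF u] fourier_L2[OF w] by auto
  show "square_integrable (\<lambda>x. u x + w x)" by (rule L2_add[OF u w])
  show "(\<lambda>k. fourier u k + fourier w k) \<in> Borel" by measurable
  show "integrable lborel (\<lambda>x. trunc R u x + trunc R w x)" for R
    using integrable_trunc[OF u] integrable_trunc[OF w] by auto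
  have sum0: "((\<lambda>R. l2sq (\<lambda>x. (a x + b x) - (f R x + g R x))) \<longlongrightarrow> 0) at_top"
    if [measurable]: "a \<in> Borel" "b \<in> Borel" "\<And>R. f R \<in> Borel" "\<And>R. g R \<in> Borel"
    and l: "((\<lambda>R. l2dist a (f R)) \<longlongrightarrow> 0) at_top" "((\<lambda>R. l2dist b (g R)) \<longlongrightarrow> 0) at_top"
    for a b :: "'a \<Rightarrow> complex" and f g :: "real \<Rightarrow> 'a \<Rightarrow> complex"
  proof (rule tendsto_sandwich[OF _ _ tendsto_const])
    let ?b = "\<lambda>R. 2 * l2dist a (f R) + 2 * l2dist b (g R)"
    have "((\<lambda>R. ?b R) \<longlongrightarrow> 2 * 0 + 2 * 0) at_top"
      using l by (intro tendsto_add ennreal_tendsto_cmult) auto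
    thus "((\<lambda>R. ?b R) \<longlongrightarrow> 0) at_top" by simp
    have "l2sq (\<lambda>x. (a x + b x) - (f R x + g R x)) \<le> ?b R" for R
      using l2sq_add_le[of "\<lambda>x. a x - f R x" "\<lambda>x. b x - g R x"] by (simp add: algebra_simps)
    thus "\<forall>\<^sub>F R in at_top. l2sq (\<lambda>x. (a x + b x) - (f R x + g R x)) \<le> ?b R"
      by simp
  qed auto
  show "((\<lambda>R. l2sq (\<lambda>x. (u x + w x) - (trunc R u x + trunc R w x))) \<longlongrightarrow> 0) at_top"
    by (intro sum0 l2sq_trunc_tendsto u w) auto
  show "((\<lambda>R. l2sq (\<lambda>k. (fourier u k + fourier w k) - fourier_integral (\<lambda>x. trunc R u x + trunc R w x) k)) \<longlongrightarrow> 0) at_top"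
    unfolding fourier_integral_add[OF integrable_trunc[OF u] integrable_trunc[OF w]]
    using is_ft_fourier[OF u] is_ft_fourier[OF w]
    by (intro sum0) (auto simp: is_ft_iff)
qed auto

section \<open>Averages against a bounded density\<close>

text \<open>A probability density with an upper bound; the bound makes averages of \<open>L\<^sup>2\<close> functions bounded.\<close>

definition bounded_density :: "('a::euclidean_space \<Rightarrow> real) \<Rightarrow> real \<Rightarrow> bool" where
  "bounded_density h H \<longleftrightarrow> h \<in> Borel \<and> (\<forall>y. 0 \<le> h y \<and> h y \<le> H) \<and>
     integrable lborel h \<and> (LBINT y. h y) = 1"

definition avg :: "('a::euclidean_space \<Rightarrow> real) \<Rightarrow> ('a \<Rightarrow> complex) \<Rightarrow> 'a \<Rightarrow> complex" where
  "avg h u x = (LBINT y. of_real (h y) * u (x - y))"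

lemma densityD:
  assumes "bounded_density h H"
  shows "h \<in> Borel" "h y \<ge> 0" "h y \<le> H" "integrable lborel h" "(LBINT y. h y) = 1"
    "H \<ge> 0" "(NNI y. ennreal (h y)) = 1"
proof -
  show "h \<in> Borel" "h y \<ge> 0" "h y \<le> H" "integrable lborel h" "(LBINT y. h y) = 1"
    using assms by (auto simp: bounded_density_def)
  thus "H \<ge> 0" by (meson order.trans)
  show "(NNI y. ennreal (h y)) = 1"
    using assms by (subst nn_integral_eq_integral) (auto simp: bounded_density_def)
qed

lemma avg_measurable [measurable]:
  assumes [measurable]: "h \<in> Borel" "u \<in> Borel"
  shows "avg h u \<in> Borel"
  unfolding avg_def[abs_def] by measurable

text \<open>Nonnegativity of the variance of \<open>|w|\<close>.\<close>

lemma jensen_square: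
  fixes w :: "'a::euclidean_space \<Rightarrow> complex"
  assumes h: "bounded_density h H" and [measurable]: "w \<in> Borel"
    and int: "integrable lborel (\<lambda>y. h y * norm2 (w y))"
  shows "integrable lborel (\<lambda>y. of_real (h y) * w y)"
    and "norm2 (LBINT y. of_real (h y) * w y) \<le> (LBINT y. h y * norm2 (w y))"
proof -
  note [measurable] = densityD(1)[OF h] and nn = densityD(2)[OF h]
  have intn: "integrable lborel (\<lambda>y. h y * norm (w y))"
  proof (rule integrable_dominated)
    show "integrable lborel (\<lambda>y. h y + h y * norm2 (w y))"
      using int densityD(4)[OF h] by simp
    have "t \<le> 1 + t^2" for t :: real
      using zero_le_power2[of "t - 1/2"] by (simp add: power2_eq_square algebra_simps)
    from mult_left_mono[OF this nn]
    show "norm (h y * norm (w y)) \<le> h y + h y * norm2 (w y)" for y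
      using nn by (simp add: distrib_left)
  qed measurable
  thus "integrable lborel (\<lambda>y. of_real (h y) * w y)"
    by (rule int_bound) (auto simp: norm_mult nn)
  define m where "m = (LBINT y. h y * norm (w y))"
  have "0 \<le> (LBINT y. h y * (norm (w y) - m)^2)"
    using nn by (intro LB_nonneg) auto
  also have "\<dots> = (LBINT y. (h y * norm2 (w y) - 2 * m * (h y * norm (w y))) + m^2 * h y)"
    by (intro LB_cong refl) (simp add: power2_eq_square algebra_simps)
  also have "\<dots> = (LBINT y. h y * norm2 (w y)) - 2 * m * m + m^2 * 1"
    by (simp add: int intn densityD[OF h] m_def)
  finally have "m^2 \<le> (LBINT y. h y * norm2 (w y))" by (simp add: power2_eq_square)
  moreover have "norm (LBINT y. of_real (h y) * w y) \<le> m"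
    unfolding m_def using nn by (intro order.trans[OF integral_norm_bound]) (simp add: norm_mult)
  hence "norm2 (LBINT y. of_real (h y) * w y) \<le> m^2"
    by (intro power_mono) auto
  ultimately show "norm2 (LBINT y. of_real (h y) * w y) \<le> (LBINT y. h y * norm2 (w y))"
    by linarith
qed

lemma int_reflect:
  fixes f :: "'a::euclidean_space \<Rightarrow> 'b::{banach, second_countable_topology}"
  assumes "integrable lborel f" shows "integrable lborel (\<lambda>y. f (x - y))"
  using int_affine[OF assms, of "-1" x] by simp

lemma integral_lborel_reflect:
  fixes f :: "'a::euclidean_space \<Rightarrow> 'b::{banach, second_countable_topology}"
  assumes "f \<in> Borel" shows "(LBINT y. f (x - y)) = (LBINT y. f y)"
  using integral_lborel_affine[OF assms, of "-1" x] by simp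

lemma integral_lborel_shift:
  fixes f :: "'a::euclidean_space \<Rightarrow> 'b::{banach, second_countable_topology}"
  assumes "f \<in> Borel" shows "(LBINT y. f (y - x)) = (LBINT y. f y)"
  using integral_lborel_affine[OF assms, of "1" "-x"] by (simp add: add.commute)

lemma int_shift:
  fixes f :: "'a::euclidean_space \<Rightarrow> 'b::{banach, second_countable_topology}"
  assumes "integrable lborel f" shows "integrable lborel (\<lambda>y. f (y - x))"
  using int_affine[OF assms, of "1" "-x"] by (simp add: add.commute)

lemma integrable_density_mult:
  assumes h: "bounded_density h H" and f: "integrable lborel (f :: 'a::euclidean_space \<Rightarrow> complex)"
  shows "integrable lborel (\<lambda>y. of_real (h y) * f y)"
proof (rule integrable_dominated)
  note [measurable] = densityD(1)[OF h]
  show "integrable lborel (\<lambda>y. H * norm (f y))" using f by simp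
  show "(\<lambda>y. of_real (h y) * f y) \<in> Borel" using f by measurable
  show "norm (of_real (h y) * f y) \<le> H * norm (f y)" for y
    using densityD[OF h] by (auto simp: norm_mult intro!: mult_right_mono)
qed

lemma
  assumes h: "bounded_density h H" and u: "square_integrable u"
  shows integrable_avg_integrand: "integrable lborel (\<lambda>y. of_real (h y) * u (x - y))"
    and norm_avg_le: "norm2 (avg h u x) \<le> (LBINT y. h y * norm2 (u (x - y)))"
    and integrable_avg_square: "integrable lborel (\<lambda>y. h y * norm2 (u (x - y)))"
    and norm_avg_bounded: "norm2 (avg h u x) \<le> H * (LBINT y. norm2 (u y))"
proof -
  note [measurable] = densityD(1)[OF h]
  have [measurable]: "u \<in> Borel" using u by auto
  have iu: "integrable lborel (\<lambda>y. H * norm2 (u (x - y)))"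
    using u by (intro integrable_mult_right int_reflect[of "\<lambda>y. norm2 (u y)"]) (simp add: square_integrable_def)
  have le: "h y * norm2 (u (x - y)) \<le> H * norm2 (u (x - y))" for y
    using densityD[OF h] by (intro mult_right_mono) auto
  show int: "integrable lborel (\<lambda>y. h y * norm2 (u (x - y)))"
    using le densityD(2,6)[OF h] by (intro int_bound[OF iu]) (auto intro!: AE_I2)
  show "integrable lborel (\<lambda>y. of_real (h y) * u (x - y))"
    by (rule jensen_square(1)[OF h _ int]) measurable
  show 1: "norm2 (avg h u x) \<le> (LBINT y. h y * norm2 (u (x - y)))"
    unfolding avg_def by (rule jensen_square(2)[OF h _ int]) measurable
  also have "\<dots> \<le> (LBINT y. H * norm2 (u (x - y)))"
    by (intro integral_mono int iu le)
  also have "\<dots> = H * (LBINT y. norm2 (u y))"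
    using integral_lborel_reflect[of "\<lambda>y. norm2 (u y)" x] by simp
  finally show "norm2 (avg h u x) \<le> H * (LBINT y. norm2 (u y))" .
qed

lemma nn_integral_lborel_shift:
  fixes f :: "'a::euclidean_space \<Rightarrow> ennreal"
  assumes [measurable]: "f \<in> Borel"
  shows "(NNI x. f (x - t)) = (NNI x. f x)"
  using nn_integral_lborel_affine[of f 1 "- t"] by (simp add: add.commute)

lemma nn_integral_convolution:
  fixes f :: "'a::euclidean_space \<Rightarrow> ennreal"
  assumes h: "bounded_density h H" and [measurable]: "f \<in> Borel"
  shows "(NNI x. NNI y. ennreal (h y) * f (x - y)) = (NNI x. f x)"
proof -
  note [measurable] = densityD(1)[OF h]
  have "(NNI x. NNI y. ennreal (h y) * f (x - y)) = (NNI y. NNI x. ennreal (h y) * f (x - y))"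
    by (rule lborel_pair.Fubini') measurable
  also have "\<dots> = (NNI y. ennreal (h y) * (NNI x. f x))"
    by (intro nn_integral_cong) (simp add: nn_integral_cmult nn_integral_lborel_shift)
  also have "\<dots> = (NNI x. f x)"
    by (simp add: nn_integral_multc densityD(7)[OF h])
  finally show ?thesis .
qed

lemma l2sq_avg_le:
  assumes h: "bounded_density h H" and u: "square_integrable u"
  shows "l2sq (avg h u) \<le> l2sq u"
proof -
  note [measurable] = densityD(1)[OF h]
  have [measurable]: "u \<in> Borel" using u by auto
  have "l2sq (avg h u) \<le> (NNI x. NNI y. ennreal (h y) * ennreal (norm2 (u (x - y))))"
    unfolding l2sq_def
  proof (intro nn_integral_mono)
    fix x
    have "ennreal (norm2 (avg h u x)) \<le> ennreal (LBINT y. h y * norm2 (u (x - y)))"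
      by (intro ennreal_leI norm_avg_le[OF h u])
    also have "\<dots> = (NNI y. ennreal (h y * norm2 (u (x - y))))"
      using densityD(2)[OF h] by (intro nn_integral_eq_integral[symmetric] integrable_avg_square[OF h u]) auto
    also have "\<dots> = (NNI y. ennreal (h y) * ennreal (norm2 (u (x - y))))"
      using densityD(2)[OF h] by (simp add: ennreal_mult)
    finally show "ennreal (norm2 (avg h u x)) \<le> (NNI y. ennreal (h y) * ennreal (norm2 (u (x - y))))" .
  qed
  also have "\<dots> = l2sq u"
    unfolding l2sq_def by (rule nn_integral_convolution[OF h]) measurable
  finally show ?thesis .
qed

lemma L2_avg:
  assumes "bounded_density h H" "square_integrable u" shows "square_integrable (avg h u)"
  using l2sq_avg_le[OF assms] assms densityD(1)[OF assms(1)]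
  by (auto simp: L2_iff)

lemma integrable_density_shift_product:
  fixes f :: "'a::euclidean_space \<Rightarrow> complex"
  assumes h: "bounded_density h H" and f: "integrable lborel f"
  shows "integrable (lborel \<Otimes>\<^sub>M lborel) (\<lambda>(x, y). of_real (h y) * f (x - y))"
proof -
  note [measurable] = densityD(1)[OF h]
  have [measurable]: "f \<in> Borel" using f by auto
  have "(\<integral>\<^sup>+z. ennreal (norm (case z of (x, y) \<Rightarrow> of_real (h y) * f (x - y))) \<partial>(lborel \<Otimes>\<^sub>M lborel))
     = (NNI x. NNI y. ennreal (h y) * ennreal (norm (f (x - y))))"
    using densityD(2)[OF h]
    by (subst lborel.nn_integral_fst[symmetric]) (auto simp: norm_mult ennreal_mult)
  also have "\<dots> = (NNI x. ennreal (norm (f x)))"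
    by (rule nn_integral_convolution[OF h]) measurable
  also have "\<dots> < \<infinity>" using f by (simp add: integrable_iff_bounded)
  finally show ?thesis by (auto simp: integrable_iff_bounded)
qed

lemma integrable_avg:
  fixes f :: "'a::euclidean_space \<Rightarrow> complex"
  assumes h: "bounded_density h H" and f: "integrable lborel f"
  shows "integrable lborel (avg h f)"
  using lborel_pair.integrable_fst'[OF integrable_density_shift_product[OF h f]]
  by (simp add: avg_def[abs_def])

lemma fourier_integral_avg:
  fixes f :: "'a::euclidean_space \<Rightarrow> complex"
  assumes h: "bounded_density h H" and f: "integrable lborel f"
  shows "fourier_integral (avg h f) k = (LBINT y. cis (- (k \<bullet> y)) * of_real (h y)) * fourier_integral f k"
proof -
  note [measurable] = densityD(1)[OF h]
  have [measurable]: "f \<in> Borel" using f by auto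
  let ?K = "\<lambda>x y. cis (- (k \<bullet> x)) * (of_real (h y) * f (x - y))"
  let ?m = "\<lambda>y. cis (- (k \<bullet> y)) * of_real (h y)"
  let ?f = "\<lambda>x. cis (- (k \<bullet> x)) * f x"
  have int: "integrable (lborel \<Otimes>\<^sub>M lborel) (\<lambda>(x, y). ?K x y)"
    by (rule int_bound[OF integrable_density_shift_product[OF h f]])
       (auto simp: norm_mult)
  have "(LBINT x. cis (- (k \<bullet> x)) * avg h f x) = (LBINT x. LBINT y. ?K x y)"
    unfolding avg_def by simp
  also have "\<dots> = (LBINT y. LBINT x. ?K x y)"
    using lborel_pair.Fubini_integral[OF int] by simp
  also have "\<dots> = (LBINT y. ?m y * (LBINT x. ?f x))"
  proof (intro LB_cong refl)
    fix y
    have "(LBINT x. ?K x y)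
      = (LBINT x. (?m y) * ?f (x - y))"
    proof (intro LB_cong refl)
      fix x
      have "cis (- (k \<bullet> x)) = cis (- (k \<bullet> y)) * cis (- (k \<bullet> (x - y)))" by (simp add: cis_mult inner_diff_right)
      thus "?K x y
        = (?m y) * ?f (x - y)" by simp
    qed
    also have "\<dots> = ?m y * (LBINT x. ?f (x - y))"
      by (rule integral_mult_right_zero)
    also have "(LBINT x. ?f (x - y)) = (LBINT x. ?f x)"
      by (rule integral_lborel_shift[of "\<lambda>x. ?f x"]) measurable
    finally show "(LBINT x. ?K x y)
      = ?m y * (LBINT x. ?f x)" .
  qed
  also have "\<dots> = (LBINT y. ?m y) * (LBINT x. ?f x)"
    by (rule integral_mult_left_zero)
  finally show ?thesis by (simp add: fourier_integral_def)
qed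

text \<open>
  The transform of an average is \<open>fourier u\<close> times the transform of a probability density, and
  the latter has modulus at most \<open>1\<close>.
\<close>

lemma fourier_avg_norm_le:
  assumes h: "bounded_density h H" and u: "square_integrable u"
  shows "AE k in lborel. norm (fourier (avg h u) k) \<le> norm (fourier u k)"
proof -
  note [measurable] = densityD(1)[OF h]
  have [measurable]: "u \<in> Borel" "fourier u \<in> Borel"
    using u fourier_L2[OF u] by auto
  define H' where "H' k = (LBINT y. cis (- (k \<bullet> y)) * of_real (h y))" for k
  have [measurable]: "H' \<in> Borel" unfolding H'_def[abs_def] by measurable
  have H': "norm (H' k) \<le> 1" for k
    unfolding H'_def using densityD[OF h]
    by (intro order.trans[OF integral_norm_bound]) (simp add: norm_mult)
  have "AE k in lborel. fourier (avg h u) k = H' k * fourier u k"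
  proof (rule fourier_transfer[OF u, where f = "\<lambda>R. avg h (trunc R u)" and c = 1 and d = 1])
    show "square_integrable (avg h u)" by (rule L2_avg[OF h u])
    show "integrable lborel (avg h (trunc R u))" for R by (rule integrable_avg[OF h integrable_trunc[OF u]])
    have "avg h u x - avg h (trunc R u) x = avg h (\<lambda>x. u x - trunc R u x) x" for R x
      unfolding avg_def by (simp add: right_diff_distrib integrable_avg_integrand[OF h] u L2_trunc)
    thus "l2dist (avg h u) (avg h (trunc R u)) \<le> 1 * l2dist u (trunc R u)" for R
      using l2sq_avg_le[OF h L2_diff[OF u L2_trunc[OF u, of R]]] by simp
    show "l2sq (\<lambda>k. H' k * fourier u k - fourier_integral (avg h (trunc R u)) k)
      \<le> 1 * l2dist (fourier u) (fourier_integral (trunc R u))" for R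
      unfolding fourier_integral_avg[OF h integrable_trunc[OF u]] H'_def[symmetric] right_diff_distrib[symmetric] mult_1_left
      using H' by (intro l2sq_mono) (simp add: norm_mult mult_left_le_one_le)
  qed auto
  thus ?thesis
  proof eventually_elim
    case (elim k)
    thus ?case using H'[of k] by (simp add: norm_mult mult_left_le_one_le)
  qed
qed

definition ball_kernel :: "real \<Rightarrow> 'a::euclidean_space \<Rightarrow> real" where
  "ball_kernel r y = indicator (ball 0 r) y / measure lborel (ball (0::'a) r)"

lemma density_ball_kernel:
  assumes "r > 0"
  shows "bounded_density (ball_kernel r :: 'a::euclidean_space \<Rightarrow> real) (1 / measure lborel (ball (0::'a) r))"
proof -
  have [measurable]: "ball (0::'a) r \<in> sets borel" by auto
  have fin: "emeasure lborel (ball (0::'a) r) < \<infinity>" by (rule emeasure_bounded_finite) auto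
  have "measure lborel (ball (0::'a) r) > 0"
    using content_ball_pos[OF assms, of "0::'a"] by simp
  moreover have "integrable lborel (indicat_real (ball (0::'a) r))"
    using fin by (intro integrable_real_indicator) auto
  ultimately show ?thesis
    unfolding bounded_density_def ball_kernel_def[abs_def]
    by (auto intro!: divide_right_mono simp del: indicator_simps simp: indicator_le_1)
qed

section \<open>Averages over shrinking balls\<close>

definition nth_kernel :: "nat \<Rightarrow> 'a::euclidean_space \<Rightarrow> real" where
  "nth_kernel n = ball_kernel (inverse (real (Suc n)))"

definition avg_error :: "nat \<Rightarrow> ('a::euclidean_space \<Rightarrow> complex) \<Rightarrow> ennreal" where
  "avg_error n w = (NNI x. ennreal (norm (avg (nth_kernel n) w x - w x)))"

lemma density_nth_kernel:
  "bounded_density (nth_kernel n :: 'a::euclidean_space \<Rightarrow> real) (1 / measure lborel (ball (0::'a) (inverse (real (Suc n)))))"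
  unfolding nth_kernel_def by (rule density_ball_kernel) simp

lemma nth_kernel_measurable [measurable]: "(nth_kernel n :: 'a::euclidean_space \<Rightarrow> real) \<in> Borel"
  by (rule densityD(1)[OF density_nth_kernel])

lemma avg_add:
  assumes h: "bounded_density h H" and f: "integrable lborel f" and g: "integrable lborel g"
  shows "avg h (\<lambda>x. f x + g x) x = avg h f x + avg h g x"
  unfolding avg_def distrib_left
  by (intro LB_add integrable_density_mult[OF h] int_reflect f g)

lemma nn_integral_avg_le:
  assumes h: "bounded_density h H" and [measurable]: "f \<in> Borel"
  shows "(NNI x. ennreal (norm (avg h f x))) \<le> (NNI x. ennreal (norm (f x)))"
proof -
  have "ennreal (norm (avg h f x)) \<le> (NNI y. ennreal (h y) * ennreal (norm (f (x - y))))" for x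
    using norm_integral_le_nn[of lborel "\<lambda>y. complex_of_real (h y) * f (x - y)"] densityD(2)[OF h]
    by (simp add: avg_def norm_mult ennreal_mult)
  hence "(NNI x. ennreal (norm (avg h f x))) \<le> (NNI x. NNI y. ennreal (h y) * ennreal (norm (f (x - y))))"
    by (rule nn_integral_mono)
  also have "\<dots> = (NNI x. ennreal (norm (f x)))"
    by (rule nn_integral_convolution[OF h]) measurable
  finally show ?thesis .
qed

lemma avg_error_add_le:
  assumes f: "integrable lborel f" and g: "integrable lborel g"
  shows "avg_error n (\<lambda>x. f x + g x) \<le> avg_error n f + avg_error n g"
proof -
  have [measurable]: "f \<in> Borel" "g \<in> Borel" using f g by auto
  have "norm (avg (nth_kernel n) (\<lambda>x. f x + g x) x - (f x + g x))
     \<le> norm (avg (nth_kernel n) f x - f x) + norm (avg (nth_kernel n) g x - g x)" for x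
    unfolding avg_add[OF density_nth_kernel f g] by (metis add_diff_add norm_triangle_ineq)
  thus ?thesis unfolding avg_error_def
    by (subst nn_integral_add[symmetric]) (auto intro!: nn_integral_mono simp: ennreal_leI simp flip: ennreal_plus)
qed

lemma avg_error_le:
  assumes f: "integrable lborel f"
  shows "avg_error n f \<le> 2 * (NNI x. ennreal (norm (f x)))"
proof -
  have [measurable]: "f \<in> Borel" using f by auto
  have "avg_error n f \<le> (NNI x. (ennreal (norm (avg (nth_kernel n) f x)) + ennreal (norm (f x))))"
    unfolding avg_error_def
    by (intro nn_integral_mono) (simp add: ennreal_leI norm_triangle_ineq4 flip: ennreal_plus)
  also have "\<dots> = (NNI x. ennreal (norm (avg (nth_kernel n) f x))) + (NNI x. ennreal (norm (f x)))"
    by (rule nn_integral_add) auto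
  also have "\<dots> \<le> 2 * (NNI x. ennreal (norm (f x)))"
    unfolding mult_2 by (intro add_right_mono nn_integral_avg_le[OF density_nth_kernel]) auto
  finally show ?thesis .
qed

lemma avg_error_tendsto_approx:
  assumes f: "integrable lborel f"
    and ex: "\<And>e. e > 0 \<Longrightarrow> \<exists>g. integrable lborel g \<and> (NNI x. ennreal (norm (f x - g x))) \<le> ennreal e \<and>
           (\<lambda>n. avg_error n g) \<longlonglongrightarrow> 0"
  shows "(\<lambda>n. avg_error n f) \<longlonglongrightarrow> 0"
proof (rule tendsto_ennreal_0I)
  fix e :: real assume "e > 0"
  then obtain g where g: "integrable lborel g" "(NNI x. ennreal (norm (f x - g x))) \<le> ennreal (e/4)" "(\<lambda>n. avg_error n g) \<longlonglongrightarrow> 0"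
    using ex[of "e/4"] by auto
  have fg: "integrable lborel (\<lambda>x. f x - g x)" using f g(1) by simp
  have "\<forall>\<^sub>F n in sequentially. avg_error n g < ennreal (e/2)"
    using g(3) \<open>e > 0\<close> by (intro order_tendstoD(2)[of _ 0]) auto
  thus "\<forall>\<^sub>F n in sequentially. avg_error n f \<le> ennreal e"
  proof eventually_elim
    case (elim n)
    have "avg_error n f \<le> avg_error n g + avg_error n (\<lambda>x. f x - g x)"
      using avg_error_add_le[OF g(1) fg, of n] by simp
    also have "\<dots> \<le> ennreal (e/2) + 2 * ennreal (e/4)"
      using elim by (intro add_mono order.trans[OF avg_error_le[OF fg] mult_left_mono[OF g(2)]]) auto
    also have "\<dots> = ennreal e"
      using \<open>e > 0\<close> by (simp add: mult_2 flip: ennreal_plus)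
    finally show ?case .
  qed
qed

text \<open>
  Scheffe's argument. The averages \<open>A\<^sub>n\<close> of the indicator \<open>f\<close> have the same integral as \<open>f\<close>, and
  \<open>|A\<^sub>n - f| = 2f(1 - A\<^sub>n) + (A\<^sub>n - f)\<close> because \<open>f\<close> only takes the values \<open>0\<close> and \<open>1\<close>. The term \<open>f(1 - A\<^sub>n)\<close>
  is dominated by \<open>f\<close>, and at each point of the open set it is eventually \<open>0\<close>.
\<close>

lemma avg_error_indicator_open:
  fixes U :: "'a::euclidean_space set"
  assumes "open U" and fin: "emeasure lborel U < \<infinity>"
  shows "(\<lambda>n. avg_error n (\<lambda>x. indicator U x *\<^sub>R c)) \<longlonglongrightarrow> 0"
proof -
  have [measurable]: "U \<in> sets borel" using \<open>open U\<close> by auto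
  let ?f = "indicat_real U"
  let ?w = "\<lambda>x. indicator U x *\<^sub>R c"
  define A where "A n x = (LBINT y. nth_kernel n y * ?f (x - y))" for n and x :: 'a
  have [measurable]: "A n \<in> Borel" for n unfolding A_def[abs_def] by measurable
  note h = density_nth_kernel[where 'a='a]
  have K: "integrable lborel (\<lambda>y. nth_kernel n y * ?f (x - y))" for n x
    by (rule integrable_dominated[OF densityD(4)[OF h]]) (auto simp: indicator_def densityD(2)[OF h])
  have A0: "0 \<le> A n x" for n x
    unfolding A_def using densityD(2)[OF h] by (intro LB_nonneg) simp
  have A1: "A n x \<le> 1" for n x
  proof -
    have "A n x \<le> (LBINT y. nth_kernel n (y :: 'a))"
      unfolding A_def using densityD(2)[OF h] by (intro integral_mono K densityD(4)[OF h]) (auto simp: indicator_def)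
    thus ?thesis using densityD(5)[OF h] by simp
  qed
  have int: "integrable lborel ?f" using fin by (intro integrable_real_indicator) auto
  have NA: "(NNI x. ennreal (A n x)) = ennreal (LBINT x. ?f x)" for n
  proof -
    have "(NNI x. ennreal (A n x)) = (NNI x. NNI y. ennreal (nth_kernel n y) * ennreal (?f (x - y)))"
      unfolding A_def using densityD(2)[OF h]
      by (intro nn_integral_cong) (subst nn_integral_eq_integral[OF K, symmetric], auto simp: ennreal_mult)
    also have "\<dots> = (NNI x. ennreal (?f x))" by (rule nn_integral_convolution[OF h]) measurable
    also have "\<dots> = ennreal (LBINT x. ?f x)" by (rule nn_integral_eq_integral[OF int]) auto
    finally show ?thesis .
  qed
  have iA: "integrable lborel (A n)" for n
    unfolding integrable_iff_bounded using NA[of n] A0 by simp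
  have eqA: "(LBINT x. A n x) = (LBINT x. ?f x)" for n
    using NA[of n] A0 by (subst integral_eq_nn_integral) auto
  let ?g = "\<lambda>n x. ?f x * (1 - A n x)"
  have ig: "integrable lborel (?g n)" for n
    using A0[of n] A1[of n] by (intro integrable_dominated[OF int]) (auto simp: indicator_def)
  have *: "avg_error n ?w = ennreal (2 * norm c * (LBINT x. ?g n x))" for n
  proof -
    have pt: "norm (avg (nth_kernel n) ?w x - ?w x)
      = norm c * (2 * ?g n x + (A n x - ?f x))" for x
    proof -
      have "avg (nth_kernel n) ?w x = complex_of_real (A n x) * c"
        unfolding avg_def A_def integral_complex_of_real[symmetric] integral_mult_left_zero[symmetric]
        by (intro LB_cong) (auto simp: scaleR_conv_of_real)
      hence "avg (nth_kernel n) ?w x - ?w x = complex_of_real (A n x - ?f x) * c"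
        by (simp add: scaleR_conv_of_real left_diff_distrib)
      moreover have "\<bar>A n x - ?f x\<bar> = 2 * ?g n x + (A n x - ?f x)"
        using A0[of n x] A1[of n x] by (auto simp: indicator_def)
      ultimately show ?thesis by (simp only: norm_mult norm_of_real mult.commute)
    qed
    have "avg_error n ?w = ennreal (LBINT x. norm c * (2 * ?g n x + (A n x - ?f x)))"
      unfolding avg_error_def pt
      by (intro nn_integral_eq_integral int_add int_diff integrable_mult_right int iA ig AE_I2) (simp add: pt[symmetric])
    also have "(LBINT x. norm c * (2 * ?g n x + (A n x - ?f x))) = 2 * norm c * (LBINT x. ?g n x)"
      using int iA[of n] ig[of n] eqA[of n] by simp
    finally show ?thesis .
  qed
  have "(\<lambda>n. LBINT x. ?g n x) \<longlonglongrightarrow> (LINT x|(lborel::'a measure). 0)"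
  proof (rule integral_dominated_convergence[OF _ _ int])
    show "AE x in lborel. (\<lambda>n. ?g n x) \<longlonglongrightarrow> 0"
    proof (intro AE_I2 tendsto_eventually)
      fix x
      show "\<forall>\<^sub>F n in sequentially. ?g n x = 0"
      proof (cases "x \<in> U")
        case True
        then obtain d where d: "d > 0" "ball x d \<subseteq> U" using \<open>open U\<close> open_contains_ball by blast
        have "\<forall>\<^sub>F n in sequentially. inverse (real (Suc n)) < d"
          using LIMSEQ_inverse_real_of_nat d(1) by (rule order_tendstoD(2))
        thus ?thesis
        proof eventually_elim
          case (elim n)
          have "nth_kernel n y * ?f (x - y) = nth_kernel n y" for y
            using elim d(2) by (auto simp: nth_kernel_def ball_kernel_def indicator_def dist_norm subset_iff simp del: of_nat_Suc)
          hence "A n x = 1" unfolding A_def by (simp only: densityD(5)[OF h])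
          thus ?case by simp
        qed
      qed auto
    qed
    show "AE x in lborel. norm (?g n x) \<le> ?f x" for n
      using A0[of n] A1[of n] by (auto simp: indicator_def)
  qed measurable
  hence "(\<lambda>n. ennreal (2 * norm c * (LBINT x. ?g n x))) \<longlonglongrightarrow> ennreal (2 * norm c * 0)"
    by (intro tendsto_intros tendsto_ennrealI) auto
  thus ?thesis unfolding * by simp
qed

text \<open>
  Borel sets are approximated by open sets from outside, integrable functions by the usual
  induction; averaging does not increase the \<open>L\<^sup>1\<close> norm, so the approximation errors carry over.
\<close>

lemma avg_error_tendsto:
  fixes w :: "'a::euclidean_space \<Rightarrow> complex"
  assumes "integrable lborel w"
  shows "(\<lambda>n. avg_error n w) \<longlonglongrightarrow> 0"
  using assms
proof (induction rule: integrable_induct)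
  case (base A c)
  hence [measurable]: "A \<in> sets borel" by simp
  have int: "integrable lborel (\<lambda>x. indicator B x *\<^sub>R c)" if "B \<in> sets borel" "emeasure lborel B < \<infinity>" for B :: "'a set"
    using that by (intro integrable_scaleR_left integrable_real_indicator) auto
  show ?case
  proof (rule avg_error_tendsto_approx[OF int])
    fix e :: real assume "e > 0"
    define d where "d = e / (norm c + 1)"
    have "d > 0" using \<open>e > 0\<close> by (simp add: d_def add_nonneg_pos)
    have "A \<in> sets lebesgue" by (auto simp: sets_completionI_sets)
    then obtain U where U: "open U" "A \<subseteq> U" "emeasure lebesgue (U - A) < ennreal d"
      using sets_lebesgue_outer_open[OF _ \<open>d > 0\<close>] by metis
    have [measurable]: "U \<in> sets borel" using U(1) by auto
    have UA: "emeasure lborel (U - A) < ennreal d" using U(3) by simp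
    have "emeasure lborel U \<le> emeasure lborel A + emeasure lborel (U - A)"
      using U(2) by (subst plus_emeasure) (auto intro: emeasure_mono)
    also have "\<dots> < \<infinity>" using base UA by (auto simp: less_top[symmetric] top_unique intro: less_trans)
    finally have finU: "emeasure lborel U < \<infinity>" .
    have "(NNI x. ennreal (norm (indicator A x *\<^sub>R c - indicator U x *\<^sub>R c)))
        = (NNI x. ennreal (norm c) * indicator (U - A) x)"
      using U(2) by (intro nn_integral_cong) (auto simp: indicator_def)
    also have "\<dots> = ennreal (norm c) * emeasure lborel (U - A)"
      by (simp add: nn_integral_cmult_indicator)
    also have "\<dots> \<le> ennreal (norm c) * ennreal d"
      using UA by (intro mult_left_mono) auto
    also have "\<dots> = ennreal (norm c * d)" using \<open>d > 0\<close> by (simp add: ennreal_mult)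
    also have "\<dots> \<le> ennreal e"
    proof (rule ennreal_leI)
      have "norm c * d \<le> (norm c + 1) * d" using \<open>d > 0\<close> by (intro mult_right_mono) auto
      also have "\<dots> = e" unfolding d_def using norm_ge_zero[of c] by (simp add: add_nonneg_eq_0_iff)
      finally show "norm c * d \<le> e" .
    qed
    finally show "\<exists>g. integrable lborel g \<and> (NNI x. ennreal (norm (indicator A x *\<^sub>R c - g x))) \<le> ennreal e \<and>
           (\<lambda>n. avg_error n g) \<longlonglongrightarrow> 0"
      using avg_error_indicator_open[OF U(1) finU] int[OF _ finU] by (intro exI[of _ "\<lambda>x. indicator U x *\<^sub>R c"]) auto
  qed (use base in auto)
next
  case (add f g)
  show ?case
  proof (rule tendsto_sandwich[OF _ _ tendsto_const])
    show "(\<lambda>n. avg_error n f + avg_error n g) \<longlonglongrightarrow> 0"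
      using tendsto_add[OF add.IH] by simp
  qed (use avg_error_add_le[OF add.hyps] in auto)
next
  case (lim f s)
  note P = lim.IH and s_le = lim.hyps(3) and s_lim = lim.hyps(2) and fi = lim.hyps(4)
  have [measurable]: "f \<in> Borel" "\<And>i. s i \<in> Borel" using lim by auto
  show ?case
  proof (rule avg_error_tendsto_approx[OF fi])
    fix e :: real assume "e > 0"
    have "(\<lambda>i. NNI x. ennreal (norm (f x - s i x))) \<longlonglongrightarrow> (\<integral>\<^sup>+x. 0 \<partial>(lborel::'a measure))"
    proof (rule nn_integral_dominated_convergence)
      show "AE x in lborel. ennreal (norm (f x - s j x)) \<le> ennreal (3 * norm (f x))" for j
      proof (intro AE_I2 ennreal_leI)
        fix x show "norm (f x - s j x) \<le> 3 * norm (f x)"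
          using s_le[of x j] norm_triangle_ineq4[of "f x" "s j x"] by simp
      qed
      show "(NNI x. ennreal (3 * norm (f x))) < \<infinity>"
        using fi by (simp add: integrable_iff_bounded ennreal_mult nn_integral_cmult ennreal_mult_less_top)
      show "AE x in lborel. (\<lambda>i. ennreal (norm (f x - s i x))) \<longlonglongrightarrow> 0"
      proof (intro AE_I2)
        fix x
        have "(\<lambda>i. ennreal (norm (f x - s i x))) \<longlonglongrightarrow> ennreal (norm (f x - f x))"
          using s_lim[of x] by (intro tendsto_ennrealI tendsto_intros) auto
        thus "(\<lambda>i. ennreal (norm (f x - s i x))) \<longlonglongrightarrow> 0" by simp
      qed
    qed auto
    hence "\<forall>\<^sub>F i in sequentially. (NNI x. ennreal (norm (f x - s i x))) < ennreal e"
      using \<open>e > 0\<close> by (intro order_tendstoD(2)[of _ 0]) auto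
    then obtain i where "(NNI x. ennreal (norm (f x - s i x))) < ennreal e"
      by (auto dest: eventually_happens)
    thus "\<exists>g. integrable lborel g \<and> (NNI x. ennreal (norm (f x - g x))) \<le> ennreal e \<and>
           (\<lambda>n. avg_error n g) \<longlonglongrightarrow> 0"
      using P[of i] lim.hyps(1)[of i] by (intro exI[of _ "s i"]) auto
  qed
qed

lemma avg_nth_kernel_AE_subseq:
  fixes w :: "'a::euclidean_space \<Rightarrow> complex"
  assumes w: "integrable lborel w"
  obtains r where "strict_mono r" "AE x in lborel. (\<lambda>n. avg (nth_kernel (r n)) w x) \<longlonglongrightarrow> w x"
proof -
  have int: "integrable lborel (\<lambda>x. avg (nth_kernel n) w x - w x)" for n
    by (intro int_diff integrable_avg[OF density_nth_kernel] w)
  have "avg_error n w = ennreal (LBINT x. norm (avg (nth_kernel n) w x - w x))" for n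
    unfolding avg_error_def using int[of n] by (intro nn_integral_eq_integral) auto
  hence lim: "(\<lambda>n. LBINT x. norm (avg (nth_kernel n) w x - w x)) \<longlonglongrightarrow> 0"
    using avg_error_tendsto[OF w] by (simp add: ennreal_tendsto_0_iff)
  obtain r where r: "strict_mono r" "AE x in lborel. (\<lambda>n. avg (nth_kernel (r n)) w x - w x) \<longlonglongrightarrow> 0"
    using tendsto_L1_AE_subseq[OF int lim] by blast
  have "AE x in lborel. (\<lambda>n. avg (nth_kernel (r n)) w x) \<longlonglongrightarrow> w x"
    using r(2) by eventually_elim (simp add: LIM_zero_iff)
  thus thesis using that r(1) by blast
qed

section \<open>Power integrability in the Sobolev class\<close>

definition mass :: "('a::euclidean_space \<Rightarrow> complex) \<Rightarrow> real" where
  "mass u = (LBINT x. norm2 (u x))"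

definition power_integral :: "real \<Rightarrow> ('a::euclidean_space \<Rightarrow> complex) \<Rightarrow> real" where
  "power_integral p u = (LBINT x. norm (u x) powr p)"

text \<open>The Fourier multiplier of \<open>\<surd>(-\<Delta>) + \<i>v\<cdot>\<nabla>\<close>.\<close>

definition symbol :: "'a::euclidean_space \<Rightarrow> 'a \<Rightarrow> real" where
  "symbol v k = norm k - v \<bullet> k"

lemma mass_nonneg: "mass u \<ge> 0"
  by (simp add: mass_def)

lemma power_integral_nonneg: "power_integral p u \<ge> 0"
  by (simp add: power_integral_def)

lemma l2sq_eq_mass: "square_integrable u \<Longrightarrow> l2sq u = ennreal (mass u)"
  by (simp add: mass_def l2sq_eq_integral)

lemma mass_mono_l2sq:
  assumes "square_integrable u" "square_integrable w" "l2sq u \<le> ennreal c * l2sq w" "c \<ge> 0"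
  shows "mass u \<le> c * mass w"
  using assms by (simp add: l2sq_eq_mass mass_nonneg flip: ennreal_mult)

lemma Lp_norm_powr: "q > 0 \<Longrightarrow> Lp_norm q u powr q = power_integral q u"
  unfolding Lp_norm_def power_integral_def by (simp add: powr_powr)

lemma norm_powr_2: "norm (x::complex) powr 2 = norm2 x"
  by (cases "x = 0") (auto simp: powr_numeral)

lemma Lp_norm_2: "Lp_norm 2 u = sqrt (mass u)"
  unfolding Lp_norm_def mass_def norm_powr_2 by (simp add: powr_half_sqrt)

lemma Lp_norm_2_sq: "(Lp_norm 2 u)^2 = mass u"
  by (simp add: Lp_norm_2 mass_nonneg)

lemma Lp_norm_2_powr: "Lp_norm 2 u powr (2 * s) = mass u powr s"
  using mass_nonneg[of u] by (simp add: Lp_norm_2 powr_half_sqrt[symmetric] powr_powr)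

lemma inner_le_norm: "norm v < 1 \<Longrightarrow> \<bar>v \<bullet> k\<bar> \<le> norm (k::'a::euclidean_space)"
  using Cauchy_Schwarz_ineq2[of v k] mult_right_mono[of "norm v" 1 "norm k"] by simp

lemma symbol_nonneg: "norm v < 1 \<Longrightarrow> symbol v k \<ge> 0"
  using inner_le_norm[of v k] by (auto simp: symbol_def)

lemma symbol_le: "norm v < 1 \<Longrightarrow> symbol v k \<le> 2 * norm k"
  using inner_le_norm[of v k] by (auto simp: symbol_def)

lemma symbol_diff_le:
  assumes "norm v < 1" shows "symbol v k \<le> symbol v l + 2 * norm (k - l)"
  using inner_le_norm[OF assms, of "k - l"] norm_triangle_ineq2[of k l]
  by (auto simp: symbol_def inner_diff_right)

lemma symbol_measurable [measurable]: "symbol v \<in> Borel"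
  unfolding symbol_def[abs_def] by measurable

lemma T_eq: "T v u = (LBINT k. symbol v k * norm2 (fourier u k))"
  by (simp add: T_def symbol_def)

abbreviation H_half :: "('a::euclidean_space \<Rightarrow> complex) set" where
  "H_half \<equiv> sobolev_H (1/2)"

lemma sobolev_half_iff:
  "u \<in> H_half \<longleftrightarrow> square_integrable u \<and> integrable lborel (\<lambda>k. sqrt (1 + norm2 k) * norm2 (fourier u k))"
  unfolding sobolev_H_def by (simp add: powr_half_sqrt add_nonneg_nonneg)

lemma H_half_L2: "u \<in> H_half \<Longrightarrow> square_integrable u"
  by (simp add: sobolev_half_iff)

lemma norm_le_sqrt_1: "norm k \<le> sqrt (1 + norm2 k)"
  by (rule real_le_rsqrt) simp

lemma int_norm_fourier:
  assumes u: "u \<in> H_half"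
  shows "integrable lborel (\<lambda>k. norm k * norm2 (fourier u k))"
proof -
  have [measurable]: "fourier u \<in> Borel"
    using fourier_L2[OF H_half_L2[OF u]] by auto
  show ?thesis
  proof (rule integrable_dominated)
    show "integrable lborel (\<lambda>k. sqrt (1 + norm2 k) * norm2 (fourier u k))"
      using u by (simp add: sobolev_half_iff)
    show "norm (norm k * norm2 (fourier u k)) \<le> sqrt (1 + norm2 k) * norm2 (fourier u k)" for k
      using norm_le_sqrt_1 by (auto intro!: mult_right_mono)
  qed measurable
qed

lemma integrable_fourier_sq:
  "square_integrable u \<Longrightarrow> integrable lborel (\<lambda>k. norm2 (fourier u k))"
  using fourier_L2 by (auto simp: square_integrable_def)

lemma mass_fourier_le: "square_integrable u \<Longrightarrow> mass (fourier u) \<le> 4 * mass u"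
  using l2sq_fourier_le[of u] by (intro mass_mono_l2sq fourier_L2) auto

lemma sobolev_halfI:
  assumes w: "square_integrable w" and g: "integrable lborel g"
    and le: "AE k in lborel. norm k * norm2 (fourier w k) \<le> g k"
  shows "w \<in> H_half"
  unfolding sobolev_half_iff
proof (intro conjI w)
  have [measurable]: "fourier w \<in> Borel" using fourier_L2[OF w] by auto
  show "integrable lborel (\<lambda>k. sqrt (1 + norm2 k) * norm2 (fourier w k))"
  proof (rule int_bound[OF int_add[OF integrable_fourier_sq[OF w] g]])
    show "AE k in lborel. norm (sqrt (1 + norm2 k) * norm2 (fourier w k)) \<le> norm (norm2 (fourier w k) + g k)"
      using le
    proof eventually_elim
      case (elim k)
      have "sqrt (1 + norm2 k) \<le> 1 + norm k"
        by (rule real_le_lsqrt) (auto simp: power2_eq_square algebra_simps)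
      from mult_right_mono[OF this, of "norm2 (fourier w k)"] elim show ?case
        by (auto simp: distrib_right)
    qed
  qed measurable
qed

lemma integrable_T:
  assumes u: "u \<in> H_half" and v: "norm v < 1"
  shows "integrable lborel (\<lambda>k. symbol v k * norm2 (fourier u k))"
proof -
  have [measurable]: "fourier u \<in> Borel"
    using fourier_L2[OF H_half_L2[OF u]] by auto
  show ?thesis
  proof (rule integrable_dominated)
    show "integrable lborel (\<lambda>k. 2 * (norm k * norm2 (fourier u k)))"
      using int_norm_fourier[OF u] by simp
    show "norm (symbol v k * norm2 (fourier u k)) \<le> 2 * (norm k * norm2 (fourier u k))" for k
      using mult_right_mono[OF symbol_le[OF v, of k], of "norm2 (fourier u k)"] symbol_nonneg[OF v, of k]
      by (simp add: mult.assoc)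
  qed measurable
qed

lemma T_nonneg: "norm v < 1 \<Longrightarrow> T v u \<ge> 0"
  unfolding T_eq by (intro LB_nonneg) (simp add: symbol_nonneg)

lemma sobolev_dominated:
  assumes u: "u \<in> H_half" and w: "square_integrable w"
    and le: "AE k in lborel. norm (fourier w k) \<le> norm (fourier u k)" and v: "norm v < 1"
  shows "w \<in> H_half" "T v w \<le> T v u"
proof -
  have [measurable]: "fourier w \<in> Borel" using fourier_L2[OF w] by auto
  show W: "w \<in> H_half"
  proof (rule sobolev_halfI[OF w int_norm_fourier[OF u]])
    show "AE k in lborel. norm k * norm2 (fourier w k) \<le> norm k * norm2 (fourier u k)"
      using le by eventually_elim (auto intro!: mult_left_mono power_mono)
  qed
  show "T v w \<le> T v u"
    unfolding T_eq
  proof (rule integral_mono_AE[OF integrable_T[OF W v] integrable_T[OF u v]])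
    show "AE k in lborel. symbol v k * norm2 (fourier w k) \<le> symbol v k * norm2 (fourier u k)"
      using le by eventually_elim (intro mult_left_mono power_mono symbol_nonneg v, auto)
  qed
qed

lemma integrable_powr_bounded:
  assumes w: "square_integrable w" and "p \<ge> 2" and bd: "\<And>x. norm2 (w x) \<le> B"
  shows "integrable lborel (\<lambda>x. norm (w x) powr p)"
proof (rule integrable_dominated)
  show "integrable lborel (\<lambda>x. sqrt B powr (p - 2) * norm2 (w x))"
    using w by (simp add: square_integrable_def)
  show "(\<lambda>x. norm (w x) powr p) \<in> Borel" using w by measurable
  fix x
  have "norm (w x) powr p = norm (w x) powr (p - 2) * norm (w x) powr 2"
    by (subst powr_add[symmetric]) simp
  also have "\<dots> \<le> sqrt B powr (p - 2) * norm (w x) powr 2"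
    using bd[of x] \<open>p \<ge> 2\<close> by (intro mult_right_mono powr_mono2 real_le_rsqrt) auto
  finally show "norm (norm (w x) powr p) \<le> sqrt B powr (p - 2) * norm2 (w x)"
    by (simp add: norm_powr_2)
qed

text \<open>
  The assumed inequality carries information only where the power is integrable. Averages over
  balls of radius \<open>1/(n+1)\<close> are bounded, hence have integrable power, and satisfy the inequality
  with a right-hand side independent of \<open>n\<close>. On each ball \<open>B(0,R)\<close> they agree with averages of an
  integrable function, so a subsequence converges to \<open>u\<close> almost everywhere there and Fatou's
  lemma applies.
\<close>

lemma sobolev_integrable_power:
  fixes u :: "'a::euclidean_space \<Rightarrow> complex"
  assumes GN: "\<And>w :: 'a \<Rightarrow> complex. w \<in> H_half \<Longrightarrow> power_integral p w \<le> C * T v w * mass w powr s"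
    and "C \<ge> 0" "s \<ge> 0" "p \<ge> 2" and v: "norm v < 1" and u: "u \<in> H_half"
  shows "integrable lborel (\<lambda>x. norm (u x) powr p)"
proof -
  have u2: "square_integrable u" using u by (rule H_half_L2)
  have [measurable]: "u \<in> Borel" using u2 by auto
  define h where "h n = (nth_kernel n :: 'a \<Rightarrow> real)" for n
  note h = density_nth_kernel[where 'a='a, folded h_def]
  note [measurable] = densityD(1)[OF h]
  define M where "M = C * T v u * mass u powr s"
  let ?u = "\<lambda>x. ennreal (norm (u x) powr p)"
  let ?b = "\<lambda>n x. ?u x * indicator (ball 0 (real n)) x"
  let ?v = "\<lambda>n x. ennreal (norm (avg (h n) u x) powr p)"
  have bound: "(NNI x. ?v n x) \<le> ennreal M" for n
  proof -
    have sq: "square_integrable (avg (h n) u)" by (rule L2_avg[OF h u2])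
    note dom = sobolev_dominated[OF u sq fourier_avg_norm_le[OF h u2] v]
    have "integrable lborel (\<lambda>x. norm (avg (h n) u x) powr p)"
      by (rule integrable_powr_bounded[OF sq \<open>p \<ge> 2\<close> norm_avg_bounded[OF h u2]])
    hence "(NNI x. ?v n x) = ennreal (power_integral p (avg (h n) u))"
      unfolding power_integral_def by (intro nn_integral_eq_integral) auto
    moreover have "power_integral p (avg (h n) u) \<le> M"
    proof -
      have "mass (avg (h n) u) \<le> 1 * mass u"
        using l2sq_avg_le[OF h u2] by (intro mass_mono_l2sq sq u2) auto
      hence "C * T v (avg (h n) u) * mass (avg (h n) u) powr s \<le> M"
        unfolding M_def using \<open>C \<ge> 0\<close> \<open>s \<ge> 0\<close> T_nonneg[OF v] dom(2)
        by (intro mult_mono powr_mono2 mult_nonneg_nonneg) (auto simp: mass_nonneg)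
      thus ?thesis using GN[OF dom(1)] by linarith
    qed
    ultimately show ?thesis by (simp add: ennreal_leI)
  qed
  have ball_bound: "(NNI x. ?u x * indicator (ball 0 R) x) \<le> ennreal M" for R
  proof -
    \<comment> \<open>All kernels live in the unit ball, so on \<open>B(0,R)\<close> the averages see \<open>u\<close> only up to radius \<open>R + 1\<close>.\<close>
    define w where "w = trunc (R + 1) u"
    have wi: "integrable lborel w" unfolding w_def by (rule integrable_trunc[OF u2])
    have same: "avg (h n) w x = avg (h n) u x" if "x \<in> ball 0 R" for n x
      unfolding avg_def
    proof (intro LB_cong refl)
      fix y
      show "complex_of_real (h n y) * w (x - y) = complex_of_real (h n y) * u (x - y)"
      proof (cases "norm y < inverse (real (Suc n))")
        case True
        have "inverse (real (Suc n)) \<le> 1" by (simp add: field_simps)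
        hence "norm (x - y) \<le> R + 1" using True that norm_triangle_ineq4[of x y] by simp
        thus ?thesis by (simp add: w_def trunc_def)
      qed (simp add: h_def nth_kernel_def ball_kernel_def)
    qed
    obtain r where r: "AE x in lborel. (\<lambda>n. avg (h (r n)) w x) \<longlonglongrightarrow> w x"
      using avg_nth_kernel_AE_subseq[OF wi] unfolding h_def by metis
    have "(NNI x. ?u x * indicator (ball 0 R) x)
       \<le> (NNI x. liminf (\<lambda>n. ?v (r n) x))"
    proof (rule nn_integral_mono_AE, use r in eventually_elim)
      case (elim x)
      show ?case
      proof (cases "x \<in> ball 0 R")
        case True
        have "w x = u x" using True by (simp add: w_def trunc_def)
        hence "(\<lambda>n. avg (h (r n)) u x) \<longlonglongrightarrow> u x" using elim same[OF True] by simp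
        hence "(\<lambda>n. norm (avg (h (r n)) u x) powr p) \<longlonglongrightarrow> norm (u x) powr p"
          using \<open>p \<ge> 2\<close> by (intro tendsto_powr' tendsto_norm tendsto_const) auto
        hence "(\<lambda>n. ?v (r n) x) \<longlonglongrightarrow> ?u x"
          by (rule tendsto_ennrealI)
        hence "liminf (\<lambda>n. ?v (r n) x) = ?u x"
          by (intro lim_imp_Liminf) auto
        thus ?thesis using True by simp
      qed simp
    qed
    also have "\<dots> \<le> liminf (\<lambda>n. NNI x. ?v (r n) x)"
      by (intro nn_integral_liminf) measurable
    also have "\<dots> \<le> ennreal M"
      by (rule Liminf_le) (use bound in auto)
    finally show ?thesis .
  qed
  have "(NNI x. ?u x)
     = (NNI x. liminf (\<lambda>n. ?b n x))"
  proof (intro nn_integral_cong)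
    fix x
    have "\<forall>\<^sub>F n in sequentially. ?b n x = ?u x"
      using eventually_gt_at_top[of "nat \<lceil>norm x\<rceil>"] by eventually_elim (auto simp: indicator_def, linarith)
    hence "(\<lambda>n. ?b n x) \<longlonglongrightarrow> ?u x"
      by (rule tendsto_eventually)
    from lim_imp_Liminf[OF _ this] show "?u x = liminf (\<lambda>n. ?b n x)"
      by simp
  qed
  also have "\<dots> \<le> liminf (\<lambda>n. NNI x. ?b n x)"
  proof (intro nn_integral_liminf)
    fix n :: nat
    have [measurable]: "ball (0::'a) (real n) \<in> sets borel" by auto
    show "(\<lambda>x. ?b n x) \<in> borel_measurable lborel" by measurable
  qed
  also have "\<dots> \<le> ennreal M"
    by (rule Liminf_le) (use ball_bound in auto)
  also have "\<dots> < \<infinity>" by simp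
  finally show ?thesis by (auto simp: integrable_iff_bounded)
qed

section \<open>Localisation of the kinetic form\<close>

lemma sobolev_modulate:
  assumes u: "u \<in> H_half"
  shows "(\<lambda>x. cis (\<theta> \<bullet> x) * u x) \<in> H_half"
proof (rule sobolev_halfI)
  have u2: "square_integrable u" using u by (rule H_half_L2)
  show "square_integrable (\<lambda>x. cis (\<theta> \<bullet> x) * u x)" by (rule L2_bounded_mult[OF u2]) auto
  show "integrable lborel (\<lambda>k. norm (k - \<theta>) * norm2 (fourier u (k - \<theta>)) + norm \<theta> * norm2 (fourier u (k - \<theta>)))"
    using int_shift[OF int_norm_fourier[OF u], of \<theta>]
      int_shift[OF integrable_fourier_sq[OF u2], of \<theta>] by simp
  show "AE k in lborel. norm k * norm2 (fourier (\<lambda>x. cis (\<theta> \<bullet> x) * u x) k)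
     \<le> norm (k - \<theta>) * norm2 (fourier u (k - \<theta>)) + norm \<theta> * norm2 (fourier u (k - \<theta>))"
    using fourier_modulate[OF u2, of \<theta>]
  proof eventually_elim
    case (elim k)
    have "norm k \<le> norm (k - \<theta>) + norm \<theta>" by (metis diff_add_cancel norm_triangle_ineq)
    from mult_right_mono[OF this, of "norm2 (fourier u (k - \<theta>))"]
    show ?case unfolding elim by (simp add: distrib_right)
  qed
qed

lemma sobolev_add:
  assumes u: "u \<in> H_half" and w: "w \<in> H_half"
  shows "(\<lambda>x. u x + w x) \<in> H_half"
proof (rule sobolev_halfI)
  have u2: "square_integrable u" and w2: "square_integrable w" using u w by (auto intro: H_half_L2)
  show "square_integrable (\<lambda>x. u x + w x)" by (rule L2_add[OF u2 w2])
  show "integrable lborel (\<lambda>k. 2 * (norm k * norm2 (fourier u k)) + 2 * (norm k * norm2 (fourier w k)))"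
    by (intro int_add integrable_mult_right int_norm_fourier u w)
  show "AE k in lborel. norm k * norm2 (fourier (\<lambda>x. u x + w x) k)
     \<le> 2 * (norm k * norm2 (fourier u k)) + 2 * (norm k * norm2 (fourier w k))"
    using fourier_add[OF u2 w2]
  proof eventually_elim
    case (elim k)
    show ?case unfolding elim
      using mult_left_mono[OF norm2_add_le[of "fourier u k" "fourier w k"] norm_ge_zero[of k]]
      by (simp add: distrib_left mult_ac)
  qed
qed

lemma sobolev_cmult:
  assumes u: "u \<in> H_half"
  shows "(\<lambda>x. c * u x) \<in> H_half"
proof (rule sobolev_halfI)
  have u2: "square_integrable u" using u by (auto intro: H_half_L2)
  show "square_integrable (\<lambda>x. c * u x)" by (rule L2_cmult[OF u2])
  show "integrable lborel (\<lambda>k. norm2 c * (norm k * norm2 (fourier u k)))"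
    by (intro integrable_mult_right int_norm_fourier u)
  show "AE k in lborel. norm k * norm2 (fourier (\<lambda>x. c * u x) k) \<le> norm2 c * (norm k * norm2 (fourier u k))"
    using fourier_cmult[OF u2, of c] by eventually_elim (simp add: norm_mult power_mult_distrib)
qed

lemma integrable_symbol_product:
  fixes f g :: "'a::euclidean_space \<Rightarrow> complex"
  assumes [measurable]: "f \<in> Borel" "g \<in> Borel" and v: "norm v < 1"
    and f: "integrable lborel (\<lambda>k. symbol v k * norm2 (f k))" and g: "integrable lborel (\<lambda>k. symbol v k * norm2 (g k))"
  shows "integrable lborel (\<lambda>k. of_real (symbol v k) * f k * cnj (g k))"
proof (rule integrable_dominated[OF int_add[OF f g]])
  fix k
  have "0 \<le> norm (f k) * norm (g k)" by simp
  hence "norm (f k) * norm (g k) \<le> norm2 (f k) + norm2 (g k)"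
    using sum_squares_bound[of "norm (f k)" "norm (g k)"] by linarith
  from mult_left_mono[OF this symbol_nonneg[OF v, of k]]
  show "norm (of_real (symbol v k) * f k * cnj (g k)) \<le> symbol v k * norm2 (f k) + symbol v k * norm2 (g k)"
    using symbol_nonneg[OF v, of k] by (simp add: norm_mult distrib_left)
qed measurable

text \<open>
  Replacing \<open>symbol v (k \<plusminus> h)\<close> by \<open>symbol v k\<close> costs at most \<open>2|h|\<close> in each product, by the
  Lipschitz bound; afterwards the two products add up to \<open>symbol v k |a - b|\<^sup>2\<close>.
\<close>

lemma commutator_pointwise:
  assumes v: "norm v < 1"
  shows "symbol v k * norm2 (a - b) - 4 * norm h * (norm2 a + norm2 b)
    \<le> Re (of_real (symbol v (k + h)) * b * cnj (b - a) + of_real (symbol v (k - h)) * a * cnj (a - b))"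
proof -
  define d1 where "d1 = symbol v (k + h) - symbol v k"
  define d2 where "d2 = symbol v (k - h) - symbol v k"
  have d1: "\<bar>d1\<bar> \<le> 2 * norm h" and d2: "\<bar>d2\<bar> \<le> 2 * norm h"
    using symbol_diff_le[OF v, of "k + h" k] symbol_diff_le[OF v, of k "k + h"]
      symbol_diff_le[OF v, of "k - h" k] symbol_diff_le[OF v, of k "k - h"]
    by (simp_all add: d1_def d2_def abs_le_iff)
  let ?r = "of_real d1 * b * cnj (b - a) + of_real d2 * a * cnj (a - b)"
  have "of_real (symbol v (k + h)) * b * cnj (b - a) + of_real (symbol v (k - h)) * a * cnj (a - b)
     = of_real (symbol v k) * ((a - b) * cnj (a - b)) + (?r)"
    unfolding d1_def d2_def by (simp add: algebra_simps)
  also have "Re \<dots> = symbol v k * norm2 (a - b) + Re (?r)"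
    by (simp only: plus_complex.simps complex_norm_square[symmetric] of_real_mult[symmetric] Re_complex_of_real)
  also have "Re (?r)
     \<ge> - norm (?r)"
    using abs_Re_le_cmod[of "?r"] by linarith
  moreover have "norm (?r)
     \<le> 4 * norm h * (norm2 a + norm2 b)"
  proof -
    have "norm (?r)
      \<le> \<bar>d1\<bar> * norm b * norm (b - a) + \<bar>d2\<bar> * norm a * norm (a - b)"
      by (rule norm_triangle_le) (simp add: norm_mult del: complex_cnj_diff)
    also have "\<dots> \<le> 2 * norm h * norm b * (norm a + norm b) + 2 * norm h * norm a * (norm a + norm b)"
      using norm_triangle_ineq4[of a b] norm_triangle_ineq4[of b a]
      by (intro add_mono mult_mono d1 d2) auto
    also have "\<dots> = 2 * norm h * (norm a + norm b)^2"
      by (simp add: power2_eq_square algebra_simps)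
    also have "\<dots> \<le> 2 * norm h * (2 * (norm2 a + norm2 b))"
      using zero_le_power2[of "norm a - norm b"]
      by (intro mult_left_mono) (auto simp: power2_eq_square algebra_simps)
    finally show ?thesis by (simp only: mult_ac)
  qed
  ultimately show ?thesis by linarith
qed

text \<open>
  On the Fourier side \<open>sin (h\<cdot>x) u\<close> is \<open>(F(k-h) - F(k+h))/(2\<i>)\<close> with \<open>F = fourier u\<close>, and
  \<open>sin\<^sup>2(h\<cdot>x) u\<close> is \<open>((F(k) - F(k-2h)) + (F(k) - F(k+2h)))/4\<close>. Translating the two halves of the
  pairing by \<open>h\<close> and \<open>-h\<close> makes both contain \<open>F(k-h)\<close> and \<open>F(k+h)\<close>, and then only the symbol is
  evaluated at shifted points. The shifts of the symbol play the role of the commutator in the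
  localisation formula for a differential operator.
\<close>

lemma
  fixes u :: "'a::euclidean_space \<Rightarrow> complex" and h :: 'a
  assumes u: "u \<in> H_half" and v: "norm v < 1"
  defines "w \<equiv> \<lambda>x. of_real (sin (h \<bullet> x)) * u x"
    and "\<phi> \<equiv> \<lambda>x. of_real ((sin (h \<bullet> x))^2) * u x"
  shows sobolev_sin: "w \<in> H_half"
    and sobolev_sin_sq: "\<phi> \<in> H_half"
    and T_sin_le: "T v w \<le> Re (LBINT k. of_real (symbol v k) * fourier u k * cnj (fourier \<phi> k)) + 2 * norm h * mass (fourier u)"
proof -
  have u2: "square_integrable u" using u by (rule H_half_L2)
  define F where "F = fourier u"
  let ?D = "\<lambda>k. symbol v k * norm2 (F (k - h) - F (k + h))"
  let ?B = "\<lambda>k. of_real (symbol v k) * fourier u k * cnj (fourier \<phi> k)"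
  have [measurable]: "u \<in> Borel" "F \<in> Borel"
    using u2 fourier_L2[OF u2] by (auto simp: F_def)
  let ?e = "\<lambda>\<theta> x. cis (\<theta> \<bullet> x) * u x"
  have e: "?e \<theta> \<in> H_half" for \<theta> by (rule sobolev_modulate[OF u])
  have e2: "square_integrable (?e \<theta>)" for \<theta> by (rule H_half_L2[OF e])
  \<comment> \<open>Characters become translations under the Fourier transform.\<close>
  have sin_eq: "of_real (sin t) = (1 / (2 * \<i>)) * cis t + (- 1 / (2 * \<i>)) * cis (- t)" for t
    by (simp add: complex_eq_iff Re_divide Im_divide)
  have w_eq: "w = (\<lambda>x. (1 / (2 * \<i>)) * ?e h x + (- 1 / (2 * \<i>)) * ?e (- h) x)"
    unfolding w_def sin_eq by (auto simp: fun_eq_iff algebra_simps)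
  show w: "w \<in> H_half"
    unfolding w_eq by (intro sobolev_add sobolev_cmult e)
  have sin2_eq: "of_real ((sin t)^2) = 1/2 + ((- 1/4) * cis (2 * t) + (- 1/4) * cis (- (2 * t)))" for t
    by (simp add: complex_eq_iff cos_double_sin diff_divide_distrib)
  have phi_eq: "\<phi> = (\<lambda>x. (1/2) * u x + ((- 1/4) * ?e (2 *\<^sub>R h) x + (- 1/4) * ?e (- (2 *\<^sub>R h)) x))"
    unfolding \<phi>_def sin2_eq by (auto simp: fun_eq_iff algebra_simps)
  show "\<phi> \<in> H_half"
    unfolding phi_eq by (intro sobolev_add sobolev_cmult e u)
  have Fw: "AE k in lborel. fourier w k = (1 / (2 * \<i>)) * (F (k - h) - F (k + h))"
    using fourier_add[OF L2_cmult[OF e2] L2_cmult[OF e2], of "1 / (2 * \<i>)" h "- 1 / (2 * \<i>)" "- h"]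
      fourier_cmult[OF e2, of "1 / (2 * \<i>)" h] fourier_cmult[OF e2, of "- 1 / (2 * \<i>)" "- h"]
      fourier_modulate[OF u2, of h] fourier_modulate[OF u2, of "- h"]
    unfolding w_eq[symmetric]
  proof eventually_elim
    case (elim k)
    show ?case unfolding F_def by (simp only: elim) (simp add: right_diff_distrib)
  qed
  have Fphi: "AE k in lborel. fourier \<phi> k = (1/4) * (F k - F (k - 2 *\<^sub>R h)) + (1/4) * (F k - F (k + 2 *\<^sub>R h))"
    using fourier_add[OF L2_cmult[OF u2] L2_add[OF L2_cmult[OF e2] L2_cmult[OF e2]], of "1/2" "-1/4" "2 *\<^sub>R h" "-1/4" "- (2 *\<^sub>R h)"]
      fourier_add[OF L2_cmult[OF e2] L2_cmult[OF e2], of "-1/4" "2 *\<^sub>R h" "-1/4" "- (2 *\<^sub>R h)"]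
      fourier_cmult[OF u2, of "1/2"] fourier_cmult[OF e2, of "-1/4" "2 *\<^sub>R h"] fourier_cmult[OF e2, of "-1/4" "- (2 *\<^sub>R h)"]
      fourier_modulate[OF u2, of "2 *\<^sub>R h"] fourier_modulate[OF u2, of "- (2 *\<^sub>R h)"]
    unfolding phi_eq[symmetric]
  proof eventually_elim
    case (elim k)
    show ?case unfolding F_def by (simp only: elim) (simp add: field_simps)
  qed
  have iF: "integrable lborel (\<lambda>k. symbol v k * norm2 (F k))"
    unfolding F_def by (rule integrable_T[OF u v])
  have iFs: "integrable lborel (\<lambda>k. symbol v k * norm2 (F (k - \<theta>)))" for \<theta>
  proof (rule int_bound[OF integrable_T[OF e v, of \<theta>]])
    show "AE k in lborel. norm (symbol v k * norm2 (F (k - \<theta>))) \<le> norm (symbol v k * norm2 (fourier (?e \<theta>) k))"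
      using fourier_modulate[OF u2, of \<theta>] by eventually_elim (simp add: F_def)
  qed measurable
  have ip: "integrable lborel (\<lambda>k. of_real (symbol v k) * F k * cnj (F k - F (k - \<theta>)))" for \<theta>
    using integrable_symbol_product[of F F v] integrable_symbol_product[of F "\<lambda>k. F (k - \<theta>)" v] v iF iFs[of \<theta>]
    by (simp add: right_diff_distrib)
  define G1 where "G1 k = of_real (symbol v k) * F k * cnj (F k - F (k - 2 *\<^sub>R h))" for k
  define G2 where "G2 k = of_real (symbol v k) * F k * cnj (F k - F (k + 2 *\<^sub>R h))" for k
  have [measurable]: "G1 \<in> Borel" "G2 \<in> Borel"
    unfolding G1_def[abs_def] G2_def[abs_def] by measurable
  have G1: "integrable lborel G1" using ip[of "2 *\<^sub>R h"] unfolding G1_def[abs_def] .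
  have G2: "integrable lborel G2" using ip[of "- (2 *\<^sub>R h)"] unfolding G2_def[abs_def] by simp
  have G1': "integrable lborel (\<lambda>k. G1 (k + h))" "(LBINT k. G1 (k + h)) = (LBINT k. G1 k)"
    using int_shift[OF G1, of "- h"] integral_lborel_shift[of G1 "- h"] by auto
  have G2': "integrable lborel (\<lambda>k. G2 (k - h))" "(LBINT k. G2 (k - h)) = (LBINT k. G2 k)"
    using int_shift[OF G2, of "h"] integral_lborel_shift[of G2 "h"] by auto
  have "(LBINT k. ?B k)
      = (LBINT k. (1/4) * G1 k + (1/4) * G2 k)"
  proof (rule integral_cong_AE)
    have "fourier \<phi> \<in> Borel"
      using fourier_L2[OF H_half_L2[OF \<open>\<phi> \<in> H_half\<close>]] by auto
    thus "(\<lambda>k. ?B k) \<in> borel_measurable lborel"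
      unfolding F_def[symmetric] by measurable
    show "(\<lambda>k. (1/4) * G1 k + (1/4) * G2 k) \<in> borel_measurable lborel" by measurable
    show "AE k in lborel. ?B k = (1/4) * G1 k + (1/4) * G2 k"
      using Fphi
    proof eventually_elim
      case (elim k)
      show ?case unfolding elim G1_def G2_def F_def by (simp add: algebra_simps)
    qed
  qed
  also have "\<dots> = (1/4) * (LBINT k. G1 k) + (1/4) * (LBINT k. G2 k)"
    using G1 G2 by simp
  also have "\<dots> = (1/4) * (LBINT k. G1 (k + h) + G2 (k - h))"
    using G1' G2' by (simp add: distrib_left)
  finally have main0: "(LBINT k. ?B k)
      = of_real (1/4) * (LBINT k. G1 (k + h) + G2 (k - h))" by simp
  have main: "Re (LBINT k. ?B k)
      = (1/4) * (LBINT k. Re (G1 (k + h) + G2 (k - h)))"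
    unfolding main0 using G1'(1) G2'(1) by (subst integral_Re) (simp_all only: Re_complex_of_real int_add times_complex.simps Im_complex_of_real mult_zero_left diff_zero)
  have iD: "integrable lborel (\<lambda>k. ?D k)"
    and TW: "T v w = (1/4) * (LBINT k. ?D k)"
  proof -
    have wk: "AE k in lborel. symbol v k * norm2 (fourier w k) = (1/4) * (?D k)"
      using Fw by eventually_elim (simp add: norm_mult norm_divide power_divide)
    have [measurable]: "fourier w \<in> Borel"
      using fourier_L2[OF H_half_L2[OF w]] by auto
    have "integrable lborel (\<lambda>k. (1/4) * (?D k))"
      by (rule integrable_cong_AE_imp[OF integrable_T[OF w v]]) (use wk in \<open>auto elim: eventually_mono\<close>)
    from integrable_mult_right[OF this, of 4]
    show "integrable lborel (\<lambda>k. ?D k)" by simp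
    have "T v w = (LBINT k. (1/4) * (?D k))"
      unfolding T_eq by (rule integral_cong_AE) (use wk in auto)
    thus "T v w = (1/4) * (LBINT k. ?D k)" by simp
  qed
  have iF2: "integrable lborel (\<lambda>k. norm2 (F k))" unfolding F_def by (rule integrable_fourier_sq[OF u2])
  have s1: "integrable lborel (\<lambda>k. norm2 (F (k - h)))" "(LBINT k. norm2 (F (k - h))) = mass F"
    using int_shift[OF iF2, of h] integral_lborel_shift[of "\<lambda>k. norm2 (F k)" h] by (auto simp: mass_def)
  have s2: "integrable lborel (\<lambda>k. norm2 (F (k + h)))" "(LBINT k. norm2 (F (k + h))) = mass F"
    using int_shift[OF iF2, of "- h"] integral_lborel_shift[of "\<lambda>k. norm2 (F k)" "- h"] by (auto simp: mass_def)
  let ?E = "\<lambda>k. ?D k - 4 * norm h * (norm2 (F (k - h)) + norm2 (F (k + h)))"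
  have "(LBINT k. ?E k)
     \<le> (LBINT k. Re (G1 (k + h) + G2 (k - h)))"
  proof (rule integral_mono)
    show "integrable lborel (\<lambda>k. ?E k)"
      by (intro int_diff int_add integrable_mult_right iD s1 s2)
    show "integrable lborel (\<lambda>k. Re (G1 (k + h) + G2 (k - h)))"
      using G1' G2' by (intro integrable_Re) auto
    fix k
    have "G1 (k + h) = of_real (symbol v (k + h)) * F (k + h) * cnj (F (k + h) - F (k - h))"
      and "G2 (k - h) = of_real (symbol v (k - h)) * F (k - h) * cnj (F (k - h) - F (k + h))"
      by (simp_all add: G1_def G2_def scaleR_2 algebra_simps)
    thus "?E k \<le> Re (G1 (k + h) + G2 (k - h))"
      using commutator_pointwise[OF v, of k "F (k - h)" "F (k + h)" h] by simp
  qed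
  also have "(LBINT k. ?E k)
      = 4 * T v w - 4 * norm h * (2 * mass F)"
    by (subst LB_diff)
       (auto simp: TW s1 s2 iD intro!: int_add integrable_mult_right)
  finally show "T v w \<le> Re (LBINT k. ?B k) + 2 * norm h * mass (fourier u)"
    using main unfolding F_def[symmetric] by simp
qed

section \<open>Decay of the ground state\<close>

lemma is_QD:
  fixes Q :: "'a::euclidean_space \<Rightarrow> complex"
  assumes "is_Q v Q"
  defines "N \<equiv> real DIM('a)"
  defines "C \<equiv> (N + 1) / (N * mass Q powr (1 / N))"
  shows "Q \<in> H_half" "mass Q > 0" "solves_Q_equation v Q" "C > 0"
    "\<And>u. u \<in> H_half \<Longrightarrow> power_integral (2 + 2 / N) u \<le> C * T v u * mass u powr (1 / N)"
    "power_integral (2 + 2 / N) Q = C * T v Q * mass Q powr (1 / N)"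
proof -
  have N: "N > 0" by (simp add: N_def)
  have s: "Lp_norm 2 u powr (2 / N) = mass u powr (1 / N)" for u :: "'a \<Rightarrow> complex"
    using Lp_norm_2_powr[of u "1 / N"] by simp
  have P: "Lp_norm (2 + 2 / N) u powr (2 + 2 / N) = power_integral (2 + 2 / N) u" for u :: "'a \<Rightarrow> complex"
    using N by (intro Lp_norm_powr) (simp add: add_pos_pos)
  note Q = assms(1)[unfolded is_Q_def Let_def N_def[symmetric] s P]
  show "Q \<in> H_half" "solves_Q_equation v Q" using Q by auto
  hence Q2: "square_integrable Q" by (intro H_half_L2)
  show "mass Q > 0"
  proof (rule ccontr)
    assume "\<not> mass Q > 0"
    hence "l2sq Q = 0" using l2sq_eq_mass[OF Q2] mass_nonneg[of Q] by simp
    hence "AE x in lborel. Q x = 0" using Q2 by (intro l2sq_eq_0_AE) auto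
    thus False using Q by auto
  qed
  thus "C > 0" using N by (simp add: C_def)
  show "power_integral (2 + 2 / N) u \<le> C * T v u * mass u powr (1 / N)" if "u \<in> H_half" for u
    using Q that by (auto simp: C_def)
  show "power_integral (2 + 2 / N) Q = C * T v Q * mass Q powr (1 / N)"
    using Q by (auto simp: C_def)
qed

lemma powr_p_split:
  fixes z :: complex
  assumes "p = 2 + q" shows "norm z powr q * norm2 z = norm z powr p"
  by (simp only: assms powr_add norm_powr_2 mult.commute)

lemma norm_sq_powr: "(norm2 (z::complex)) powr a = norm z powr (2 * a)"
  by (simp only: norm_powr_2[symmetric] powr_powr)

text \<open>The weak equation tested against \<open>sin\<^sup>2(h\<cdot>x) Q\<close>.\<close>

lemma localized_energy_le:
  fixes Q :: "'a::euclidean_space \<Rightarrow> complex" and h :: 'a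
  assumes Q: "Q \<in> H_half" and eq: "solves_Q_equation v Q" and v: "norm v < 1"
    and p: "p = 2 + 2 / real DIM('a)"
  defines "w \<equiv> \<lambda>x. of_real (sin (h \<bullet> x)) * Q x"
  shows "T v w + mass w \<le> (LBINT x. (sin (h \<bullet> x))^2 * norm (Q x) powr p) + 8 * norm h * mass Q"
proof -
  let ?q = "\<lambda>x. of_real (norm (Q x) powr (2 / real DIM('a))) * Q x"
  let ?s = "\<lambda>x. (sin (h \<bullet> x))^2 * norm (Q x) powr p"
  define \<phi> where "\<phi> = (\<lambda>x. of_real ((sin (h \<bullet> x))^2) * Q x)"
  let ?I = "LBINT k. of_real (symbol v k) * fourier Q k * cnj (fourier \<phi> k)"
  have \<phi>: "\<phi> \<in> H_half" unfolding \<phi>_def by (rule sobolev_sin_sq[OF Q v])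
  have "(LBINT x. Q x * cnj (\<phi> x)) = (LBINT x. of_real (norm2 (w x)))"
  proof (intro LB_cong refl)
    fix x
    have "of_real (norm2 (w x)) = of_real ((sin (h \<bullet> x))^2) * of_real (norm2 (Q x))"
      by (simp add: w_def norm_mult power_mult_distrib)
    also have "\<dots> = Q x * cnj (\<phi> x)" by (simp only: complex_norm_square \<phi>_def) simp
    finally show "Q x * cnj (\<phi> x) = of_real (norm2 (w x))" by (rule sym)
  qed
  hence B: "(LBINT x. Q x * cnj (\<phi> x)) = of_real (mass w)"
    by (simp only: mass_def integral_complex_of_real)
  have "(LBINT x. ?q x * cnj (\<phi> x))
     = (LBINT x. of_real (?s x))"
  proof (intro LB_cong refl)
    fix x
    have "?q x * cnj (\<phi> x)
      = of_real ((sin (h \<bullet> x))^2 * (norm (Q x) powr (2 / real DIM('a)) * norm2 (Q x)))"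
      by (simp only: of_real_mult complex_norm_square[of "Q x"] \<phi>_def) simp
    thus "?q x * cnj (\<phi> x) = of_real (?s x)"
      by (simp add: powr_p_split[OF p])
  qed
  hence D: "(LBINT x. ?q x * cnj (\<phi> x))
     = of_real (LBINT x. ?s x)"
    by (simp only: integral_complex_of_real)
  have "?I + of_real (mass w)
     = of_real (LBINT x. ?s x)"
    using eq \<phi> unfolding solves_Q_equation_def symbol_def[symmetric] B[symmetric] D[symmetric] by blast
  from arg_cong[OF this, of Re] have "Re ?I + mass w
     = (LBINT x. ?s x)"
    by (simp only: plus_complex.simps Re_complex_of_real)
  moreover have "T v w \<le> Re ?I + 2 * norm h * mass (fourier Q)"
    unfolding w_def \<phi>_def by (rule T_sin_le[OF Q v])
  moreover have "2 * norm h * mass (fourier Q) \<le> 2 * norm h * (4 * mass Q)"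
    by (intro mult_left_mono mass_fourier_le H_half_L2 Q) auto
  ultimately show ?thesis by linarith
qed

lemma integral_tail_small:
  fixes f :: "'a::euclidean_space \<Rightarrow> real"
  assumes f: "integrable lborel f" and "e > 0"
  obtains R where "R \<ge> 0" "(LBINT x. indicator (- cball 0 R) x * f x) \<le> e"
proof -
  have [measurable]: "f \<in> Borel" using f by auto
  let ?t = "\<lambda>R x. indicator (- cball 0 R) x * f x"
  have m: "(\<lambda>x. ?t R x) \<in> borel_measurable lborel" for R
  proof -
    have [measurable]: "- cball (0::'a) R \<in> sets borel" by auto
    show ?thesis by measurable
  qed
  have "((\<lambda>R. LBINT x. ?t R x) \<longlongrightarrow> (LINT x|(lborel::'a measure). 0)) at_top"
  proof (rule integral_dominated_convergence_at_top)
    show "integrable lborel (\<lambda>x. norm (f x))" using f by simp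
    show "\<forall>\<^sub>F R in at_top. AE x in lborel. norm (?t R x) \<le> norm (f x)"
      by (intro always_eventually allI AE_I2) (auto simp: indicator_def)
    show "AE x in lborel. ((\<lambda>R. ?t R x) \<longlongrightarrow> 0) at_top"
    proof (intro AE_I2 tendsto_eventually)
      fix x show "\<forall>\<^sub>F R in at_top. ?t R x = 0"
        using eventually_ge_at_top[of "norm x"] by eventually_elim auto
    qed
  qed (use m in auto)
  hence "\<forall>\<^sub>F R in at_top. (LBINT x. ?t R x) < e"
    using \<open>e > 0\<close> by (intro order_tendstoD(2)[of _ 0]) auto
  hence "\<forall>\<^sub>F R in at_top. (LBINT x. ?t R x) \<le> e \<and> R \<ge> 0"
    using eventually_ge_at_top[of 0] by eventually_elim auto
  thus thesis using that by (auto dest: eventually_happens)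
qed

text \<open>Young's inequality with constant \<open>1\<close>: compare \<open>a\<close> with \<open>b\<^bsup>1/s\<^esup>\<close>.\<close>

lemma young_crude:
  assumes "a \<ge> 0" "b \<ge> 0" "s > 0"
  shows "a * b \<le> a powr (1 + s) + b powr (1 + 1 / s :: real)"
proof (cases "a = 0 \<or> b = 0")
  case False
  hence a: "a > 0" and b: "b > 0" using assms by auto
  show ?thesis
  proof (cases "a \<le> b powr (1 / s)")
    case True
    have "a * b \<le> b powr (1 / s) * b" using True b by (intro mult_right_mono) auto
    also have "\<dots> = b powr (1 + 1 / s)" using b by (simp add: powr_add)
    finally show ?thesis using a by (smt (verit) powr_ge_zero)
  next
    case False
    hence "(b powr (1 / s)) powr s \<le> a powr s" using assms by (intro powr_mono2) auto
    hence "b \<le> a powr s" using b assms by (simp add: powr_powr)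
    hence "a * b \<le> a * a powr s" using a by (intro mult_left_mono) auto
    also have "\<dots> = a powr (1 + s)" using a by (simp add: powr_add)
    finally show ?thesis using b by (smt (verit) powr_ge_zero)
  qed
qed auto

lemma sin_sq_le: "(sin (t::real))^2 \<le> \<bar>t\<bar>"
proof -
  have "(sin t)^2 = \<bar>sin t\<bar> * \<bar>sin t\<bar>"
    unfolding power2_eq_square by (rule abs_mult_self_eq[symmetric])
  also have "\<dots> \<le> 1 * \<bar>t\<bar>" by (intro mult_mono abs_sin_x_le_abs_x) auto
  finally show ?thesis by simp
qed

text \<open>
  Let \<open>X\<close> be the localised energy \<open>T\<^sub>v(w) + \<parallel>w\<parallel>\<^sup>2\<close> with \<open>w = sin(h\<cdot>x) Q\<close>. In the nonlinear term, the
  part over \<open>|x| \<le> R\<close> is \<open>O(|h|)\<close> because \<open>sin\<^sup>2(h\<cdot>x) \<le> |h||x|\<close>. Over \<open>|x| > R\<close> one has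
  \<open>sin\<^sup>2(h\<cdot>x)|Q|\<^sup>p = |w|\<^sup>2|Q|\<^bsup>2/N\<^esup>\<close>, and a Hoelder estimate with the small tail of \<open>\<integral>|Q|\<^sup>p\<close> and with
  \<open>\<integral>|w|\<^sup>p \<le> C X\<^bsup>1+1/N\<^esup>\<close> bounds it by \<open>X/2\<close>, which is absorbed. Hence \<open>X = O(|h|)\<close>; averaged over
  \<open>|h| < 1/R\<close>, this bounds the mass of \<open>Q\<close> outside \<open>B(0,R)\<close> by a multiple of \<open>1/R\<close>.
\<close>

lemma ground_state_decay:
  fixes Q :: "'a::euclidean_space \<Rightarrow> complex"
  assumes Q: "Q \<in> H_half" and eq: "solves_Q_equation v Q" and v: "norm v < 1"
    and p: "p = 2 + 2 / real DIM('a)" and "C \<ge> 0"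
    and GN: "\<And>u :: 'a \<Rightarrow> complex. u \<in> H_half \<Longrightarrow> power_integral p u \<le> C * T v u * mass u powr (1 / real DIM('a))"
    and Qp: "integrable lborel (\<lambda>x. norm (Q x) powr p)"
  obtains K where "K \<ge> 0" "\<And>h. mass (\<lambda>x. of_real (sin (h \<bullet> x)) * Q x) \<le> K * norm h"
proof -
  define s where "s = 1 / real DIM('a)"
  have s: "s > 0" by (simp add: s_def)
  have p': "p = 2 + 2 * s" "p = 2 * (1 + s)" by (simp_all add: p s_def)
  have [measurable]: "Q \<in> Borel" using H_half_L2[OF Q] by auto
  \<comment> \<open>Chosen so that the tail contributes at most half of \<open>X\<close>.\<close>
  define \<beta> where "\<beta> = 1 / (2 * (C + 1))"
  have \<beta>: "\<beta> > 0" "\<beta> * (C + 1) = 1/2" using \<open>C \<ge> 0\<close> by (simp_all add: \<beta>_def field_simps)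
  let ?i = "\<lambda>R x. indicator (- cball 0 R) x * norm (Q x) powr p"
  obtain R where R: "R \<ge> 0" "(LBINT x. ?i R x) \<le> \<beta> powr (1 + 1 / s)"
    using integral_tail_small[OF Qp, of "\<beta> powr (1 + 1 / s)"] \<beta>(1) by auto
  have [measurable]: "- cball (0::'a) R \<in> sets borel" by auto
  have tail_int: "integrable lborel (\<lambda>x. ?i R x)"
    by (rule int_bound[OF Qp]) (auto simp: indicator_def)
  define K where "K = 2 * (R * power_integral p Q + 8 * mass Q)"
  have K: "K \<ge> 0" using R(1) by (simp add: K_def mass_nonneg power_integral_nonneg)
  have "mass w \<le> K * norm h" if w_def: "w = (\<lambda>x. of_real (sin (h \<bullet> x)) * Q x)" for h w
  proof -
    have w: "w \<in> H_half" unfolding w_def by (rule sobolev_sin[OF Q v])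
    define X where "X = T v w + mass w"
    have TX: "T v w \<ge> 0" "mass w \<ge> 0" "T v w \<le> X" "mass w \<le> X"
      using T_nonneg[OF v, of w] mass_nonneg[of w] by (auto simp: X_def)
    let ?s = "\<lambda>x. (sin (h \<bullet> x))^2 * norm (Q x) powr p"
    let ?a = "\<lambda>x. norm h * R * norm (Q x) powr p"
    let ?b = "\<lambda>x. X * \<beta> * (norm (w x) powr p / X powr (1 + s) + ?i R x / \<beta> powr (1 + 1 / s))"
    show "mass w \<le> K * norm h"
    proof (cases "X > 0")
      case False
      moreover have "0 \<le> K * norm h" using K by simp
      ultimately show ?thesis using TX by linarith
    next
      case True
      have wp: "integrable lborel (\<lambda>x. norm (w x) powr p)"
      proof (rule integrable_dominated[OF Qp])
        fix x
        have "norm (w x) \<le> norm (Q x)" unfolding w_def by (simp add: norm_mult mult_left_le_one_le)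
        thus "norm (norm (w x) powr p) \<le> norm (Q x) powr p"
          using s by (simp add: p' powr_mono2)
      next
        show "(\<lambda>x. norm (w x) powr p) \<in> Borel" unfolding w_def by measurable
      qed
      have pw: "power_integral p w \<le> C * X powr (1 + s)"
      proof -
        have "power_integral p w \<le> C * T v w * mass w powr s"
          using GN[OF w] by (simp add: s_def)
        also have "\<dots> \<le> C * X * X powr s"
          using TX s \<open>C \<ge> 0\<close> by (intro mult_mono powr_mono2 mult_nonneg_nonneg) auto
        also have "\<dots> = C * X powr (1 + s)" using True by (simp add: powr_add)
        finally show ?thesis .
      qed
      \<comment> \<open>Young for \<open>(|w|\<^sup>2/X) (|Q|\<^bsup>2/N\<^esup>/\<beta>)\<close>: after integration both powers are bounded, by \<open>C\<close> and \<open>1\<close>.\<close>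
      have pt: "?s x \<le> ?a x + ?b x" for x
      proof (cases "x \<in> cball 0 R")
        case inR: True
        have "(sin (h \<bullet> x))^2 \<le> \<bar>h \<bullet> x\<bar>" by (rule sin_sq_le)
        also have "\<dots> \<le> norm h * norm x" by (rule Cauchy_Schwarz_ineq2)
        also have "\<dots> \<le> norm h * R" using inR by (intro mult_left_mono) auto
        finally have "?s x \<le> ?a x"
          by (intro mult_right_mono) auto
        moreover have "0 \<le> ?b x"
          using True \<beta> by (intro mult_nonneg_nonneg add_nonneg_nonneg divide_nonneg_nonneg) auto
        ultimately show ?thesis by linarith
      next
        case False
        have "?s x = norm2 (w x) * norm (Q x) powr (2 * s)"
          unfolding powr_p_split[OF p'(1), symmetric] by (simp add: w_def norm_mult power_mult_distrib)
        also have "\<dots> = X * \<beta> * ((norm2 (w x) / X) * (norm (Q x) powr (2 * s) / \<beta>))"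
          using True \<beta> by simp
        also have "\<dots> \<le> X * \<beta> * ((norm2 (w x) / X) powr (1 + s) + (norm (Q x) powr (2 * s) / \<beta>) powr (1 + 1 / s))"
          using True \<beta> s by (intro mult_left_mono young_crude) auto
        also have "(norm2 (w x) / X) powr (1 + s) = norm (w x) powr p / X powr (1 + s)"
          using True by (simp add: powr_divide norm_sq_powr p'(2))
        also have "(norm (Q x) powr (2 * s) / \<beta>) powr (1 + 1 / s) = norm (Q x) powr p / \<beta> powr (1 + 1 / s)"
        proof -
          have "2 * s * (1 + 1 / s) = p" using s by (simp add: p'(2) field_simps)
          hence "(norm (Q x) powr (2 * s)) powr (1 + 1 / s) = norm (Q x) powr p" by (simp only: powr_powr)
          thus ?thesis using \<beta> by (simp add: powr_divide)
        qed
        finally have "?s x \<le> X * \<beta> * (norm (w x) powr p / X powr (1 + s) + norm (Q x) powr p / \<beta> powr (1 + 1 / s))" .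
        moreover have "0 \<le> ?a x" using R(1) by simp
        ultimately show ?thesis using False by simp
      qed
      have "(LBINT x. ?s x) \<le>
        (LBINT x. ?a x + ?b x)"
      proof (rule integral_mono)
        have "(sin t)^2 \<le> 1" for t :: real using sin_cos_squared_add[of t] zero_le_power2[of "cos t"] by linarith
        thus "integrable lborel (\<lambda>x. ?s x)"
          by (intro int_bound[OF Qp]) (auto simp: mult_left_le_one_le)
        show "integrable lborel (\<lambda>x. ?a x + ?b x)"
          by (intro int_add integrable_mult_right integrable_divide Qp wp tail_int)
      qed (rule pt)
      also have "\<dots> = norm h * R * power_integral p Q + X * \<beta> * (power_integral p w / X powr (1 + s)
          + (LBINT x. ?i R x) / \<beta> powr (1 + 1 / s))"
        by (simp add: power_integral_def Qp wp tail_int del: indicator_simps)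
      also have "\<dots> \<le> norm h * R * power_integral p Q + X * \<beta> * (C + 1)"
      proof (intro add_left_mono mult_left_mono add_mono)
        show "power_integral p w / X powr (1 + s) \<le> C" using pw True by (simp add: field_simps)
        show "(LBINT x. ?i R x) / \<beta> powr (1 + 1 / s) \<le> 1"
          using R(2) \<beta> by (simp add: field_simps)
        show "0 \<le> X * \<beta>" using True \<beta> by simp
      qed
      also have "X * \<beta> * (C + 1) = X / 2" using \<beta>(2) by (simp add: mult.assoc)
      finally have "(LBINT x. ?s x) \<le> norm h * R * power_integral p Q + X / 2" .
      moreover have "X \<le> (LBINT x. ?s x) + 8 * norm h * mass Q"
        unfolding X_def w_def by (rule localized_energy_le[OF Q eq v p])
      moreover have "X \<le> 2 * (a + b)" if "S \<le> a + X / 2" "X \<le> S + b" for S a b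
        using that by (simp add: field_simps)
      ultimately have "X \<le> 2 * (norm h * R * power_integral p Q + 8 * norm h * mass Q)" by blast
      also have "\<dots> = K * norm h" by (simp add: K_def algebra_simps)
      finally show ?thesis using TX by linarith
    qed
  qed
  thus thesis using that K by blast
qed

section \<open>Finite entropy from a logarithmic moment\<close>

lemma sin_half_pos: "sin (1/2 :: real) > 0"
  using pi_ge_two by (intro sin_gt_zero) auto

lemma ennreal_le_suminf: "f j \<le> (\<Sum>j. f j)" for f :: "nat \<Rightarrow> ennreal"
  using sum_le_suminf[of f "{j}"] by simp

text \<open>
  If \<open>2\<^sup>j \<le> |s| < 2\<^bsup>j+1\<^esup>\<close>, the argument of the sine in the \<open>j\<close>-th term has modulus between \<open>1/2\<close> and \<open>1\<close>,
  so this single term dominates the logarithm, which is at most \<open>3(j+1)\<close>. For \<open>|s| < 1\<close> the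
  summand \<open>1\<close> suffices.
\<close>

lemma ln_le_dyadic_sin_sum:
  "ennreal (ln (1 + s^2)) \<le> 1 + (\<Sum>j. ennreal (3 / (sin (1/2))^2 * (real (Suc j) * (sin ((1/2)^j / 2 * s))^2)))"
proof (cases "\<bar>s\<bar> \<ge> 1")
  case False
  hence "s^2 \<le> 1" by (simp add: abs_square_le_1)
  hence "ln (1 + s^2) \<le> 1" using ln_add_one_self_le_self[of "s^2"] by simp
  hence "ennreal (ln (1 + s^2)) \<le> ennreal 1" by (rule ennreal_leI)
  thus ?thesis by (simp add: add_increasing2)
next
  case True
  let ?t = "\<lambda>j. 3 / (sin (1/2))^2 * (real (Suc j) * (sin ((1/2)^j / 2 * s))^2)"
  obtain j where j: "2 ^ j \<le> \<bar>s\<bar>" "\<bar>s\<bar> < 2 ^ Suc j"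
  proof -
    obtain n where n: "\<bar>s\<bar> < 2 ^ n" using real_arch_pow[of 2 "\<bar>s\<bar>"] by auto
    define n0 where "n0 = (LEAST n. \<bar>s\<bar> < 2 ^ n)"
    have n0: "\<bar>s\<bar> < 2 ^ n0" unfolding n0_def by (rule LeastI[of _ n]) (rule n)
    have "n0 \<noteq> 0" using n0 True by (intro notI) simp
    then obtain j where "n0 = Suc j" by (cases n0) auto
    moreover have "\<not> \<bar>s\<bar> < 2 ^ j" using not_less_Least[of j "\<lambda>n. \<bar>s\<bar> < 2 ^ n"] \<open>n0 = Suc j\<close> by (simp add: n0_def)
    ultimately show thesis using that[of j] n0 by simp
  qed
  have "1 + s^2 \<le> 2 * s^2" using one_le_power[OF True, of 2] by simp
  also have "s^2 \<le> (2 ^ Suc j)^2" using j(2) by (intro abs_le_square_iff[THEN iffD1]) auto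
  also have "(2::real) * (2 ^ Suc j)^2 \<le> exp 1 ^ (3 * Suc j)"
  proof -
    have "(2::real) * (2 ^ Suc j)^2 \<le> 2 ^ Suc j * (2 ^ Suc j)^2"
      by (intro mult_right_mono) auto
    also have "\<dots> = (2 ^ Suc j) ^ 3" by (simp only: power2_eq_square power3_eq_cube mult.assoc)
    also have "\<dots> = 2 ^ (3 * Suc j)" by (simp only: power_mult[symmetric] mult.commute)
    also have "\<dots> \<le> exp 1 ^ (3 * Suc j)"
      using exp_ge_add_one_self[of 1] by (intro power_mono) auto
    finally show ?thesis .
  qed
  also have "\<dots> = exp (real (3 * Suc j))" by (simp only: exp_of_nat_mult[symmetric] mult_1_right)
  finally have "ln (1 + s^2) \<le> ln (exp (real (3 * Suc j)))"
    by (subst ln_le_cancel_iff) (simp_all only: add_pos_nonneg zero_le_power2 zero_less_one exp_gt_zero)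
  hence ln_le: "ln (1 + s^2) \<le> real (3 * Suc j)" by (simp only: ln_exp)
  have sin_le: "(sin (1/2))^2 \<le> (sin ((1/2)^j / 2 * s))^2"
  proof -
    have b: "1/2 \<le> (1/2)^j / 2 * \<bar>s\<bar>" "(1/2)^j / 2 * \<bar>s\<bar> \<le> 1"
      using j by (simp_all add: field_simps)
    have "sin (1/2) \<le> sin ((1/2)^j / 2 * \<bar>s\<bar>)"
      using b pi_ge_two by (intro sin_monotone_2pi_le) auto
    also have "\<dots> \<le> \<bar>sin ((1/2)^j / 2 * s)\<bar>" by (cases "s \<ge> 0") auto
    finally have "(sin (1/2))^2 \<le> \<bar>sin ((1/2)^j / 2 * s)\<bar>^2"
      using sin_half_pos by (intro power_mono) auto
    thus ?thesis by simp
  qed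
  have "real (3 * Suc j) = 3 / (sin (1/2))^2 * (real (Suc j) * (sin (1/2))^2)"
    using sin_half_pos by simp
  also have "\<dots> \<le> ?t j"
    by (intro mult_left_mono sin_le) auto
  finally have "ln (1 + s^2) \<le> ?t j"
    using ln_le by linarith
  hence "ennreal (ln (1 + s^2)) \<le> ennreal (?t j)"
    by (rule ennreal_leI)
  also have "\<dots> \<le> (\<Sum>j. ennreal (?t j))"
    by (rule ennreal_le_suminf)
  also have "\<dots> \<le> 1 + \<dots>" by (intro add_increasing order.refl) auto
  finally show ?thesis .
qed

text \<open>The decay bound at \<open>h = 2\<^bsup>-j-1\<^esup>b\<close>, multiplied by \<open>j+1\<close>, is summable over \<open>j\<close>.\<close>

lemma log_moment_of_decay:
  assumes Q: "square_integrable Q" and "K \<ge> 0"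
    and decay: "\<And>h. mass (\<lambda>x. complex_of_real (sin (h \<bullet> x)) * Q x) \<le> K * norm h"
    and b: "b \<in> Basis"
  shows "integrable lborel (\<lambda>x. ln (1 + (x \<bullet> b)^2) * norm2 (Q x))"
proof -
  have [measurable]: "Q \<in> Borel" using Q by auto
  define c where "c = 3 / (sin (1/2 :: real))^2"
  have c: "c \<ge> 0" by (simp add: c_def)
  let ?t = "\<lambda>j x. c * (real (Suc j) * (sin ((1/2)^j / 2 * (x \<bullet> b)))^2)"
  let ?k = "\<lambda>j. c * K / 2 * (real (Suc j) * (1/2)^j)"
  let ?q = "\<lambda>x. ennreal (norm2 (Q x))"
  let ?l = "\<lambda>x. ln (1 + (x \<bullet> b)^2) * norm2 (Q x)"
  have term_le: "(NNI x. ennreal (?t j x) * ?q x) \<le> ennreal (?k j)" for j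
  proof -
    let ?h = "((1/2)^j / 2) *\<^sub>R b"
    let ?w = "\<lambda>x. complex_of_real (sin (?h \<bullet> x)) * Q x"
    have w: "square_integrable ?w" by (rule L2_bounded_mult[OF Q]) auto
    have "(NNI x. ennreal (?t j x) * ?q x) = (NNI x. ennreal (c * real (Suc j)) * ennreal (norm2 (?w x)))"
    proof (intro nn_integral_cong)
      fix x
      have "?h \<bullet> x = (1/2)^j / 2 * (x \<bullet> b)" by (simp add: inner_commute)
      hence "?t j x * norm2 (Q x) = (c * real (Suc j)) * norm2 (?w x)"
        by (simp only: norm_mult power_mult_distrib norm_of_real power2_abs mult_ac)
      thus "ennreal (?t j x) * ?q x = ennreal (c * real (Suc j)) * ennreal (norm2 (?w x))"
        using c by (simp only: ennreal_mult[symmetric] zero_le_power2 mult_nonneg_nonneg of_nat_0_le_iff)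
    qed
    also have "\<dots> = ennreal (c * real (Suc j)) * l2sq ?w"
      unfolding l2sq_def by (intro nn_integral_cmult) measurable
    also have "\<dots> = ennreal (c * real (Suc j) * mass ?w)"
      using c by (simp only: l2sq_eq_mass[OF w] ennreal_mult mass_nonneg mult_nonneg_nonneg of_nat_0_le_iff)
    also have "\<dots> \<le> ennreal (c * real (Suc j) * (K * norm ?h))"
      using c by (intro ennreal_leI mult_left_mono decay) auto
    also have "c * real (Suc j) * (K * norm ?h) = ?k j"
      using b by simp
    finally show ?thesis .
  qed
  have "(NNI x. ennreal (?l x))
      \<le> (NNI x. (?q x + (\<Sum>j. ennreal (?t j x) * ?q x)))"
  proof (intro nn_integral_mono)
    fix x
    have "ennreal (?l x) = ennreal (ln (1 + (x \<bullet> b)^2)) * ?q x"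
      by (intro ennreal_mult) auto
    also have "\<dots> \<le> (1 + (\<Sum>j. ennreal (?t j x))) * ?q x"
      unfolding c_def by (intro mult_right_mono ln_le_dyadic_sin_sum) auto
    finally show "ennreal (?l x) \<le> ?q x + (\<Sum>j. ennreal (?t j x) * ?q x)"
      by (simp add: distrib_right)
  qed
  also have "\<dots> = l2sq Q + (\<Sum>j. NNI x. ennreal (?t j x) * ?q x)"
    unfolding l2sq_def by (subst nn_integral_add, measurable) (subst nn_integral_suminf, measurable)
  also have "\<dots> \<le> l2sq Q + (\<Sum>j. ennreal (?k j))"
    by (intro add_left_mono suminf_le term_le summableI)
  also have "(\<Sum>j. ennreal (?k j)) = ennreal (\<Sum>j. ?k j)"
  proof (rule suminf_ennreal_eq)
    have "summable (\<lambda>j. real (Suc j) * (1/2)^j)"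
      using geometric_deriv_sums[of "1/2::real"] by (auto simp: sums_iff)
    thus "(\<lambda>j. ?k j) sums (\<Sum>j. ?k j)"
      by (intro summable_sums summable_mult)
    show "0 \<le> ?k j" for j using c \<open>K \<ge> 0\<close> by simp
  qed
  also have "l2sq Q + \<dots> < \<infinity>" using Q by (simp add: L2_iff)
  finally have "(NNI x. ennreal (?l x)) < \<infinity>" .
  thus ?thesis by (auto simp: integrable_iff_bounded abs_mult)
qed

text \<open>Apply \<open>ln z \<le> z - 1\<close> to \<open>z = (\<delta>/N) t\<^bsup>2/N\<^esup>\<close>, since \<open>ln t\<^sup>2 = N ln t\<^bsup>2/N\<^esup>\<close>.\<close>

lemma entropy_density_upper:
  fixes t :: real
  assumes "t \<ge> 0" "N > 0" "\<delta> > 0" "p = 2 + 2 / N"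
  shows "t^2 * ln (t^2) \<le> \<delta> * t powr p + N * (ln (N / \<delta>) - 1) * t^2"
proof (cases "t = 0")
  case False
  hence t: "t > 0" using assms by simp
  define y where "y = t powr (2 / N)"
  have y: "y > 0" using t by (simp add: y_def)
  have "ln (t^2) = N * ln y" using t assms by (simp add: y_def ln_powr ln_realpow)
  also have "ln y = ln (y * \<delta> / N) + ln (N / \<delta>)"
    using y assms by (simp add: ln_mult ln_div)
  also have "ln (y * \<delta> / N) \<le> y * \<delta> / N - 1"
    using y assms by (intro ln_le_minus_one) auto
  also have "N * (y * \<delta> / N - 1 + ln (N / \<delta>)) = \<delta> * y + N * (ln (N / \<delta>) - 1)"
    using assms by (simp add: field_simps)
  finally have "ln (t^2) \<le> \<delta> * y + N * (ln (N / \<delta>) - 1)"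
    using assms by (simp add: mult_left_mono)
  hence "t^2 * ln (t^2) \<le> t^2 * (\<delta> * y + N * (ln (N / \<delta>) - 1))"
    by (intro mult_left_mono) auto
  also have "t^2 * y = t powr p"
    using t assms by (simp add: y_def powr_add powr_numeral)
  hence "t^2 * (\<delta> * y + N * (ln (N / \<delta>) - 1)) = \<delta> * t powr p + N * (ln (N / \<delta>) - 1) * t^2"
    by (simp add: distrib_left mult_ac)
  finally show ?thesis .
qed simp

text \<open>Where \<open>t\<^sup>2 \<ge> e\<^bsup>-w\<^esup>\<close> the logarithm is at least \<open>-w\<close>; elsewhere \<open>t\<^sup>2 ln (1/t\<^sup>2) \<le> 2t < 2e\<^bsup>-w/2\<^esup>\<close>.\<close>

lemma entropy_density_lower:
  fixes t w :: real
  assumes "t \<ge> 0" "w \<ge> 0"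
  shows "- (t^2 * ln (t^2)) \<le> w * t^2 + 2 * exp (- (w / 2))"
proof (cases "t = 0")
  case False
  hence t: "t > 0" using assms by simp
  have ln2: "ln (t^2) = 2 * ln t" using t by (simp add: ln_realpow)
  show ?thesis
  proof (cases "ln t \<ge> - (w / 2)")
    case True
    hence "- ln (t^2) \<le> w" using ln2 by simp
    hence "t^2 * (- ln (t^2)) \<le> t^2 * w" by (intro mult_left_mono) auto
    moreover have "0 \<le> 2 * exp (- (w / 2))" by simp
    moreover have "t^2 * (- ln (t^2)) = - (t^2 * ln (t^2))" "t^2 * w = w * t^2" by simp_all
    ultimately show ?thesis by linarith
  next
    case False
    have "ln (inverse t) \<le> inverse t - 1" using t by (intro ln_le_minus_one) auto
    hence "- ln t \<le> inverse t" using t by (simp add: ln_inverse)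
    hence "t^2 * (- ln t) \<le> t^2 * inverse t" by (intro mult_left_mono) auto
    also have "\<dots> = t" using t by (simp add: power2_eq_square)
    also have "t \<le> exp (- (w / 2))"
      using False t by (metis exp_ln exp_le_cancel_iff le_cases)
    finally have "t^2 * (- ln t) \<le> exp (- (w / 2))" .
    moreover have "- (t^2 * ln (t^2)) = 2 * (t^2 * (- ln t))" unfolding ln2 by simp
    moreover have "0 \<le> w * t^2" using assms by simp
    ultimately show ?thesis by linarith
  qed
qed simp

lemma integrable_prod_inverse_square:
  "integrable lborel (\<lambda>x::'a::euclidean_space. \<Prod>b\<in>Basis. inverse (1 + (x \<bullet> b)^2))"
proof -
  have "integrable lborel (\<lambda>x::real. inverse (1 + x^2))"
    using integrable_inverse_1_plus_square by (simp add: set_integrable_def einterval_def)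
  hence fin: "(\<integral>\<^sup>+x. ennreal (inverse (1 + x^2)) \<partial>(lborel :: real measure)) < \<infinity>"
    by (simp add: integrable_iff_bounded)
  have "(NNI x. ennreal (\<Prod>b\<in>Basis. inverse (1 + ((x::'a) \<bullet> b)^2)))
    = (NNI x. (\<Prod>b\<in>Basis. ennreal (inverse (1 + ((x::'a) \<bullet> b)^2))))"
    by (subst prod_ennreal) auto
  also have "\<dots> = (\<Prod>b\<in>(Basis :: 'a set). NNI x. ennreal (inverse (1 + x^2)))"
    by (intro nn_integral_lborel_prod) auto
  also have "\<dots> < \<infinity>"
    using fin by (cases "\<integral>\<^sup>+x. ennreal (inverse (1 + x^2)) \<partial>(lborel :: real measure)") (auto simp: ennreal_power)
  finally show ?thesis by (auto simp: integrable_iff_bounded abs_of_nonneg prod_nonneg)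
qed

text \<open>
  The upper bound for the entropy density is paid for by \<open>|u|\<^sup>p\<close>, the lower one by the weight
  \<open>W = 2 \<Sum>\<^sub>b ln (1 + x\<^sub>b\<^sup>2)\<close>, chosen so that \<open>e\<^bsup>-W/2\<^esup> = \<Prod>\<^sub>b 1/(1 + x\<^sub>b\<^sup>2)\<close> is integrable.
\<close>

lemma integrable_entropy_of_log_moment:
  fixes u :: "'a::euclidean_space \<Rightarrow> complex"
  assumes u: "square_integrable u" and p: "p = 2 + 2 / real DIM('a)"
    and up: "integrable lborel (\<lambda>x. norm (u x) powr p)"
    and lm: "\<And>b. b \<in> Basis \<Longrightarrow> integrable lborel (\<lambda>x. ln (1 + (x \<bullet> b)^2) * norm2 (u x))"
  shows "integrable lborel (\<lambda>x. norm2 (u x) * ln (norm2 (u x)))"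
proof -
  have [measurable]: "u \<in> Borel" using u by auto
  define N where "N = real DIM('a)"
  have N: "N > 0" by (simp add: N_def)
  define W where "W x = 2 * (\<Sum>b\<in>Basis. ln (1 + (x \<bullet> b)^2))" for x :: 'a
  have W: "W x \<ge> 0" for x unfolding W_def by (intro mult_nonneg_nonneg sum_nonneg) auto
  have expW: "exp (- (W x / 2)) = (\<Prod>b\<in>Basis. inverse (1 + (x \<bullet> b)^2))" for x
  proof -
    have "exp (- (W x / 2)) = exp (\<Sum>b\<in>Basis. - ln (1 + (x \<bullet> b)^2))" by (simp add: W_def sum_negf)
    also have "\<dots> = (\<Prod>b\<in>Basis. inverse (1 + (x \<bullet> b)^2))"
      by (subst exp_sum) (auto intro!: prod.cong simp: exp_minus add_pos_nonneg)
    finally show ?thesis .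
  qed
  have Wu: "integrable lborel (\<lambda>x. W x * norm2 (u x))"
    unfolding W_def mult.assoc sum_distrib_right
    by (intro integrable_mult_right int_sum lm)
  show ?thesis
  proof (rule integrable_dominated)
    show "integrable lborel (\<lambda>x. N * norm (u x) powr p + (W x * norm2 (u x) + 2 * exp (- (W x / 2))))"
      unfolding expW by (intro int_add integrable_mult_right up Wu integrable_prod_inverse_square)
    fix x
    have "norm2 (u x) * ln (norm2 (u x)) \<le> N * norm (u x) powr p + N * (ln (N / N) - 1) * norm2 (u x)"
      using N by (intro entropy_density_upper) (auto simp: p N_def)
    also have "\<dots> \<le> N * norm (u x) powr p" using N by simp
    finally have 1: "norm2 (u x) * ln (norm2 (u x)) \<le> N * norm (u x) powr p" .
    have 2: "- (norm2 (u x) * ln (norm2 (u x))) \<le> W x * norm2 (u x) + 2 * exp (- (W x / 2))"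
      using W by (intro entropy_density_lower) auto
    have 3: "0 \<le> N * norm (u x) powr p" "0 \<le> W x * norm2 (u x) + 2 * exp (- (W x / 2))"
      using N W by (auto intro!: add_nonneg_nonneg mult_nonneg_nonneg)
    show "norm (norm2 (u x) * ln (norm2 (u x))) \<le> N * norm (u x) powr p + (W x * norm2 (u x) + 2 * exp (- (W x / 2)))"
      using 1 2 3 unfolding real_norm_def by linarith
  qed measurable
qed

section \<open>Energy bounds\<close>

definition entropy :: "('a::euclidean_space \<Rightarrow> complex) \<Rightarrow> real" where
  "entropy u = (LBINT x. norm2 (u x) * ln (norm2 (u x)))"

lemma is_Q_integrable_power:
  fixes Q u :: "'a::euclidean_space \<Rightarrow> complex"
  assumes Q: "is_Q v Q" and v: "norm v < 1" and u: "u \<in> H_half"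
  shows "integrable lborel (\<lambda>x. norm (u x) powr (2 + 2 / real DIM('a)))"
  by (rule sobolev_integrable_power[OF is_QD(5)[OF Q] less_imp_le[OF is_QD(4)[OF Q]] _ _ v u]) auto

lemma ground_state_in_W_half:
  assumes Q: "is_Q v Q" and v: "norm v < 1"
  shows "Q \<in> W_half"
proof -
  note Qp = is_Q_integrable_power[OF Q v is_QD(1)[OF Q]]
  have Q2: "square_integrable Q" by (rule H_half_L2[OF is_QD(1)[OF Q]])
  obtain K where K: "K \<ge> 0" "\<And>h. mass (\<lambda>x. of_real (sin (h \<bullet> x)) * Q x) \<le> K * norm h"
    using ground_state_decay[OF is_QD(1)[OF Q] is_QD(3)[OF Q] v refl less_imp_le[OF is_QD(4)[OF Q]] is_QD(5)[OF Q] Qp] by blast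
  have "integrable lborel (\<lambda>x. norm2 (Q x) * ln (norm2 (Q x)))"
    by (rule integrable_entropy_of_log_moment[OF Q2 refl Qp log_moment_of_decay[OF Q2 K]])
  thus ?thesis using is_QD(1)[OF Q] by (simp add: W_half_def)
qed

lemma symbol_scale: "\<tau> > 0 \<Longrightarrow> symbol v (\<tau> *\<^sub>R k) = \<tau> * symbol v k"
  by (simp add: symbol_def algebra_simps)

lemma integral_lborel_scale:
  fixes f :: "'a::euclidean_space \<Rightarrow> real"
  assumes "f \<in> Borel" "\<tau> > 0"
  shows "(LBINT x. f (\<tau> *\<^sub>R x)) = (LBINT x. f x) / \<tau> ^ DIM('a)"
  using integral_lborel_affine[of f \<tau> 0] assms by simp

text \<open>
  How the terms of the energy change under amplitude and dilation: the entropy acquires the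
  logarithm of the amplitude, which drives the minimal energy to \<open>-\<infinity>\<close>.
\<close>

lemma
  fixes Q :: "'a::euclidean_space \<Rightarrow> complex"
  assumes Q: "Q \<in> W_half" and v: "norm v < 1" and c: "c > 0" and \<tau>: "\<tau> > 0"
  defines "w \<equiv> \<lambda>x. of_real c * Q (\<tau> *\<^sub>R x)"
  shows W_half_scale: "w \<in> W_half"
    and T_scale: "T v w = c^2 / \<tau> ^ DIM('a) * \<tau> * T v Q"
    and mass_scale: "mass w = c^2 / \<tau> ^ DIM('a) * mass Q"
    and power_integral_scale: "power_integral p w = c powr p / \<tau> ^ DIM('a) * power_integral p Q"
    and entropy_scale: "entropy w = c^2 / \<tau> ^ DIM('a) * (ln (c^2) * mass Q + entropy Q)"
proof -
  let ?k = "\<lambda>k. (1/\<tau>) *\<^sub>R k" and ?Q = "\<lambda>x. Q (\<tau> *\<^sub>R x)"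
  have QH: "Q \<in> H_half" and Qe: "integrable lborel (\<lambda>x. norm2 (Q x) * ln (norm2 (Q x)))"
    using Q by (auto simp: W_half_def)
  have Q2: "square_integrable Q" by (rule H_half_L2[OF QH])
  have Qm: "integrable lborel (\<lambda>x. norm2 (Q x))" using Q2 by (simp add: square_integrable_def)
  have [measurable]: "Q \<in> Borel" "fourier Q \<in> Borel"
    using Q2 fourier_L2[OF Q2] by auto
  have w2: "square_integrable w" unfolding w_def by (rule L2_scale[OF Q2 \<tau>])
  have [measurable]: "fourier w \<in> Borel" using fourier_L2[OF w2] by auto
  define C where "C = (c / \<tau> ^ DIM('a))^2"
  have Fw: "AE k in lborel. norm2 (fourier w k) = C * norm2 (fourier Q (?k k))"
    using fourier_scale[OF Q2 \<tau>, of "of_real c"] unfolding w_def[symmetric]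
  proof eventually_elim
    case (elim k)
    show ?case unfolding elim C_def using c \<tau> by (simp add: norm_mult norm_divide power_mult_distrib norm_power power_divide)
  qed
  have wH: "w \<in> H_half"
  proof (rule sobolev_halfI[OF w2])
    show "integrable lborel (\<lambda>k. C * \<tau> * (norm (?k k) * norm2 (fourier Q (?k k))))"
      using int_affine[OF int_norm_fourier[OF QH], of "1/\<tau>" 0] \<tau> by (intro integrable_mult_right) simp
    show "AE k in lborel. norm k * norm2 (fourier w k) \<le> C * \<tau> * (norm (?k k) * norm2 (fourier Q (?k k)))"
      using Fw by eventually_elim (use \<tau> in simp)
  qed
  have we: "norm2 (w x) * ln (norm2 (w x)) = c^2 * (ln (c^2) * norm2 (?Q x) + norm2 (?Q x) * ln (norm2 (?Q x)))" for x
  proof (cases "Q (\<tau> *\<^sub>R x) = 0")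
    case False
    hence "ln (norm2 (w x)) = ln (c^2) + ln (norm2 (?Q x))"
      using c by (simp add: w_def norm_mult power_mult_distrib ln_mult)
    moreover have "norm2 (w x) = c^2 * norm2 (?Q x)"
      using c by (simp add: w_def norm_mult power_mult_distrib)
    ultimately show ?thesis by (simp add: algebra_simps)
  qed (simp add: w_def)
  have e1: "integrable lborel (\<lambda>x. c^2 * (ln (c^2) * norm2 (Q x) + norm2 (Q x) * ln (norm2 (Q x))))"
    by (intro integrable_mult_right int_add Qm Qe)
  have "integrable lborel (\<lambda>x. norm2 (w x) * ln (norm2 (w x)))"
    unfolding we using int_affine[OF e1, of \<tau> 0] \<tau> by simp
  thus "w \<in> W_half" using wH by (simp add: W_half_def)
  have "entropy w = (LBINT x. c^2 * (ln (c^2) * norm2 (Q x) + norm2 (Q x) * ln (norm2 (Q x)))) / \<tau> ^ DIM('a)"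
    unfolding entropy_def we by (subst integral_lborel_scale[OF _ \<tau>, symmetric]) auto
  also have "\<dots> = c^2 * (ln (c^2) * mass Q + entropy Q) / \<tau> ^ DIM('a)"
    using Qm Qe by (simp add: mass_def entropy_def)
  finally show "entropy w = c^2 / \<tau> ^ DIM('a) * (ln (c^2) * mass Q + entropy Q)" by simp
  have "mass w = (LBINT x. c^2 * norm2 (?Q x))"
    unfolding mass_def w_def using c by (simp add: norm_mult power_mult_distrib)
  also have "\<dots> = c^2 * (mass Q / \<tau> ^ DIM('a))"
    unfolding mass_def using integral_lborel_scale[OF _ \<tau>, of "\<lambda>x. norm2 (Q x)"] by simp
  finally show "mass w = c^2 / \<tau> ^ DIM('a) * mass Q" by simp
  have "power_integral p w = (LBINT x. c powr p * norm (?Q x) powr p)"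
    unfolding power_integral_def w_def using c by (simp add: norm_mult powr_mult)
  also have "\<dots> = c powr p * (power_integral p Q / \<tau> ^ DIM('a))"
    unfolding power_integral_def using integral_lborel_scale[OF _ \<tau>, of "\<lambda>x. norm (Q x) powr p"] by simp
  finally show "power_integral p w = c powr p / \<tau> ^ DIM('a) * power_integral p Q" by simp
  have "T v w = (LBINT k. C * \<tau> * (symbol v (?k k) * norm2 (fourier Q (?k k))))"
    unfolding T_eq
  proof (rule integral_cong_AE)
    show "AE k in lborel. symbol v k * norm2 (fourier w k) = C * \<tau> * (symbol v (?k k) * norm2 (fourier Q (?k k)))"
      using Fw
    proof eventually_elim
      case (elim k)
      show ?case unfolding elim using \<tau> by (subst symbol_scale) auto
    qed
  qed measurable
  also have "\<dots> = C * \<tau> * ((LBINT k. symbol v k * norm2 (fourier Q k)) / (1/\<tau>) ^ DIM('a))"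
    using integral_lborel_scale[of "\<lambda>k. symbol v k * norm2 (fourier Q k)" "1/\<tau>"] \<tau> by (subst integral_mult_right_zero) simp
  also have "\<dots> = c^2 / \<tau> ^ DIM('a) * \<tau> * T v Q"
    unfolding T_eq C_def using \<tau> by (simp add: power_divide field_simps power2_eq_square)
  finally show "T v w = c^2 / \<tau> ^ DIM('a) * \<tau> * T v Q" .
qed

text \<open>From \<open>|k| \<le> \<surd>(|k|\<^sup>2 + m\<^sup>2) \<le> |k| + m\<close>.\<close>

lemma kinetic_bounds:
  assumes u: "u \<in> H_half" and v: "norm v < 1" and m: "m > 0"
  shows "kinetic m v u \<le> T v u" "T v u - 4 * m * mass u \<le> kinetic m v u"
proof -
  have u2: "square_integrable u" by (rule H_half_L2[OF u])
  have [measurable]: "fourier u \<in> Borel" using fourier_L2[OF u2] by auto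
  have s1: "norm k \<le> sqrt (norm2 k + m^2)" for k :: 'a by (rule real_le_rsqrt) simp
  have s2: "sqrt (norm2 k + m^2) \<le> norm k + m" for k :: 'a
    using m by (intro real_le_lsqrt) (auto simp: power2_eq_square algebra_simps)
  let ?s = "\<lambda>k. sqrt (norm2 k + m^2) - m - v \<bullet> k"
  let ?f = "\<lambda>k. norm2 (fourier u k)"
  have iT: "integrable lborel (\<lambda>k. symbol v k * ?f k)" by (rule integrable_T[OF u v])
  have iF: "integrable lborel (\<lambda>k. ?f k)" by (rule integrable_fourier_sq[OF u2])
  have up: "?s k * ?f k \<le> symbol v k * ?f k" for k
    using s2[of k] by (intro mult_right_mono) (auto simp: symbol_def)
  have lo: "symbol v k * ?f k - m * ?f k \<le> ?s k * ?f k" for k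
    unfolding left_diff_distrib[symmetric] using s1[of k] by (intro mult_right_mono) (auto simp: symbol_def)
  have iK: "integrable lborel (\<lambda>k. ?s k * ?f k)"
  proof (rule integrable_dominated)
    show "integrable lborel (\<lambda>k. symbol v k * ?f k + m * ?f k)"
      using iT iF by (intro int_add integrable_mult_right)
    fix k
    have "0 \<le> symbol v k * ?f k" "0 \<le> m * ?f k"
      using symbol_nonneg[OF v, of k] m by auto
    thus "norm (?s k * ?f k) \<le> symbol v k * ?f k + m * ?f k"
      using up[of k] lo[of k] unfolding real_norm_def by linarith
  qed measurable
  show "kinetic m v u \<le> T v u"
    unfolding kinetic_def T_eq by (intro integral_mono iK iT up)
  have "T v u - m * mass (fourier u) = (LBINT k. symbol v k * ?f k - m * ?f k)"
    using iT iF by (simp add: T_eq mass_def)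
  also have "\<dots> \<le> kinetic m v u"
    unfolding kinetic_def using iT iF by (intro integral_mono iK lo) auto
  finally have "T v u - m * mass (fourier u) \<le> kinetic m v u" .
  moreover have "m * mass (fourier u) \<le> m * (4 * mass u)"
    using m by (intro mult_left_mono mass_fourier_le u2) auto
  ultimately show "T v u - 4 * m * mass u \<le> kinetic m v u" by linarith
qed

lemma energy_eq:
  assumes u: "u \<in> W_half" and "p > 0"
  shows "energy m v p u = 1/2 * kinetic m v u - 1/p * power_integral p u - 1/2 * entropy u + 1/2 * mass u"
proof -
  have "integrable lborel (\<lambda>x. norm2 (u x) * ln (norm2 (u x)))" "integrable lborel (\<lambda>x. norm2 (u x))"
    using u H_half_L2[of u] by (auto simp: W_half_def square_integrable_def)
  hence "(LBINT x. norm2 (u x) * (ln (norm2 (u x)) - 1)) = entropy u - mass u"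
    by (simp add: right_diff_distrib entropy_def mass_def)
  thus ?thesis by (simp add: energy_def Lp_norm_powr[OF \<open>p > 0\<close>] diff_divide_distrib)
qed

lemma mass_sphere_iff: "u \<in> mass_sphere a \<longleftrightarrow> u \<in> W_half \<and> mass u = a"
  by (auto simp: mass_sphere_def Lp_norm_2_sq)

lemma entropy_le:
  fixes u :: "'a::euclidean_space \<Rightarrow> complex"
  assumes u: "u \<in> W_half" and p: "p = 2 + 2 / real DIM('a)" and up: "integrable lborel (\<lambda>x. norm (u x) powr p)" and "\<delta> > 0"
  shows "entropy u \<le> \<delta> * power_integral p u + real DIM('a) * (ln (real DIM('a) / \<delta>) - 1) * mass u"
proof -
  have i: "integrable lborel (\<lambda>x. norm2 (u x) * ln (norm2 (u x)))" "integrable lborel (\<lambda>x. norm2 (u x))"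
    using u H_half_L2[of u] by (auto simp: W_half_def square_integrable_def)
  have "entropy u \<le> (LBINT x. \<delta> * norm (u x) powr p + real DIM('a) * (ln (real DIM('a) / \<delta>) - 1) * norm2 (u x))"
    unfolding entropy_def
    by (intro integral_mono i int_add integrable_mult_right up entropy_density_upper p \<open>\<delta> > 0\<close>) auto
  also have "\<dots> = \<delta> * power_integral p u + real DIM('a) * (ln (real DIM('a) / \<delta>) - 1) * mass u"
    using up i by (simp add: power_integral_def mass_def)
  finally show ?thesis .
qed

text \<open>
  The amplitude \<open>c\<close> gives the trial function mass \<open>a\<close>. Equality in the sharp inequality for \<open>Q\<close>
  makes its quadratic and power terms \<open>\<sigma>\<tau>T\<^sub>v(Q)/2\<close> and \<open>\<sigma>\<^bsup>1+1/N\<^esup>\<tau>T\<^sub>v(Q)/2\<close>, whose difference is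
  \<open>\<sigma>T\<^sub>v(Q)/2\<close> for the chosen \<open>\<tau>\<close>; the term \<open>ln (1 - \<sigma>\<^bsup>1/N\<^esup>) = -ln \<tau>\<close> is the contribution of the
  entropy.
\<close>

lemma min_energy_le_trial:
  fixes Q :: "'a::euclidean_space \<Rightarrow> complex"
  assumes Q: "is_Q v Q" and v: "norm v < 1" and m: "m > 0" and p: "p = 2 + 2 / real DIM('a)"
    and a: "0 < a" "a < mass Q"
  defines "N \<equiv> real DIM('a)" and "\<sigma> \<equiv> a / mass Q"
  shows "min_energy m v p a \<le> ereal (T v Q / 2 + a * N / 2 * ln (1 - \<sigma> powr (1 / N)) - a / 2 * ln \<sigma> + \<bar>entropy Q\<bar> / 2 + a / 2)"
proof -
  have N: "N > 0" by (simp add: N_def)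
  have \<sigma>: "0 < \<sigma>" "\<sigma> < 1" using a by (simp_all add: \<sigma>_def)
  have aeq: "a = \<sigma> * mass Q" using a by (simp add: \<sigma>_def)
  define \<rho> where "\<rho> = \<sigma> powr (1 / N)"
  have \<rho>: "0 < \<rho>" "\<rho> < 1" using \<sigma> N powr_less_mono2[of "1 / N" \<sigma> 1] by (auto simp: \<rho>_def)
  define \<tau> where "\<tau> = 1 / (1 - \<rho>)"
  have \<tau>: "\<tau> > 0" using \<rho> by (simp add: \<tau>_def)
  define c where "c = sqrt (\<sigma> * \<tau> ^ DIM('a))"
  have c: "c > 0" "c^2 = \<sigma> * \<tau> ^ DIM('a)" using \<sigma> \<tau> by (auto simp: c_def)
  have c': "c^2 / \<tau> ^ DIM('a) = \<sigma>" using \<tau> c by simp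
  define w where "w = (\<lambda>x. of_real c * Q (\<tau> *\<^sub>R x))"
  note QW = ground_state_in_W_half[OF Q v]
  note sc = T_scale[OF QW v c(1) \<tau>, folded w_def, unfolded c'] mass_scale[OF QW v c(1) \<tau>, folded w_def, unfolded c']
    power_integral_scale[OF QW v c(1) \<tau>, of p, folded w_def] entropy_scale[OF QW v c(1) \<tau>, folded w_def, unfolded c']
  have wW: "w \<in> W_half" unfolding w_def by (rule W_half_scale[OF QW v c(1) \<tau>])
  have "w \<in> mass_sphere a" using wW sc(2) aeq by (simp add: mass_sphere_iff)
  hence "min_energy m v p a \<le> ereal (energy m v p w)"
    unfolding min_energy_def by (rule INF_lower)
  also have "energy m v p w \<le> T v Q / 2 + a * N / 2 * ln (1 - \<rho>) - a / 2 * ln \<sigma> + \<bar>entropy Q\<bar> / 2 + a / 2"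
  proof -
    have p0: "p > 0" using N by (simp add: p N_def add_pos_pos)
    have pN: "p = 2 * (N + 1) / N" using N by (simp add: p N_def field_simps)
    have cp: "c powr p / \<tau> ^ DIM('a) = \<sigma> * \<rho> * \<tau>"
    proof -
      have "c powr p = (c^2) powr (p / 2)" using norm_sq_powr[of "complex_of_real c" "p / 2"] c(1) by simp
      also have "p / 2 = 1 + 1 / N" using N by (simp add: p N_def)
      also have "(c^2) powr (1 + 1 / N) = c^2 * (c^2) powr (1 / N)"
        using c(1) by (simp add: powr_add)
      also have "(c^2) powr (1 / N) = \<rho> * (\<tau> powr N) powr (1 / N)"
        unfolding c(2) using \<sigma> \<tau> by (simp add: powr_mult \<rho>_def N_def powr_realpow)
      also have "(\<tau> powr N) powr (1 / N) = \<tau>" using N \<tau> by (simp add: powr_powr)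
      finally show ?thesis using c' by (metis (no_types, lifting) mult.assoc times_divide_eq_left)
    qed
    have PQ: "1 / p * power_integral p Q = T v Q / 2"
    proof -
      have "mass Q powr (1 / N) > 0" using a by simp
      moreover have "power_integral p Q = (N + 1) / (N * mass Q powr (1 / N)) * T v Q * mass Q powr (1 / N)"
        using is_QD(6)[OF Q, folded N_def] by (simp only: p N_def[symmetric])
      ultimately have "power_integral p Q = (N + 1) / N * T v Q" by simp
      also have "(N + 1) / N = p / 2" unfolding pN using N by (simp add: field_simps)
      finally show ?thesis using p0 by simp
    qed
    have lnc: "ln (c^2) = ln \<sigma> - N * ln (1 - \<rho>)"
      unfolding c(2) using \<sigma> \<tau> \<rho> by (simp add: ln_mult ln_realpow N_def \<tau>_def ln_div)
    have "energy m v p w = 1/2 * kinetic m v w - 1/p * power_integral p w - 1/2 * entropy w + 1/2 * mass w"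
      by (rule energy_eq[OF wW p0])
    also have "\<dots> \<le> 1/2 * T v w - 1/p * power_integral p w - 1/2 * entropy w + 1/2 * mass w"
      using kinetic_bounds(1)[OF _ v m, of w] wW by (simp add: W_half_def)
    also have "\<dots> = 1/2 * (\<sigma> * \<tau> * T v Q) - \<sigma> * \<rho> * \<tau> * (1 / p * power_integral p Q) - 1/2 * (\<sigma> * (ln (c^2) * mass Q + entropy Q)) + 1/2 * a"
      unfolding sc cp aeq by simp
    also have "\<dots> = 1/2 * \<sigma> * T v Q * (\<tau> * (1 - \<rho>)) - 1/2 * (a * ln (c^2) + \<sigma> * entropy Q) + 1/2 * a"
      unfolding PQ aeq by (simp add: field_simps)
    also have "\<tau> * (1 - \<rho>) = 1" using \<rho> by (simp add: \<tau>_def)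
    also have "1/2 * \<sigma> * T v Q * 1 - 1/2 * (a * ln (c^2) + \<sigma> * entropy Q) + 1/2 * a
       \<le> T v Q / 2 - 1/2 * (a * ln (c^2)) + \<bar>entropy Q\<bar> / 2 + a / 2"
    proof -
      have "\<sigma> * T v Q \<le> 1 * T v Q" using \<sigma> T_nonneg[OF v, of Q] by (intro mult_right_mono) auto
      moreover have "- (\<sigma> * entropy Q) \<le> 1 * \<bar>entropy Q\<bar>"
      proof -
        have "- (\<sigma> * entropy Q) \<le> \<sigma> * \<bar>entropy Q\<bar>" using mult_left_mono[of "- entropy Q" "\<bar>entropy Q\<bar>" \<sigma>] \<sigma> by simp
        also have "\<dots> \<le> 1 * \<bar>entropy Q\<bar>" using \<sigma> by (intro mult_right_mono) auto
        finally show ?thesis .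
      qed
      ultimately show ?thesis by (simp add: field_simps)
    qed
    also have "\<dots> = T v Q / 2 + a * N / 2 * ln (1 - \<rho>) - a / 2 * ln \<sigma> + \<bar>entropy Q\<bar> / 2 + a / 2"
      unfolding lnc by (simp add: algebra_simps)
    finally show ?thesis .
  qed
  finally show ?thesis by (simp add: \<rho>_def)
qed

theorem lemma4p1:
  fixes v :: "real ^ 'n" and m p astar :: real and Q :: "real ^ 'n \<Rightarrow> complex"
    and A :: "real set" and u :: "real \<Rightarrow> real ^ 'n \<Rightarrow> complex" and eps :: "real \<Rightarrow> real"
  assumes "CARD('n) \<ge> 2" and "norm v < 1" and "p = 2 + 2 / real CARD('n)" and "m > 0"
    and "is_Q v Q" and "astar = (Lp_norm 2 Q)\<^sup>2"
    and "A \<subseteq> {0<..<astar}" and "astar islimpt A"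
    and "\<And>a. a \<in> A \<Longrightarrow> is_minimizer m v p a (u a)"
    and "\<And>a. eps a = inverse (T v (u a))"
  shows "(min_energy m v p \<longlongrightarrow> -\<infinity>) (at astar within A) \<and>
    ((\<lambda>a. ereal (eps a) * min_energy m v p a) \<longlongrightarrow> 0) (at astar within A) \<and>
    ((\<lambda>a. eps a * (LINT x|lborel. (norm (u a x))\<^sup>2 * ln ((norm (u a x))\<^sup>2))) \<longlongrightarrow> 0)
      (at astar within A) \<and>
    ((\<lambda>a. eps a * Lp_norm p (u a) powr p) \<longlongrightarrow> (real CARD('n) + 1) / real CARD('n))
      (at astar within A) \<and>
    filterlim eps (at_right 0) (at astar within A)"
proof -
  note v = assms(2) and m = assms(4) and Q = assms(5) and A = assms(7) and min = assms(9) and eps = assms(10)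
  define N where "N = real CARD('n)"
  have N: "N > 0" by (simp add: N_def)
  have p: "p = 2 + 2 / N" and pD: "p = 2 + 2 / real DIM(real ^ 'n)" using assms(3) by (simp_all add: N_def)
  have p0: "p > 0" using N by (simp add: p add_pos_pos)
  have pN: "p / 2 = (N + 1) / N" using N by (simp add: p field_simps)
  have astar: "astar = mass Q" using assms(6) by (simp add: Lp_norm_2_sq)
  have astar0: "astar > 0" using is_QD(2)[OF Q] by (simp add: astar)
  let ?F = "at astar within A"
  have FA: "\<forall>\<^sub>F a in ?F. a \<in> A" by (simp add: eventually_at_filter)
  have Fl: "?F \<le> at_left astar" using A by (intro at_le) auto
  define e where "e a = energy m v p (u a)" for a
  define t where "t a = T v (u a)" for a
  define S where "S a = entropy (u a)" for a
  define P where "P a = power_integral p (u a)" for a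
  define k where "k a = kinetic m v (u a)" for a
  have a: "0 < a" "a < astar" if "a \<in> A" for a using A that by auto
  have uW: "u a \<in> W_half" and um: "mass (u a) = a" and E: "min_energy m v p a = ereal (e a)" if "a \<in> A" for a
    using min[OF that] by (auto simp: is_minimizer_def mass_sphere_iff e_def)
  have uH: "u a \<in> H_half" if "a \<in> A" for a using uW[OF that] by (simp add: W_half_def)
  have up: "integrable lborel (\<lambda>x. norm (u a x) powr p)" if "a \<in> A" for a
    unfolding pD by (rule is_Q_integrable_power[OF Q v uH[OF that]])
  have t0: "t a \<ge> 0" for a unfolding t_def by (rule T_nonneg[OF v])
  have eq: "e a = k a / 2 - P a / p - S a / 2 + a / 2" if "a \<in> A" for a
    using energy_eq[OF uW[OF that] p0, of m v] um[OF that] by (simp add: e_def k_def P_def S_def)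
  have k: "k a \<le> t a" "t a - 4 * m * astar \<le> k a" if "a \<in> A" for a
  proof -
    show "k a \<le> t a" unfolding k_def t_def by (rule kinetic_bounds(1)[OF uH[OF that] v m])
    have "t a - 4 * m * a \<le> k a"
      using kinetic_bounds(2)[OF uH[OF that] v m] um[OF that] by (simp add: k_def t_def)
    moreover have "4 * m * a \<le> 4 * m * astar" using a[OF that] m by simp
    ultimately show "t a - 4 * m * astar \<le> k a" by linarith
  qed
  have P: "P a \<le> p / 2 * t a" if "a \<in> A" for a
  proof -
    have "P a \<le> (N + 1) / (N * mass Q powr (1 / N)) * t a * a powr (1 / N)"
      using is_QD(5)[OF Q uH[OF that]] um[OF that] by (simp add: P_def t_def p N_def)
    also have "\<dots> \<le> (N + 1) / (N * mass Q powr (1 / N)) * t a * mass Q powr (1 / N)"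
      using a[OF that] N t0[of a] astar by (intro mult_left_mono powr_mono2) auto
    also have "\<dots> = p / 2 * t a"
    proof -
      have "mass Q powr (1 / N) > 0" using astar0 astar by simp
      thus ?thesis unfolding pN by simp
    qed
    finally show ?thesis .
  qed
  have P0: "P a \<ge> 0" for a by (simp add: P_def power_integral_nonneg)
  have Pp: "P a / p \<le> t a / 2" if "a \<in> A" for a using P[OF that] p0 by (simp add: field_simps)
  have lower: "- (2 * m * astar) - S a / 2 \<le> e a" if "a \<in> A" for a
    using eq[OF that] k[OF that] Pp[OF that] a[OF that] by simp
  define c where "c \<delta> = \<bar>N * (ln (N / \<delta>) - 1)\<bar> * astar" for \<delta>
  have S_le: "S a \<le> \<delta> * (p / 2 * t a) + c \<delta>" if "a \<in> A" "\<delta> > 0" for a \<delta>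
  proof -
    have "S a \<le> \<delta> * P a + N * (ln (N / \<delta>) - 1) * a"
      using entropy_le[OF uW[OF that(1)] pD up[OF that(1)] that(2)] um[OF that(1)] by (simp add: S_def P_def N_def)
    also have "\<dots> \<le> \<delta> * (p / 2 * t a) + c \<delta>"
      unfolding c_def using a[OF that(1)] that(2)
      by (intro add_mono mult_left_mono P that mult_mono) auto
    finally show ?thesis .
  qed

  have e_lim: "filterlim e at_bot ?F"
  proof -
    define g where "g a = T v Q / 2 + a * N / 2 * ln (1 - (a / astar) powr (1 / N)) - a / 2 * ln (a / astar) + \<bar>entropy Q\<bar> / 2 + a / 2" for a
    have e_le: "e a \<le> g a" if "a \<in> A" for a
      using min_energy_le_trial[OF Q v m pD a(1)[OF that] a(2)[OF that, unfolded astar]] E[OF that]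
      by (simp add: g_def N_def astar)
    have "filterlim g at_bot (at_left astar)"
    proof -
      have lim1: "((\<lambda>a. 1 - (a / astar) powr (1 / N)) \<longlongrightarrow> 1 - (astar / astar) powr (1 / N)) (at_left astar)"
        using astar0 by (intro tendsto_intros) auto
      have "filterlim (\<lambda>a. 1 - (a / astar) powr (1 / N)) (at_right 0) (at_left astar)"
        unfolding filterlim_at
      proof (intro conjI)
        show "((\<lambda>a. 1 - (a / astar) powr (1 / N)) \<longlongrightarrow> 0) (at_left astar)" using lim1 astar0 by simp
        show "\<forall>\<^sub>F a in at_left astar. 1 - (a / astar) powr (1 / N) \<in> {0<..} \<and> 1 - (a / astar) powr (1 / N) \<noteq> 0"
          using eventually_at_left_real[OF astar0]
        proof eventually_elim
          case (elim a)
          have "(a / astar) powr (1 / N) < 1 powr (1 / N)"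
            using elim astar0 N by (intro powr_less_mono2) auto
          thus ?case by simp
        qed
      qed
      hence ln_lim: "filterlim (\<lambda>a. ln (1 - (a / astar) powr (1 / N))) at_bot (at_left astar)"
        by (rule filterlim_compose[OF ln_at_0])
      have "((\<lambda>a. a * N / 2) \<longlongrightarrow> astar * N / 2) (at_left astar)" by (intro tendsto_intros) auto
      from filterlim_tendsto_pos_mult_at_bot[OF this _ ln_lim]
      have 1: "filterlim (\<lambda>a. a * N / 2 * ln (1 - (a / astar) powr (1 / N))) at_bot (at_left astar)"
        using astar0 N by simp
      have 2: "((\<lambda>a. T v Q / 2 - a / 2 * ln (a / astar) + \<bar>entropy Q\<bar> / 2 + a / 2) \<longlongrightarrow>
         T v Q / 2 - astar / 2 * ln (astar / astar) + \<bar>entropy Q\<bar> / 2 + astar / 2) (at_left astar)"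
        using astar0 by (intro tendsto_intros) auto
      from filterlim_tendsto_add_at_top[OF tendsto_minus[OF 2] 1[unfolded filterlim_uminus_at_bot]]
      show ?thesis unfolding filterlim_uminus_at_bot g_def by (simp add: algebra_simps)
    qed
    hence "filterlim g at_bot ?F" by (rule filterlim_mono[OF _ order.refl Fl])
    moreover have "\<forall>\<^sub>F a in ?F. e a \<le> g a" using FA by eventually_elim (rule e_le)
    ultimately show ?thesis by (rule filterlim_at_bot_mono)
  qed

  \<comment> \<open>The energy can only diverge through the entropy, and the entropy only through \<open>t\<close>.\<close>
  have S_lim: "filterlim S at_top ?F"
  proof (rule filterlim_at_top_mono)
    have "filterlim (\<lambda>a. - e a) at_top ?F" using e_lim by (simp add: filterlim_uminus_at_top)
    hence "filterlim (\<lambda>a. 2 * (- e a)) at_top ?F"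
      by (intro filterlim_tendsto_pos_mult_at_top[OF tendsto_const]) auto
    thus "filterlim (\<lambda>a. - (4 * m * astar) + 2 * (- e a)) at_top ?F"
      by (rule filterlim_tendsto_add_at_top[OF tendsto_const])
    show "\<forall>\<^sub>F a in ?F. - (4 * m * astar) + 2 * (- e a) \<le> S a"
      using FA
    proof eventually_elim
      case (elim a)
      show ?case using lower[OF elim] by simp
    qed
  qed
  have t_lim: "filterlim t at_top ?F"
  proof (rule filterlim_at_top_mono)
    have "filterlim (\<lambda>a. - c 1 + S a) at_top ?F" by (rule filterlim_tendsto_add_at_top[OF tendsto_const S_lim])
    thus "filterlim (\<lambda>a. 2 / p * (- c 1 + S a)) at_top ?F"
      using p0 by (intro filterlim_tendsto_pos_mult_at_top[OF tendsto_const]) auto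
    show "\<forall>\<^sub>F a in ?F. 2 / p * (- c 1 + S a) \<le> t a"
      using FA by eventually_elim (use S_le[of _ 1] p0 in \<open>auto simp: field_simps\<close>)
  qed
  have eps': "eps = (\<lambda>a. inverse (t a))" using eps by (auto simp: t_def)
  have eps_lim: "filterlim eps (at_right 0) ?F"
    unfolding eps' by (rule filterlim_compose[OF filterlim_inverse_at_right_top t_lim])
  have eps0: "(eps \<longlongrightarrow> 0) ?F" using eps_lim by (simp add: filterlim_at)
  have t_pos: "\<forall>\<^sub>F a in ?F. t a > 0" using t_lim by (simp add: filterlim_at_top_dense)
  have e_neg: "\<forall>\<^sub>F a in ?F. e a < 0" using e_lim by (simp add: filterlim_at_bot_dense)
  have S_pos: "\<forall>\<^sub>F a in ?F. S a > 0" using S_lim by (simp add: filterlim_at_top_dense)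

  have epsS: "((\<lambda>a. eps a * S a) \<longlongrightarrow> 0) ?F"
  proof (rule tendstoI)
    fix r :: real assume r: "r > 0"
    \<comment> \<open>Since \<open>P \<le> pt/2\<close>, this makes the coefficient of \<open>t\<close> in the bound for \<open>S\<close> equal to \<open>r/2\<close>.\<close>
    define \<delta> where "\<delta> = r / p"
    have \<delta>: "\<delta> > 0" "\<delta> * (p / 2) = r / 2" using r p0 by (auto simp: \<delta>_def)
    have "((\<lambda>a. eps a * c \<delta>) \<longlongrightarrow> 0 * c \<delta>) ?F" by (intro tendsto_intros eps0)
    hence "\<forall>\<^sub>F a in ?F. eps a * c \<delta> < r / 2" using r by (intro order_tendstoD(2)) auto
    thus "\<forall>\<^sub>F a in ?F. dist (eps a * S a) 0 < r"
      using FA t_pos S_pos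
    proof eventually_elim
      case (elim a)
      have "eps a * S a \<le> eps a * (\<delta> * (p / 2 * t a) + c \<delta>)"
        using elim by (intro mult_left_mono S_le \<delta>) (auto simp: eps')
      also have "\<dots> = r / 2 + eps a * c \<delta>"
        using elim \<delta>(2) by (simp add: eps' field_simps)
      finally have "eps a * S a < r" using elim by simp
      moreover have "eps a * S a \<ge> 0" using elim by (simp add: eps')
      ultimately show ?case by (simp add: dist_real_def)
    qed
  qed
  have epse: "((\<lambda>a. eps a * e a) \<longlongrightarrow> 0) ?F"
  proof (rule tendsto_sandwich)
    have "((\<lambda>a. - (eps a * (2 * m * astar)) - eps a * S a / 2) \<longlongrightarrow> - (0 * (2 * m * astar)) - 0 / 2) ?F"
      by (intro tendsto_intros eps0 epsS) auto
    thus "((\<lambda>a. - (eps a * (2 * m * astar)) - eps a * S a / 2) \<longlongrightarrow> 0) ?F" by simp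
    show "\<forall>\<^sub>F a in ?F. - (eps a * (2 * m * astar)) - eps a * S a / 2 \<le> eps a * e a"
      using FA t_pos
    proof eventually_elim
      case (elim a)
      have "eps a * (- (2 * m * astar) - S a / 2) \<le> eps a * e a"
        using elim by (intro mult_left_mono lower) (auto simp: eps')
      thus ?case by (simp add: algebra_simps)
    qed
    show "\<forall>\<^sub>F a in ?F. eps a * e a \<le> 0"
      using t_pos e_neg by eventually_elim (auto simp: eps' mult_nonneg_nonpos)
  qed auto
  have epsk: "((\<lambda>a. eps a * k a) \<longlongrightarrow> 1) ?F"
  proof (rule tendsto_sandwich)
    have "((\<lambda>a. 1 - eps a * (4 * m * astar)) \<longlongrightarrow> 1 - 0 * (4 * m * astar)) ?F"
      by (intro tendsto_intros eps0)
    thus "((\<lambda>a. 1 - eps a * (4 * m * astar)) \<longlongrightarrow> 1) ?F" by simp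
    show "\<forall>\<^sub>F a in ?F. 1 - eps a * (4 * m * astar) \<le> eps a * k a"
      using FA t_pos
    proof eventually_elim
      case (elim a)
      have "eps a * (t a - 4 * m * astar) \<le> eps a * k a"
        using elim by (intro mult_left_mono k) (auto simp: eps')
      moreover have "eps a * t a = 1" using elim by (simp add: eps')
      ultimately show ?case by (simp add: right_diff_distrib)
    qed
    show "\<forall>\<^sub>F a in ?F. eps a * k a \<le> 1"
      using FA t_pos
    proof eventually_elim
      case (elim a)
      have "eps a * k a \<le> eps a * t a"
        using elim by (intro mult_left_mono k) (auto simp: eps')
      thus ?case using elim by (simp add: eps')
    qed
  qed auto
  have epsP: "((\<lambda>a. eps a * P a) \<longlongrightarrow> (N + 1) / N) ?F"
  proof -
    have "((\<lambda>a. p * (eps a * k a / 2 - eps a * e a - eps a * S a / 2 + eps a * a / 2)) \<longlongrightarrow>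
       p * (1 / 2 - 0 - 0 / 2 + 0 * astar / 2)) ?F"
      by (intro tendsto_intros eps0 epsS epse epsk) auto
    hence "((\<lambda>a. p * (eps a * k a / 2 - eps a * e a - eps a * S a / 2 + eps a * a / 2)) \<longlongrightarrow> (N + 1) / N) ?F"
      unfolding pN[symmetric] by simp
    moreover have "\<forall>\<^sub>F a in ?F. p * (eps a * k a / 2 - eps a * e a - eps a * S a / 2 + eps a * a / 2) = eps a * P a"
      using FA
    proof eventually_elim
      case (elim a)
      have P_eq: "P a = p * (k a / 2 - e a - S a / 2 + a / 2)" using eq[OF elim] p0 by (simp add: field_simps)
      show ?case unfolding P_eq by (simp add: algebra_simps)
    qed
    ultimately show ?thesis by (rule Lim_transform_eventually)
  qed
  show ?thesis
  proof (intro conjI)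
    have "((\<lambda>a. ereal (e a)) \<longlongrightarrow> - \<infinity>) ?F"
      using e_lim by (simp add: tendsto_MInfty filterlim_at_bot_dense)
    moreover have "\<forall>\<^sub>F a in ?F. ereal (e a) = min_energy m v p a"
      using FA by eventually_elim (simp add: E)
    ultimately show "(min_energy m v p \<longlongrightarrow> - \<infinity>) ?F" by (rule Lim_transform_eventually)
    have "((\<lambda>a. ereal (eps a * e a)) \<longlongrightarrow> ereal 0) ?F" using epse by (rule tendsto_ereal)
    moreover have "\<forall>\<^sub>F a in ?F. ereal (eps a * e a) = ereal (eps a) * min_energy m v p a"
      using FA by eventually_elim (simp add: E)
    ultimately show "((\<lambda>a. ereal (eps a) * min_energy m v p a) \<longlongrightarrow> 0) ?F"
      unfolding zero_ereal_def by (rule Lim_transform_eventually)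
    show "((\<lambda>a. eps a * (LINT x|lborel. (norm (u a x))\<^sup>2 * ln ((norm (u a x))\<^sup>2))) \<longlongrightarrow> 0) ?F"
      using epsS unfolding S_def entropy_def .
    show "((\<lambda>a. eps a * Lp_norm p (u a) powr p) \<longlongrightarrow> (real CARD('n) + 1) / real CARD('n)) ?F"
      using epsP unfolding P_def N_def by (simp only: Lp_norm_powr[OF p0])
    show "filterlim eps (at_right 0) ?F" by (rule eps_lim)
  qed
qed

end
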